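(* Let $\gamma_1,\delta_1>0$ and $\gamma,\gamma_2,\delta_2\in\mathbb{R}$. There is a constant $c>0$, depending only on these coefficients, such that the following holds. Let $\sigma_0>0$ and let $\eta_0\in H^{\sigma_0,2}(\mathbb{R})$ be real-valued. Then, with existence time $$T= c\left(1+\|\eta_0\|_{H^{\sigma_0,2}(\mathbb{R})}\right)^{-2},$$ there exists a unique solution $$\eta\in C([0,T];H^{\sigma_0,2}(\mathbb{R}))$$ of the Cauchy problem $$\partial_t\eta+\partial_x\eta-\gamma_1\partial_t\partial_x^2\eta+\gamma_2\partial_x^3\eta+\delta_1\partial_t\partial_x^4\eta+\delta_2\partial_x^5\eta=-\tfrac34\partial_x(\eta^2)-\gamma\partial_x^3(\eta^2)+\tfrac{7}{48}\partial_x(\eta_x^2)+\tfrac18\partial_x(\eta^3),\qquad \eta(x,0)=\eta_0(x).$$ Moreover, the data-to-solution map $\eta_0\mapsto\eta$ is continuous from $H^{\sigma_0,2}(\mathbb{R})$ to $C([0,T];H^{\sigma_0,2}(\mathbb{R}))$; that is, for every $R>0$, with $T=c(1+R)^{-2}$, it is continuous from $\{\eta_0\in H^{\sigma_0,2}(\mathbb{R}):\|\eta_0\|_{H^{\sigma_0,2}(\mathbb{R})}\le R\}$ to $C([0,T];H^{\sigma_0,2}(\mathbb{R}))$.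
   Context: The unknown $\eta=\eta(x,t)$ is real-valued, $x\in\mathbb{R}$. Modified Gevrey space: for $\sigma\ge0$ and $s\in\mathbb{R}$, $H^{\sigma,s}(\mathbb{R})$ is the space of $f$ with finite norm $$\|f\|_{H^{\sigma,s}(\mathbb{R})}=\big\|\cosh(\sigma|\xi|)\,\langle\xi\rangle^s\,\widehat f(\xi)\big\|_{L^2_\xi(\mathbb{R})},\qquad \langle\xi\rangle=\sqrt{1+\xi^2},$$ where $\widehat f(\xi)=\int_{\mathbb R} e^{-ix\xi}f(x)\,dx$. Notion of solution: with $\varphi(\xi)=1+\gamma_1\xi^2+\delta_1\xi^4$, $$\phi(\xi)=\frac{\xi(1-\gamma_2\xi^2+\delta_2\xi^4)}{\varphi(\xi)},\quad \tau(\xi)=\frac{\xi(3-4\gamma\xi^2)}{4\varphi(\xi)},\quad \psi(\xi)=\frac{\xi}{\varphi(\xi)},$$ and $\phi(D),\tau(D),\psi(D)$ the corresponding Fourier multipliers ($D=-i\partial_x$), a solution of the Cauchy problem on $[0,T]$ is a function satisfying, for $0\le t\le T$, the integral equation $$\eta(t)=e^{-it\phi(D)}\eta_0-i\int_0^t e^{-i(t-s)\phi(D)}F(\eta)(s)\,ds,\qquad F(\eta)=\tau(D)\eta^2-\tfrac{7}{48}\psi(D)\eta_x^2-\tfrac18\psi(D)\eta^3 .$$ *)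

theory Defs
  imports "HOL-Analysis.Analysis"
begin

section \<open>The Hilbert space \<open>L\<^sup>2(\<real>)\<close> of complex-valued functions\<close>

definition sq_int :: "(real \<Rightarrow> complex) \<Rightarrow> bool" where
  "sq_int f \<longleftrightarrow> f \<in> borel_measurable lborel \<and> integrable lborel (\<lambda>x. (cmod (f x))\<^sup>2)"

lemma sq_int_zero: "sq_int (\<lambda>_. 0)"
  by (simp add: sq_int_def)

lemma sq_int_add:
  assumes "sq_int f" "sq_int g"
  shows "sq_int (\<lambda>x. f x + g x)"
proof -
  have m: "f \<in> borel_measurable lborel" "g \<in> borel_measurable lborel"
    using assms by (auto simp: sq_int_def)
  have "integrable lborel (\<lambda>x. 2 * (cmod (f x))\<^sup>2 + 2 * (cmod (g x))\<^sup>2)"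
    using assms by (auto simp: sq_int_def)
  then have "integrable lborel (\<lambda>x. (cmod (f x + g x))\<^sup>2)"
  proof (rule Bochner_Integration.integrable_bound)
    show "(\<lambda>x. (cmod (f x + g x))\<^sup>2) \<in> borel_measurable lborel"
      using m by measurable
    have "(cmod (f x + g x))\<^sup>2 \<le> 2 * (cmod (f x))\<^sup>2 + 2 * (cmod (g x))\<^sup>2" for x
    proof -
      have "(cmod (f x + g x))\<^sup>2 \<le> (cmod (f x) + cmod (g x))\<^sup>2"
        by (intro power_mono norm_triangle_ineq norm_ge_zero)
      also have "\<dots> \<le> 2 * (cmod (f x))\<^sup>2 + 2 * (cmod (g x))\<^sup>2"
        using sum_squares_bound[of "cmod (f x)" "cmod (g x)"] by (simp add: power2_sum)
      finally show ?thesis .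
    qed
    then show "AE x in lborel. norm ((cmod (f x + g x))\<^sup>2)
        \<le> norm (2 * (cmod (f x))\<^sup>2 + 2 * (cmod (g x))\<^sup>2)"
      by simp
  qed
  with m show ?thesis by (simp add: sq_int_def)
qed

lemma sq_int_cmult:
  assumes "sq_int f"
  shows "sq_int (\<lambda>x. c * f x)"
  using assms by (auto simp: sq_int_def norm_mult power_mult_distrib)

lemma sq_int_uminus: "sq_int f \<Longrightarrow> sq_int (\<lambda>x. - f x)"
  using sq_int_cmult[of f "-1"] by simp

lemma sq_int_diff: "sq_int f \<Longrightarrow> sq_int g \<Longrightarrow> sq_int (\<lambda>x. f x - g x)"
  using sq_int_add[of f "\<lambda>x. - g x"] sq_int_uminus[of g] by simp

lemma sq_int_scaleR: "sq_int f \<Longrightarrow> sq_int (\<lambda>x. r *\<^sub>R f x)"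
  using sq_int_cmult[of f "of_real r"] by (simp add: scaleR_conv_of_real)

lemma integrable_inner_sq_int:
  assumes "sq_int f" "sq_int g"
  shows "integrable lborel (\<lambda>x. f x \<bullet> g x)"
proof -
  have m: "f \<in> borel_measurable lborel" "g \<in> borel_measurable lborel"
    using assms by (auto simp: sq_int_def)
  have "integrable lborel (\<lambda>x. (cmod (f x))\<^sup>2 + (cmod (g x))\<^sup>2)"
    using assms by (auto simp: sq_int_def)
  then show ?thesis
  proof (rule Bochner_Integration.integrable_bound)
    show "(\<lambda>x. f x \<bullet> g x) \<in> borel_measurable lborel"
      using m by measurable
    have "\<bar>f x \<bullet> g x\<bar> \<le> (cmod (f x))\<^sup>2 + (cmod (g x))\<^sup>2" for x
    proof -
      have "\<bar>f x \<bullet> g x\<bar> \<le> cmod (f x) * cmod (g x)"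
        by (rule Cauchy_Schwarz_ineq2)
      also have "\<dots> \<le> 2 * cmod (f x) * cmod (g x)"
        by simp
      also have "\<dots> \<le> (cmod (f x))\<^sup>2 + (cmod (g x))\<^sup>2"
        by (rule sum_squares_bound)
      finally show ?thesis .
    qed
    then show "AE x in lborel. norm (f x \<bullet> g x) \<le> norm ((cmod (f x))\<^sup>2 + (cmod (g x))\<^sup>2)"
      by simp
  qed
qed

definition l2_rel :: "(real \<Rightarrow> complex) \<Rightarrow> (real \<Rightarrow> complex) \<Rightarrow> bool" where
  "l2_rel f g \<longleftrightarrow> sq_int f \<and> sq_int g \<and> (AE x in lborel. f x = g x)"

quotient_type l2 = "real \<Rightarrow> complex" / partial: l2_rel
proof (rule part_equivpI)
  show "\<exists>f. l2_rel f f"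
    using sq_int_zero by (auto simp: l2_rel_def)
  show "symp l2_rel"
    by (auto simp: symp_def l2_rel_def)
  show "transp l2_rel"
    unfolding transp_def l2_rel_def by (auto elim: AE_mp)
qed

instantiation l2 :: real_inner
begin

lift_definition zero_l2 :: l2 is "\<lambda>_. 0"
  by (simp add: l2_rel_def sq_int_zero)

lift_definition plus_l2 :: "l2 \<Rightarrow> l2 \<Rightarrow> l2" is "\<lambda>f g x. f x + g x"
  by (auto simp: l2_rel_def intro: sq_int_add)

lift_definition minus_l2 :: "l2 \<Rightarrow> l2 \<Rightarrow> l2" is "\<lambda>f g x. f x - g x"
  by (auto simp: l2_rel_def intro: sq_int_diff)

lift_definition uminus_l2 :: "l2 \<Rightarrow> l2" is "\<lambda>f x. - f x"
  by (auto simp: l2_rel_def intro: sq_int_uminus)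

lift_definition scaleR_l2 :: "real \<Rightarrow> l2 \<Rightarrow> l2" is "\<lambda>r f x. r *\<^sub>R f x"
  by (auto simp: l2_rel_def intro: sq_int_scaleR)

text \<open>On \<^typ>\<open>complex\<close> the operation \<open>z \<bullet> w\<close> is the real part of \<open>z\<close> times the
  conjugate of \<open>w\<close>, so this is the real part of the usual sesquilinear form and
  it induces the usual norm.\<close>

lift_definition inner_l2 :: "l2 \<Rightarrow> l2 \<Rightarrow> real" is "\<lambda>f g. \<integral>x. f x \<bullet> g x \<partial>lborel"
proof -
  fix f f' g g' assume *: "l2_rel f f'" "l2_rel g g'"
  then have "AE x in lborel. f x \<bullet> g x = f' x \<bullet> g' x"
    by (auto simp: l2_rel_def)
  then show "(\<integral>x. f x \<bullet> g x \<partial>lborel) = (\<integral>x. f' x \<bullet> g' x \<partial>lborel)"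
    using * by (intro integral_cong_AE) (auto simp: l2_rel_def sq_int_def)
qed

definition norm_l2 :: "l2 \<Rightarrow> real" where "norm_l2 u = sqrt (u \<bullet> u)"
definition sgn_l2 :: "l2 \<Rightarrow> l2" where "sgn_l2 u = inverse (norm u) *\<^sub>R u"
definition dist_l2 :: "l2 \<Rightarrow> l2 \<Rightarrow> real" where "dist_l2 u v = norm (u - v)"
definition uniformity_l2 :: "(l2 \<times> l2) filter" where
  "uniformity_l2 = (INF e\<in>{0<..}. principal {(u, v). dist u v < e})"
definition open_l2 :: "l2 set \<Rightarrow> bool" where
  "open_l2 U \<longleftrightarrow> (\<forall>u\<in>U. \<forall>\<^sub>F (u', v) in uniformity. u' = u \<longrightarrow> v \<in> U)"

instance
proof
  fix u v w :: l2 and r s :: real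
  show "u + v + w = u + (v + w)"
    by transfer (auto simp: l2_rel_def add.assoc intro!: sq_int_add)
  show "u + v = v + u"
    by transfer (auto simp: l2_rel_def add.commute intro!: sq_int_add)
  show "0 + u = u"
    by transfer (auto simp: l2_rel_def)
  show "- u + u = 0"
    by transfer (auto simp: l2_rel_def sq_int_zero)
  show "u - v = u + - v"
    by transfer (auto simp: l2_rel_def intro: sq_int_diff)
  show "r *\<^sub>R (u + v) = r *\<^sub>R u + r *\<^sub>R v"
    by transfer (auto simp: l2_rel_def scaleR_add_right intro!: sq_int_add sq_int_scaleR)
  show "(r + s) *\<^sub>R u = r *\<^sub>R u + s *\<^sub>R u"
    by transfer (auto simp: l2_rel_def scaleR_add_left intro!: sq_int_add sq_int_scaleR)
  show "r *\<^sub>R s *\<^sub>R u = (r * s) *\<^sub>R u"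
    by transfer (auto simp: l2_rel_def intro!: sq_int_scaleR)
  show "1 *\<^sub>R u = u"
    by transfer (auto simp: l2_rel_def)
  show "u \<bullet> v = v \<bullet> u"
    by transfer (simp add: inner_commute)
  show "(u + v) \<bullet> w = u \<bullet> w + v \<bullet> w"
    by transfer
      (auto simp: l2_rel_def inner_add_left
        intro!: Bochner_Integration.integral_add integrable_inner_sq_int)
  show "(r *\<^sub>R u) \<bullet> v = r * (u \<bullet> v)"
    by transfer (simp add: l2_rel_def)
  show "0 \<le> u \<bullet> u"
    by transfer (simp add: l2_rel_def)
  show "(u \<bullet> u = 0) = (u = 0)"
  proof (transfer, goal_cases)
    case (1 f)
    then have f: "sq_int f" by (simp add: l2_rel_def)
    then have "(\<integral>x. f x \<bullet> f x \<partial>lborel) = 0 \<longleftrightarrow> (AE x in lborel. f x \<bullet> f x = 0)"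
      by (intro integral_nonneg_eq_0_iff_AE integrable_inner_sq_int) auto
    with f show ?case by (simp add: l2_rel_def sq_int_zero)
  qed
qed (simp_all add: norm_l2_def sgn_l2_def dist_l2_def uniformity_l2_def open_l2_def)

end

lift_definition l2_cscale :: "complex \<Rightarrow> l2 \<Rightarrow> l2" is "\<lambda>c f x. c * f x"
  by (auto simp: l2_rel_def intro: sq_int_cmult)

text \<open>Pointwise product, with the value \<open>0\<close> when the product is not square-integrable.\<close>

lift_definition l2_mult :: "l2 \<Rightarrow> l2 \<Rightarrow> l2" is
  "\<lambda>f g. if sq_int (\<lambda>x. f x * g x) then (\<lambda>x. f x * g x) else (\<lambda>_. 0)"
proof -
  fix f f' g g' assume *: "l2_rel f f'" "l2_rel g g'"
  then have m: "f \<in> borel_measurable lborel" "f' \<in> borel_measurable lborel"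
      "g \<in> borel_measurable lborel" "g' \<in> borel_measurable lborel"
    by (auto simp: l2_rel_def sq_int_def)
  from * have ae: "AE x in lborel. f x * g x = f' x * g' x"
    by (auto simp: l2_rel_def)
  have "integrable lborel (\<lambda>x. (cmod (f x * g x))\<^sup>2) \<longleftrightarrow>
      integrable lborel (\<lambda>x. (cmod (f' x * g' x))\<^sup>2)"
  proof (rule integrable_cong_AE)
    show "AE x in lborel. (cmod (f x * g x))\<^sup>2 = (cmod (f' x * g' x))\<^sup>2"
      using ae by eventually_elim simp
  qed (use m in measurable)
  then have "sq_int (\<lambda>x. f x * g x) \<longleftrightarrow> sq_int (\<lambda>x. f' x * g' x)"
    using m by (simp add: sq_int_def)
  with ae show "l2_rel
      (if sq_int (\<lambda>x. f x * g x) then \<lambda>x. f x * g x else (\<lambda>_. 0))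
      (if sq_int (\<lambda>x. f' x * g' x) then \<lambda>x. f' x * g' x else (\<lambda>_. 0))"
    by (auto simp: l2_rel_def sq_int_zero)
qed

definition real_valued :: "l2 \<Rightarrow> bool" where
  "real_valued u \<longleftrightarrow> (AE x in lborel. rep_l2 u x \<in> \<real>)"


section \<open>Fourier transform and Fourier multipliers\<close>

text \<open>The integral of \<open>e\<^sup>-\<^sup>i\<^sup>x\<^sup>\<xi> f(x)\<close> over \<open>\<real>\<close> need not converge absolutely for
  \<open>f\<close> in \<open>L\<^sup>2\<close>; as usual it is the \<open>L\<^sup>2\<close>-limit, for \<open>N \<rightarrow> \<infinity>\<close>, of the integrals
  over \<open>[-N, N]\<close> (Plancherel).\<close>

lift_definition has_fourier :: "l2 \<Rightarrow> l2 \<Rightarrow> bool" is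
  "\<lambda>f g. ((\<lambda>N. \<integral>\<^sup>+\<xi>. ennreal ((cmod ((LINT x:{-N..N}|lborel. cis (- (x * \<xi>)) * f x) - g \<xi>))\<^sup>2)
      \<partial>lborel) \<longlongrightarrow> 0) at_top"
proof -
  fix f f' g g' assume *: "l2_rel f f'" "l2_rel g g'"
  then have m: "f \<in> borel_measurable borel" "f' \<in> borel_measurable borel"
    by (auto simp: l2_rel_def sq_int_def)
  have mc: "(\<lambda>x. cis (- (x * \<xi>))) \<in> borel_measurable borel" for \<xi> :: real
    by (intro borel_measurable_continuous_onI continuous_intros)
  have 1: "(LINT x:{-N..N}|lborel. cis (- (x * \<xi>)) * f x) =
      (LINT x:{-N..N}|lborel. cis (- (x * \<xi>)) * f' x)" for N \<xi> :: real
    unfolding set_lebesgue_integral_def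
  proof (rule integral_cong_AE)
    show "AE x in lborel. indicat_real {-N..N} x *\<^sub>R (cis (- (x * \<xi>)) * f x) =
        indicat_real {-N..N} x *\<^sub>R (cis (- (x * \<xi>)) * f' x)"
      using * by (auto simp: l2_rel_def)
  qed (use m mc in measurable)
  have "(\<integral>\<^sup>+\<xi>. ennreal ((cmod ((LINT x:{-N..N}|lborel. cis (- (x * \<xi>)) * f x) - g \<xi>))\<^sup>2) \<partial>lborel) =
      (\<integral>\<^sup>+\<xi>. ennreal ((cmod ((LINT x:{-N..N}|lborel. cis (- (x * \<xi>)) * f' x) - g' \<xi>))\<^sup>2) \<partial>lborel)"
    for N :: real
  proof (rule nn_integral_cong_AE)
    have "AE \<xi> in lborel. g \<xi> = g' \<xi>"
      using * by (simp add: l2_rel_def)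
    then show "AE \<xi> in lborel.
        ennreal ((cmod ((LINT x:{-N..N}|lborel. cis (- (x * \<xi>)) * f x) - g \<xi>))\<^sup>2) =
        ennreal ((cmod ((LINT x:{-N..N}|lborel. cis (- (x * \<xi>)) * f' x) - g' \<xi>))\<^sup>2)"
      by eventually_elim (simp add: 1)
  qed
  then show "((\<lambda>N. \<integral>\<^sup>+\<xi>. ennreal ((cmod ((LINT x:{-N..N}|lborel. cis (- (x * \<xi>)) * f x) - g \<xi>))\<^sup>2)
        \<partial>lborel) \<longlongrightarrow> 0) at_top =
      ((\<lambda>N. \<integral>\<^sup>+\<xi>. ennreal ((cmod ((LINT x:{-N..N}|lborel. cis (- (x * \<xi>)) * f' x) - g' \<xi>))\<^sup>2)
        \<partial>lborel) \<longlongrightarrow> 0) at_top"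
    by simp
qed

definition fourier :: "l2 \<Rightarrow> l2" where
  "fourier u = (THE v. has_fourier u v)"

text \<open>\<open>m(D)u\<close>, with \<open>D = -i \<partial>\<^sub>x\<close>; meaningful when \<open>m\<close> times the transform of \<open>u\<close> is
  in \<open>L\<^sup>2\<close>.\<close>

definition fourier_mult :: "(real \<Rightarrow> complex) \<Rightarrow> l2 \<Rightarrow> l2" where
  "fourier_mult m u =
    (THE v. AE \<xi> in lborel. rep_l2 (fourier v) \<xi> = m \<xi> * rep_l2 (fourier u) \<xi>)"

definition l2_deriv :: "l2 \<Rightarrow> l2" where
  "l2_deriv = fourier_mult (\<lambda>\<xi>. \<i> * of_real \<xi>)"


section \<open>Modified Gevrey spaces\<close>

definition jbracket :: "real \<Rightarrow> real" where
  "jbracket \<xi> = sqrt (1 + \<xi>\<^sup>2)"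

definition gevrey_weighted :: "real \<Rightarrow> real \<Rightarrow> l2 \<Rightarrow> real \<Rightarrow> complex" where
  "gevrey_weighted \<sigma> s u \<xi> =
    of_real (cosh (\<sigma> * \<bar>\<xi>\<bar>) * jbracket \<xi> powr s) * rep_l2 (fourier u) \<xi>"

text \<open>As \<open>l2\<close> is the ambient space, this is the full space of tempered distributions of
  finite norm only if \<open>\<sigma> > 0\<close> or \<open>s \<ge> 0\<close>, when finite norm entails
  square-integrability.\<close>

definition gevrey :: "real \<Rightarrow> real \<Rightarrow> l2 set" where
  "gevrey \<sigma> s = {u. sq_int (gevrey_weighted \<sigma> s u)}"

definition gevrey_norm :: "real \<Rightarrow> real \<Rightarrow> l2 \<Rightarrow> real" where
  "gevrey_norm \<sigma> s u = sqrt (\<integral>\<xi>. (cmod (gevrey_weighted \<sigma> s u \<xi>))\<^sup>2 \<partial>lborel)"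

text \<open>\<open>C([0,T]; H\<^sup>\<sigma>\<^sup>,\<^sup>s)\<close>. Functions of time are made \<open>undefined\<close> outside \<open>[0,T]\<close>, so that
  equality of two of them means equality on \<open>[0,T]\<close>.\<close>

definition C_gevrey :: "real \<Rightarrow> real \<Rightarrow> real \<Rightarrow> (real \<Rightarrow> l2) set" where
  "C_gevrey T \<sigma> s = {\<eta> \<in> extensional {0..T}. (\<forall>t\<in>{0..T}. \<eta> t \<in> gevrey \<sigma> s) \<and>
    (\<forall>t\<in>{0..T}. ((\<lambda>r. gevrey_norm \<sigma> s (\<eta> r - \<eta> t)) \<longlongrightarrow> 0) (at t within {0..T}))}"

definition C_gevrey_dist :: "real \<Rightarrow> real \<Rightarrow> real \<Rightarrow> (real \<Rightarrow> l2) \<Rightarrow> (real \<Rightarrow> l2) \<Rightarrow> real" where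
  "C_gevrey_dist T \<sigma> s \<eta> \<zeta> = (SUP t\<in>{0..T}. gevrey_norm \<sigma> s (\<eta> t - \<zeta> t))"


section \<open>The Cauchy problem\<close>

definition varphi_sym :: "real \<Rightarrow> real \<Rightarrow> real \<Rightarrow> real" where
  "varphi_sym \<gamma>\<^sub>1 \<delta>\<^sub>1 \<xi> = 1 + \<gamma>\<^sub>1 * \<xi>^2 + \<delta>\<^sub>1 * \<xi>^4"

definition phi_sym :: "real \<Rightarrow> real \<Rightarrow> real \<Rightarrow> real \<Rightarrow> real \<Rightarrow> real" where
  "phi_sym \<gamma>\<^sub>1 \<delta>\<^sub>1 \<gamma>\<^sub>2 \<delta>\<^sub>2 \<xi> = \<xi> * (1 - \<gamma>\<^sub>2 * \<xi>^2 + \<delta>\<^sub>2 * \<xi>^4) / varphi_sym \<gamma>\<^sub>1 \<delta>\<^sub>1 \<xi>"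

definition tau_sym :: "real \<Rightarrow> real \<Rightarrow> real \<Rightarrow> real \<Rightarrow> real" where
  "tau_sym \<gamma>\<^sub>1 \<delta>\<^sub>1 \<gamma> \<xi> = \<xi> * (3 - 4 * \<gamma> * \<xi>^2) / (4 * varphi_sym \<gamma>\<^sub>1 \<delta>\<^sub>1 \<xi>)"

definition psi_sym :: "real \<Rightarrow> real \<Rightarrow> real \<Rightarrow> real" where
  "psi_sym \<gamma>\<^sub>1 \<delta>\<^sub>1 \<xi> = \<xi> / varphi_sym \<gamma>\<^sub>1 \<delta>\<^sub>1 \<xi>"

definition lin_group :: "real \<Rightarrow> real \<Rightarrow> real \<Rightarrow> real \<Rightarrow> real \<Rightarrow> l2 \<Rightarrow> l2" where
  "lin_group \<gamma>\<^sub>1 \<delta>\<^sub>1 \<gamma>\<^sub>2 \<delta>\<^sub>2 t = fourier_mult (\<lambda>\<xi>. cis (- (t * phi_sym \<gamma>\<^sub>1 \<delta>\<^sub>1 \<gamma>\<^sub>2 \<delta>\<^sub>2 \<xi>)))"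

definition nonlin :: "real \<Rightarrow> real \<Rightarrow> real \<Rightarrow> l2 \<Rightarrow> l2" where
  "nonlin \<gamma>\<^sub>1 \<delta>\<^sub>1 \<gamma> \<eta> =
    fourier_mult (\<lambda>\<xi>. of_real (tau_sym \<gamma>\<^sub>1 \<delta>\<^sub>1 \<gamma> \<xi>)) (l2_mult \<eta> \<eta>)
    - (7/48) *\<^sub>R fourier_mult (\<lambda>\<xi>. of_real (psi_sym \<gamma>\<^sub>1 \<delta>\<^sub>1 \<xi>)) (l2_mult (l2_deriv \<eta>) (l2_deriv \<eta>))
    - (1/8) *\<^sub>R fourier_mult (\<lambda>\<xi>. of_real (psi_sym \<gamma>\<^sub>1 \<delta>\<^sub>1 \<xi>)) (l2_mult \<eta> (l2_mult \<eta> \<eta>))"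

text \<open>The Cauchy problem is understood through its integral (Duhamel) formulation. The time
  integral is taken in \<open>L\<^sup>2\<close>, into which \<open>H\<^sup>\<sigma>\<^sup>,\<^sup>2\<close> embeds continuously, and \<^const>\<open>integral\<close>
  agrees with the Riemann and Bochner integrals for continuous integrands.\<close>

definition is_solution ::
  "real \<Rightarrow> real \<Rightarrow> real \<Rightarrow> real \<Rightarrow> real \<Rightarrow> real \<Rightarrow> real \<Rightarrow> l2 \<Rightarrow> (real \<Rightarrow> l2) \<Rightarrow> bool" where
  "is_solution \<gamma>\<^sub>1 \<delta>\<^sub>1 \<gamma> \<gamma>\<^sub>2 \<delta>\<^sub>2 \<sigma> T \<eta>\<^sub>0 \<eta> \<longleftrightarrow>
    \<eta> \<in> C_gevrey T \<sigma> 2 \<and>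
    (\<forall>t\<in>{0..T}. real_valued (\<eta> t)) \<and>
    (\<forall>t\<in>{0..T}.
      (\<lambda>s. lin_group \<gamma>\<^sub>1 \<delta>\<^sub>1 \<gamma>\<^sub>2 \<delta>\<^sub>2 (t - s) (nonlin \<gamma>\<^sub>1 \<delta>\<^sub>1 \<gamma> (\<eta> s))) integrable_on {0..t} \<and>
      \<eta> t = lin_group \<gamma>\<^sub>1 \<delta>\<^sub>1 \<gamma>\<^sub>2 \<delta>\<^sub>2 t \<eta>\<^sub>0
        - l2_cscale \<i> (integral {0..t}
            (\<lambda>s. lin_group \<gamma>\<^sub>1 \<delta>\<^sub>1 \<gamma>\<^sub>2 \<delta>\<^sub>2 (t - s) (nonlin \<gamma>\<^sub>1 \<delta>\<^sub>1 \<gamma> (\<eta> s)))))"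

definition solution_map ::
  "real \<Rightarrow> real \<Rightarrow> real \<Rightarrow> real \<Rightarrow> real \<Rightarrow> real \<Rightarrow> real \<Rightarrow> l2 \<Rightarrow> (real \<Rightarrow> l2)" where
  "solution_map \<gamma>\<^sub>1 \<delta>\<^sub>1 \<gamma> \<gamma>\<^sub>2 \<delta>\<^sub>2 \<sigma> T \<eta>\<^sub>0 = (THE \<eta>. is_solution \<gamma>\<^sub>1 \<delta>\<^sub>1 \<gamma> \<gamma>\<^sub>2 \<delta>\<^sub>2 \<sigma> T \<eta>\<^sub>0 \<eta>)"

definition data_ball :: "real \<Rightarrow> real \<Rightarrow> l2 set" where
  "data_ball \<sigma> R = {\<eta>\<^sub>0 \<in> gevrey \<sigma> 2. real_valued \<eta>\<^sub>0 \<and> gevrey_norm \<sigma> 2 \<eta>\<^sub>0 \<le> R}"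

end

theory Submission
  imports Defs "HOL-Probability.Characteristic_Functions" "HOL-Probability.Sinc_Integral"
begin

text \<open>Since \<open>\<tau>(D)\<close> gains one derivative and \<open>\<psi>(D)\<close> three, \<open>F\<close> maps \<open>H\<^sup>\<sigma>\<^sup>,\<^sup>2\<close> to itself as soon as
  the product maps \<open>H\<^sup>\<sigma>\<^sup>,\<^sup>s\<^sup>+\<^sup>1 \<times> H\<^sup>\<sigma>\<^sup>,\<^sup>s\<^sup>+\<^sup>1\<close> to \<open>H\<^sup>\<sigma>\<^sup>,\<^sup>s\<close>. On the Fourier side this is Young's inequality:
  \<open>cosh (a + b) \<le> 2 cosh a cosh b\<close> and \<open>\<langle>\<xi> + \<eta>\<rangle> \<le> \<surd>2 \<langle>\<xi>\<rangle> \<langle>\<eta>\<rangle>\<close> distribute the weight over the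
  factors, and the spare power of \<open>\<langle>\<xi>\<rangle>\<close> makes one factor integrable. No constant depends on \<open>\<sigma>\<close>.
  Hence \<open>F\<close> is Lipschitz on balls of radius \<open>K\<close> with constant \<open>L (1 + K)\<^sup>2\<close>. Multiplying transforms
  by the weight identifies \<open>H\<^sup>\<sigma>\<^sup>,\<^sup>2\<close> with \<open>L\<^sup>2\<close>, where the free evolution becomes a strongly continuous
  group of isometries, and Duhamel's equation is solved by contraction on the ball of radius
  \<open>2 (1 + R)\<close>. Uniqueness holds among all continuous solutions by a Gronwall argument; applied to
  the complex conjugate of a solution, it also shows that solutions with real data are real.
  Plancherel's theorem, needed to identify the Fourier transform on \<open>L\<^sup>2\<close>, comes from Gaussian
  regularisation.\<close>

section \<open>Representatives of elements of \<open>L\<^sup>2\<close>\<close>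

text \<open>Both \<open>fourier\<close> and \<open>fourier_mult\<close> are definite descriptions.
  Nothing can be said about the equation before the transform is known to exist on all of L^2, to be
  injective and to be onto; this is why completeness and Plancherel come first.
  \<open>l2_mult\<close> has the default value 0, so its algebra is available only where products
  are shown to be square-integrable. The Duhamel integral is taken in the ambient L^2 while
  continuity is measured in the Gevrey norm; the bounded linear map \<open>l2_to_gevrey\<close>
  takes integrals in the weighted copy to integrals in the ambient space and so joins the two
  topologies. The time comes from the contraction condition T L (1 + K)^2 <= 1/2 with K = 2 (1 + R):
  since 1 + K <= 3 (1 + R), the value c = 1/(18 L) works. As L is fixed before \<sigma>, so is c.
  Continuous dependence appears in the stronger form of a Lipschitz bound with constant 2.\<close>

lemma sq_int_rep_l2 [simp]: "sq_int (rep_l2 u)"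
  using Quotient3_rel_rep[OF Quotient3_l2] Quotient3_abs_rep[OF Quotient3_l2]
  by (metis Quotient3_rep_reflp[OF Quotient3_l2] l2_rel_def)

lemma abs_rep_l2 [simp]: "abs_l2 (rep_l2 u) = u"
  by (rule Quotient3_abs_rep[OF Quotient3_l2])

lemma abs_l2_eq_iff:
  assumes "sq_int f" "sq_int g"
  shows "abs_l2 f = abs_l2 g \<longleftrightarrow> (AE x in lborel. f x = g x)"
  using Quotient3_rel[OF Quotient3_l2, of f g] assms by (auto simp: l2_rel_def)

lemma rep_abs_l2:
  assumes "sq_int f"
  shows "AE x in lborel. rep_l2 (abs_l2 f) x = f x"
  using assms abs_l2_eq_iff[of "rep_l2 (abs_l2 f)" f] by simp

lemma l2_eq_iff: "u = v \<longleftrightarrow> (AE x in lborel. rep_l2 u x = rep_l2 v x)"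
  using abs_l2_eq_iff[of "rep_l2 u" "rep_l2 v"] by simp

lemma l2_eqI: "(AE x in lborel. rep_l2 u x = rep_l2 v x) \<Longrightarrow> u = v"
  by (simp add: l2_eq_iff)

lemma borel_measurable_rep_l2 [measurable]: "rep_l2 u \<in> borel_measurable borel"
  using sq_int_rep_l2[of u] by (simp add: sq_int_def)

lemma sq_int_measurable: "sq_int f \<Longrightarrow> f \<in> borel_measurable borel"
  by (simp add: sq_int_def)

lemma l2_rel_refl: "sq_int f \<Longrightarrow> l2_rel f f"
  by (simp add: l2_rel_def)

lemma plus_abs_l2: "sq_int f \<Longrightarrow> sq_int g \<Longrightarrow> abs_l2 f + abs_l2 g = abs_l2 (\<lambda>x. f x + g x)"
  by (intro plus_l2.abs_eq l2_rel_refl)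

lemma minus_abs_l2: "sq_int f \<Longrightarrow> sq_int g \<Longrightarrow> abs_l2 f - abs_l2 g = abs_l2 (\<lambda>x. f x - g x)"
  by (intro minus_l2.abs_eq l2_rel_refl)

lemma scaleR_abs_l2: "sq_int f \<Longrightarrow> r *\<^sub>R abs_l2 f = abs_l2 (\<lambda>x. r *\<^sub>R f x)"
  by (intro scaleR_l2.abs_eq l2_rel_refl)

lemma inner_abs_l2: "sq_int f \<Longrightarrow> sq_int g \<Longrightarrow> abs_l2 f \<bullet> abs_l2 g = (\<integral>x. f x \<bullet> g x \<partial>lborel)"
  by (intro inner_l2.abs_eq l2_rel_refl)

lemma cscale_abs_l2: "sq_int f \<Longrightarrow> l2_cscale c (abs_l2 f) = abs_l2 (\<lambda>x. c * f x)"
  by (intro l2_cscale.abs_eq l2_rel_refl)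

lemma rep_plus_l2: "AE x in lborel. rep_l2 (u + v) x = rep_l2 u x + rep_l2 v x"
  using rep_abs_l2[OF sq_int_add[OF sq_int_rep_l2[of u] sq_int_rep_l2[of v]]]
    plus_abs_l2[of "rep_l2 u" "rep_l2 v"] by simp

lemma rep_minus_l2: "AE x in lborel. rep_l2 (u - v) x = rep_l2 u x - rep_l2 v x"
  using rep_abs_l2[OF sq_int_diff[OF sq_int_rep_l2[of u] sq_int_rep_l2[of v]]]
    minus_abs_l2[of "rep_l2 u" "rep_l2 v"] by simp

lemma rep_scaleR_l2: "AE x in lborel. rep_l2 (r *\<^sub>R u) x = r *\<^sub>R rep_l2 u x"
  using rep_abs_l2[OF sq_int_scaleR[OF sq_int_rep_l2[of u]]]
    scaleR_abs_l2[of "rep_l2 u" r] by simp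

lemma rep_cscale_l2: "AE x in lborel. rep_l2 (l2_cscale c u) x = c * rep_l2 u x"
  using rep_abs_l2[OF sq_int_cmult[OF sq_int_rep_l2[of u]]]
    cscale_abs_l2[of "rep_l2 u" c] by simp

lemma rep_zero_l2: "AE x in lborel. rep_l2 0 x = 0"
  using rep_abs_l2[OF sq_int_zero] by (simp add: zero_l2.abs_eq)

lemma norm_abs_l2_sq: "sq_int f \<Longrightarrow> (norm (abs_l2 f))\<^sup>2 = (\<integral>x. (cmod (f x))\<^sup>2 \<partial>lborel)"
  by (simp add: power2_norm_eq_inner inner_abs_l2)

lemma norm_abs_l2: "sq_int f \<Longrightarrow> norm (abs_l2 f) = sqrt (\<integral>x. (cmod (f x))\<^sup>2 \<partial>lborel)"
  by (metis norm_abs_l2_sq norm_ge_zero real_sqrt_unique)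

lemma norm_l2_sq: "(norm u)\<^sup>2 = (\<integral>x. (cmod (rep_l2 u x))\<^sup>2 \<partial>lborel)"
  using norm_abs_l2_sq[of "rep_l2 u"] by simp

lemma integrable_sq_rep_l2 [simp]: "integrable lborel (\<lambda>x. (cmod (rep_l2 u x))\<^sup>2)"
  using sq_int_rep_l2[of u] by (simp add: sq_int_def del: sq_int_rep_l2)

lemma nn_norm_abs_l2: "sq_int f \<Longrightarrow> (\<integral>\<^sup>+x. ennreal ((cmod (f x))\<^sup>2) \<partial>lborel) = ennreal ((norm (abs_l2 f))\<^sup>2)"
  by (simp add: norm_abs_l2_sq sq_int_def nn_integral_eq_integral)

lemma nn_norm_l2: "(\<integral>\<^sup>+x. ennreal ((cmod (rep_l2 u x))\<^sup>2) \<partial>lborel) = ennreal ((norm u)\<^sup>2)"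
  using nn_norm_abs_l2[of "rep_l2 u"] by simp

text \<open>Estimates are carried out with nonnegative integrals, where Fatou, Tonelli and
  Cauchy-Schwarz need no prior integrability; a finite bound then yields membership in L^2 and,
  through \<open>norm_abs_l2_le_nn\<close>, the norm bound.\<close>

lemma sq_int_nnI:
  assumes "f \<in> borel_measurable borel" "(\<integral>\<^sup>+x. ennreal ((cmod (f x))\<^sup>2) \<partial>lborel) \<le> ennreal B"
  shows "sq_int f"
  unfolding sq_int_def
proof (intro conjI integrableI_bounded)
  show "(\<integral>\<^sup>+x. ennreal (norm ((cmod (f x))\<^sup>2)) \<partial>lborel) < \<infinity>"
    using assms(2) by (auto intro: le_less_trans)
qed (use assms(1) in measurable)

lemma norm_abs_l2_le_nn:
  assumes "f \<in> borel_measurable borel" "(\<integral>\<^sup>+x. ennreal ((cmod (f x))\<^sup>2) \<partial>lborel) \<le> ennreal (B\<^sup>2)" "0 \<le> B"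
  shows "norm (abs_l2 f) \<le> B"
proof -
  have "sq_int f" using assms sq_int_nnI by blast
  then have "ennreal ((norm (abs_l2 f))\<^sup>2) \<le> ennreal (B\<^sup>2)"
    using assms(2) by (simp add: nn_norm_abs_l2)
  then show ?thesis using assms(3) by (simp add: power2_le_iff_abs_le)
qed

lemma sq_int_bound:
  assumes "sq_int g" "f \<in> borel_measurable borel" "AE x in lborel. cmod (f x) \<le> cmod (g x)"
  shows "sq_int f" "norm (abs_l2 f) \<le> norm (abs_l2 g)"
proof -
  have le: "(\<integral>\<^sup>+x. ennreal ((cmod (f x))\<^sup>2) \<partial>lborel) \<le> ennreal ((norm (abs_l2 g))\<^sup>2)"
    unfolding nn_norm_abs_l2[OF assms(1), symmetric]
    by (rule nn_integral_mono_AE) (use assms(3) in \<open>auto elim!: eventually_mono intro!: ennreal_leI power_mono\<close>)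
  show "sq_int f" by (rule sq_int_nnI[OF assms(2) le])
  show "norm (abs_l2 f) \<le> norm (abs_l2 g)" by (rule norm_abs_l2_le_nn[OF assms(2) le]) simp
qed

section \<open>Riesz--Fischer\<close>

text \<open>With increments d_k of norm at most 2^-k, the series of 2^k |d_k|^2 has integral at most
  the sum of 2^-k. It is therefore finite almost everywhere, which forces pointwise convergence;
  Fatou turns the pointwise limit into the L^2 limit with the same rate.\<close>

lemma l2_Cauchy_rapid:
  assumes X: "\<And>k m. k \<le> m \<Longrightarrow> norm (X m - X k :: l2) \<le> (1/2)^k"
  shows "\<exists>L. \<forall>k. norm (L - X k) \<le> (1/2)^k"
proof -
  let ?f = "\<lambda>k. rep_l2 (X k)"
  have "(\<integral>\<^sup>+x. (\<Sum>k. ennreal (2^k * (cmod (rep_l2 (X (Suc k) - X k) x))\<^sup>2)) \<partial>lborel)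
      = (\<Sum>k. \<integral>\<^sup>+x. ennreal (2^k * (cmod (rep_l2 (X (Suc k) - X k) x))\<^sup>2) \<partial>lborel)"
    by (intro nn_integral_suminf) measurable
  also have "\<dots> \<le> (\<Sum>k. ennreal ((1/2)^k))"
  proof (intro suminf_le)
    fix k
    have "(\<integral>\<^sup>+x. ennreal (2^k * (cmod (rep_l2 (X (Suc k) - X k) x))\<^sup>2) \<partial>lborel) =
        ennreal (2^k) * ennreal ((norm (X (Suc k) - X k))\<^sup>2)"
      by (subst nn_norm_l2[symmetric], subst nn_integral_cmult[symmetric])
        (measurable, simp add: ennreal_mult)
    also have "\<dots> = ennreal (2^k * (norm (X (Suc k) - X k))\<^sup>2)"
      by (simp add: ennreal_mult)
    also have "\<dots> \<le> ennreal (2^k * ((1/2)^k)\<^sup>2)"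
      using X[of k "Suc k"] by (intro ennreal_leI mult_left_mono power_mono) auto
    also have "2^k * ((1/2)^k)\<^sup>2 = (1/2::real)^k"
      by (simp add: power2_eq_square power_divide)
    finally show "(\<integral>\<^sup>+x. ennreal (2^k * (cmod (rep_l2 (X (Suc k) - X k) x))\<^sup>2) \<partial>lborel) \<le> ennreal ((1/2)^k)" .
  qed auto
  also have "\<dots> < \<infinity>"
    by (simp add: ennreal_suminf_neq_top less_top)
  finally have "(\<integral>\<^sup>+x. (\<Sum>k. ennreal (2^k * (cmod (rep_l2 (X (Suc k) - X k) x))\<^sup>2)) \<partial>lborel) \<noteq> \<infinity>"
    by simp
  then have "AE x in lborel. (\<Sum>k. ennreal (2^k * (cmod (rep_l2 (X (Suc k) - X k) x))\<^sup>2)) \<noteq> \<infinity>"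
    by (intro nn_integral_PInf_AE) measurable
  moreover have "AE x in lborel. \<forall>k. rep_l2 (X (Suc k) - X k) x = ?f (Suc k) x - ?f k x"
    by (simp add: AE_all_countable rep_minus_l2)
  ultimately have conv: "AE x in lborel. convergent (\<lambda>k. ?f k x)"
  proof eventually_elim
    case (elim x)
    let ?d = "\<lambda>k. ?f (Suc k) x - ?f k x"
    have s: "summable (\<lambda>k. 2^k * (cmod (?d k))\<^sup>2)"
      using elim by (intro summable_suminf_not_top) auto
    have "summable (\<lambda>k. (1/2)^k + 2^k * (cmod (?d k))\<^sup>2)"
      by (intro summable_add s) simp
    then have "summable ?d"
    proof (rule summable_comparison_test'[where N = 0])
      fix k :: nat
      let ?y = "cmod (?d k)"
      \<comment> \<open>Either y <= 2^-k, or 1 <= 2^k y and multiplying by y gives y <= 2^k y^2.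
        Weighted square summability thus becomes plain summability.\<close>
      have "?y \<le> (1/2)^k + 2^k * ?y\<^sup>2"
      proof (cases "?y \<le> (1/2)^k")
        case False
        then have "1 \<le> 2^k * ?y" by (simp add: field_simps power_divide)
        then have "?y * 1 \<le> ?y * (2^k * ?y)" by (intro mult_left_mono) auto
        then have "?y \<le> 2^k * ?y\<^sup>2" by (simp add: power2_eq_square algebra_simps)
        then show ?thesis by (rule add_increasing[rotated]) simp
      qed (simp add: add_increasing2)
      then show "norm (?d k) \<le> (1/2)^k + 2^k * ?y\<^sup>2" by simp
    qed
    then have "convergent (\<lambda>n. \<Sum>k<n. ?d k)" by (simp add: summable_iff_convergent)
    then have "convergent (\<lambda>n. ?f n x - ?f 0 x)" 
      using sum_lessThan_telescope[of "\<lambda>k. ?f k x"] by simp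
    then show ?case
      using convergent_add[OF _ convergent_const[of "?f 0 x"]] by fastforce
  qed
  define F where "F x = lim (\<lambda>k. ?f k x)" for x
  have F_meas [measurable]: "F \<in> borel_measurable borel"
    unfolding F_def[abs_def] by (rule borel_measurable_lim_metric) measurable
  have bnd: "(\<integral>\<^sup>+x. ennreal ((cmod (F x - ?f k x))\<^sup>2) \<partial>lborel) \<le> ennreal (((1/2)^k)\<^sup>2)" for k
  proof -
    have "(\<integral>\<^sup>+x. ennreal ((cmod (F x - ?f k x))\<^sup>2) \<partial>lborel)
        = (\<integral>\<^sup>+x. liminf (\<lambda>m. ennreal ((cmod (?f m x - ?f k x))\<^sup>2)) \<partial>lborel)"
    proof (rule nn_integral_cong_AE, use conv in eventually_elim)
      case (elim x)
      then have "(\<lambda>m. ?f m x) \<longlonglongrightarrow> F x" unfolding F_def convergent_LIMSEQ_iff .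
      then have "(\<lambda>m. ennreal ((cmod (?f m x - ?f k x))\<^sup>2)) \<longlonglongrightarrow> ennreal ((cmod (F x - ?f k x))\<^sup>2)"
        by (intro tendsto_intros tendsto_ennrealI)
      then show ?case by (intro lim_imp_Liminf[symmetric] sequentially_bot)
    qed
    also have "\<dots> \<le> liminf (\<lambda>m. \<integral>\<^sup>+x. ennreal ((cmod (?f m x - ?f k x))\<^sup>2) \<partial>lborel)"
      by (intro nn_integral_liminf) measurable
    also have "\<dots> \<le> liminf (\<lambda>m. ennreal (((1/2)^k)\<^sup>2))"
    proof (intro Liminf_mono, unfold eventually_sequentially, intro exI[of _ k] allI impI)
      fix m assume "k \<le> m"
      have "(\<integral>\<^sup>+x. ennreal ((cmod (?f m x - ?f k x))\<^sup>2) \<partial>lborel) = ennreal ((norm (X m - X k))\<^sup>2)"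
        unfolding nn_norm_l2[symmetric] using rep_minus_l2[of "X m" "X k"]
        by (intro nn_integral_cong_AE) (auto elim!: eventually_mono)
      also have "\<dots> \<le> ennreal (((1/2)^k)\<^sup>2)"
        using X[OF \<open>k \<le> m\<close>] by (intro ennreal_leI power_mono) auto
      finally show "(\<integral>\<^sup>+x. ennreal ((cmod (?f m x - ?f k x))\<^sup>2) \<partial>lborel) \<le> ennreal (((1/2)^k)\<^sup>2)" .
    qed
    finally show ?thesis by (simp add: Liminf_const)
  qed
  \<comment> \<open>The bound concerns differences only; adding back the member of index 0 puts
    \<open>F\<close> itself in L^2.\<close>
  have "sq_int (\<lambda>x. F x - ?f k x)" for k
    by (rule sq_int_nnI[OF _ bnd]) measurable
  from sq_int_add[OF this[of 0] sq_int_rep_l2[of "X 0"]] have F: "sq_int F" by simp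
  have "norm (abs_l2 F - X k) \<le> (1/2)^k" for k
    using norm_abs_l2_le_nn[OF _ bnd[of k]] minus_abs_l2[OF F sq_int_rep_l2[of "X k"]] by simp
  then show ?thesis by blast
qed

text \<open>Completeness is used later for the existence of the transform, for integrating
  continuous functions with values in L^2 and for the fixed point theorem.\<close>

instance l2 :: banach
proof
  fix X :: "nat \<Rightarrow> l2" assume X: "Cauchy X"
  have "\<exists>N. \<forall>m\<ge>N. \<forall>n\<ge>N. norm (X m - X n) < (1/2)^k" for k
    using X by (intro CauchyD) auto
  then obtain N where N: "\<And>k m n. m \<ge> N k \<Longrightarrow> n \<ge> N k \<Longrightarrow> norm (X m - X n) < (1/2)^k"
    by metis
  \<comment> \<open>Summing the thresholds makes \<open>r m\<close> at least \<open>N k\<close> for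
    every k <= m, so the subsequence along \<open>r\<close> converges rapidly.\<close>
  define r where "r k = (\<Sum>j\<le>k. N j)" for k
  have rN: "N k \<le> r m" if "k \<le> m" for k m
    unfolding r_def using that by (intro member_le_sum) auto
  obtain L where L: "\<And>k. norm (L - X (r k)) \<le> (1/2)^k"
    using l2_Cauchy_rapid[of "\<lambda>k. X (r k)"] N rN by (meson less_imp_le order_refl)
  have "X \<longlonglongrightarrow> L"
  proof (rule LIMSEQ_I)
    fix e :: real assume "0 < e"
    then obtain k where k: "(1/2)^k < e/2" using real_arch_pow_inv[of "e/2" "1/2"] by auto
    show "\<exists>no. \<forall>n\<ge>no. norm (X n - L) < e"
    proof (intro exI allI impI)
      fix n assume "N k \<le> n"
      then have "norm (X n - X (r k)) < (1/2)^k" by (intro N rN) auto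
      moreover have "norm (X n - L) \<le> norm (X n - X (r k)) + norm (L - X (r k))"
        using norm_triangle_ineq4[of "X n - X (r k)" "L - X (r k)"] by simp
      ultimately show "norm (X n - L) < e" using L[of k] k by simp
    qed
  qed
  then show "convergent X" by (auto simp: convergent_def)
qed

section \<open>Continuity of translations in \<open>L\<^sup>1\<close>\<close>

lemma borel_measurable_cis [measurable]: "cis \<in> borel_measurable borel"
  by (intro borel_measurable_continuous_onI continuous_intros)

lemma borel_measurable_cnj [measurable]: "cnj \<in> borel_measurable borel"
  by (intro borel_measurable_continuous_onI continuous_intros)

lemma integral_translate:
  fixes g :: "real \<Rightarrow> 'a :: {banach, second_countable_topology}"
  shows "(\<integral>x. g (x - h) \<partial>lborel) = (\<integral>x. g x \<partial>lborel)"
  using lborel_integral_real_affine[of 1 g "-h"] by simp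

lemma integrable_translate:
  fixes g :: "real \<Rightarrow> 'a :: {banach, second_countable_topology}"
  shows "integrable lborel g \<Longrightarrow> integrable lborel (\<lambda>x. g (x - h))"
  using lborel_integrable_real_affine[of g 1 "-h"] by simp

text \<open>The null sequence may change with the tolerance \<open>e\<close>; this is the form in
  which approximation by open sets and by simple functions is used below.\<close>

lemma tendsto_zero_approx:
  fixes a :: "nat \<Rightarrow> real"
  assumes "\<And>n. 0 \<le> a n"
    and "\<And>e. 0 < e \<Longrightarrow> \<exists>b. b \<longlonglongrightarrow> 0 \<and> (\<forall>n. a n \<le> b n + e)"
  shows "a \<longlonglongrightarrow> 0"
proof (rule LIMSEQ_I)
  fix e :: real assume "0 < e"
  then obtain b where b: "b \<longlonglongrightarrow> 0" "\<And>n. a n \<le> b n + e/2" using assms(2)[of "e/2"] by auto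
  from LIMSEQ_D[OF b(1), of "e/2"] \<open>0 < e\<close> obtain N where "\<And>n. n \<ge> N \<Longrightarrow> norm (b n - 0) < e/2" by auto
  then have "norm (a n - 0) < e" if "n \<ge> N" for n
    using that b(2)[of n] assms(1)[of n] by fastforce
  then show "\<exists>N. \<forall>n\<ge>N. norm (a n - 0) < e" by blast
qed

text \<open>The modulus equals 1_U(x - t) + 1_U(x) - 2 1_U(x) 1_U(x - t), and translation preserves
  the integral of the first term. Only the product term still depends on t after integration, and
  openness gives 1_U(x - h_n) = 1 eventually for each x in U.\<close>

lemma indicator_translate_continuous_open:
  fixes U :: "real set"
  assumes "open U" "emeasure lborel U < \<infinity>" "h \<longlonglongrightarrow> 0"
  shows "(\<lambda>n. \<integral>x. \<bar>indicat_real U (x - h n) - indicat_real U x\<bar> \<partial>lborel) \<longlonglongrightarrow> 0"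
proof -
  have [measurable]: "U \<in> sets borel" using assms by auto
  have iU: "integrable lborel (indicat_real U)" using assms by (simp add: integrable_indicator_iff)
  have i1: "integrable lborel (\<lambda>x. indicat_real U (x - t))" for t
    by (rule integrable_translate[OF iU])
  have i2: "integrable lborel (\<lambda>x. indicat_real U x * indicat_real U (x - t))" for t
    by (rule Bochner_Integration.integrable_bound[OF iU]) (auto simp: indicator_def)
  have "\<bar>indicat_real U (x - t) - indicat_real U x\<bar> =
      indicat_real U (x - t) + indicat_real U x - 2 * (indicat_real U x * indicat_real U (x - t))" for x t
    by (auto simp: indicator_def)
  then have eq: "(\<integral>x. \<bar>indicat_real U (x - t) - indicat_real U x\<bar> \<partial>lborel) =
      2 * (\<integral>x. indicat_real U x \<partial>lborel) - 2 * (\<integral>x. indicat_real U x * indicat_real U (x - t) \<partial>lborel)" for t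
    using i1[of t] iU i2[of t] integral_translate[of "indicat_real U" t] by simp
  have "(\<lambda>n. \<integral>x. indicat_real U x * indicat_real U (x - h n) \<partial>lborel) \<longlonglongrightarrow> (\<integral>x. indicat_real U x \<partial>lborel)"
  proof (rule integral_dominated_convergence[OF _ _ iU])
    show "AE x in lborel. (\<lambda>n. indicat_real U x * indicat_real U (x - h n)) \<longlonglongrightarrow> indicat_real U x"
    proof (intro AE_I2)
      fix x :: real
      show "(\<lambda>n. indicat_real U x * indicat_real U (x - h n)) \<longlonglongrightarrow> indicat_real U x"
      proof (cases "x \<in> U")
        case True
        have "(\<lambda>n. x - h n) \<longlonglongrightarrow> x - 0" by (intro tendsto_intros assms)
        then have "eventually (\<lambda>n. x - h n \<in> U) sequentially"
          using True \<open>open U\<close> by (auto dest: topological_tendstoD)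
        then have "eventually (\<lambda>n. indicat_real U x * indicat_real U (x - h n) = indicat_real U x) sequentially"
          by eventually_elim (simp add: True)
        then show ?thesis by (rule tendsto_eventually)
      qed simp
    qed
  qed (auto simp: indicator_def)
  from tendsto_diff[OF tendsto_const[of "2 * (\<integral>x. indicat_real U x \<partial>lborel)"] tendsto_mult[OF tendsto_const[of 2] this]]
  show ?thesis unfolding eq by simp
qed

text \<open>Outer regularity gives an open U containing A whose excess U - A has measure below e/2.
  The excess enters once translated and once untranslated, so the error is at most e.\<close>

lemma indicator_translate_continuous:
  fixes A :: "real set"
  assumes [measurable]: "A \<in> sets borel" and "emeasure lborel A < \<infinity>" "h \<longlonglongrightarrow> 0"
  shows "(\<lambda>n. \<integral>x. \<bar>indicat_real A (x - h n) - indicat_real A x\<bar> \<partial>lborel) \<longlonglongrightarrow> 0"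
proof (rule tendsto_zero_approx)
  fix e :: real assume "0 < e"
  obtain U where U: "open U" "A \<subseteq> U" "emeasure lborel (U - A) < ennreal (e/2)"
    using outer_regular_lborel[OF assms(1), of "e/2"] \<open>0 < e\<close> by auto
  have [measurable]: "U \<in> sets borel" using U by auto
  have "emeasure lborel U = emeasure lborel A + emeasure lborel (U - A)"
    using U by (subst plus_emeasure) (auto intro!: arg_cong[where f="emeasure lborel"])
  also have "\<dots> < \<infinity>"
    using assms(2) order_less_trans[OF U(3) ennreal_less_top] by simp
  finally have Uf: "emeasure lborel U < \<infinity>" .
  let ?D = "U - A"
  have Df: "emeasure lborel ?D < \<infinity>" using U(3) order_less_trans ennreal_less_top by force
  have iU: "integrable lborel (indicat_real U)" "integrable lborel (indicat_real A)" "integrable lborel (indicat_real ?D)"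
    using Uf Df assms by (simp_all add: integrable_indicator_iff)
  note it = iU[THEN integrable_translate]
  have mD: "(\<integral>x. indicat_real ?D x \<partial>lborel) \<le> e/2"
    using U(3) Df \<open>0 < e\<close> by (simp add: emeasure_eq_ennreal_measure ennreal_less_iff)
  show "\<exists>b. b \<longlonglongrightarrow> 0 \<and> (\<forall>n. (\<integral>x. \<bar>indicat_real A (x - h n) - indicat_real A x\<bar> \<partial>lborel) \<le> b n + e)"
  proof (intro exI conjI allI)
    show "(\<lambda>n. \<integral>x. \<bar>indicat_real U (x - h n) - indicat_real U x\<bar> \<partial>lborel) \<longlonglongrightarrow> 0"
      by (rule indicator_translate_continuous_open[OF U(1) Uf assms(3)])
    fix n
    have "(\<integral>x. \<bar>indicat_real A (x - h n) - indicat_real A x\<bar> \<partial>lborel) \<le>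
        (\<integral>x. \<bar>indicat_real U (x - h n) - indicat_real U x\<bar> + (indicat_real ?D (x - h n) + indicat_real ?D x) \<partial>lborel)"
      using U(2) by (intro integral_mono integrable_abs Bochner_Integration.integrable_diff Bochner_Integration.integrable_add iU it)
        (auto simp: indicator_def)
    also have "\<dots> = (\<integral>x. \<bar>indicat_real U (x - h n) - indicat_real U x\<bar> \<partial>lborel) + ((\<integral>x. indicat_real ?D (x - h n) \<partial>lborel) + (\<integral>x. indicat_real ?D x \<partial>lborel))"
      using iU it by simp
    also have "\<dots> \<le> (\<integral>x. \<bar>indicat_real U (x - h n) - indicat_real U x\<bar> \<partial>lborel) + e"
      using mD integral_translate[of "indicat_real ?D" "h n"] by simp
    finally show "(\<integral>x. \<bar>indicat_real A (x - h n) - indicat_real A x\<bar> \<partial>lborel) \<le> (\<integral>x. \<bar>indicat_real U (x - h n) - indicat_real U x\<bar> \<partial>lborel) + e" .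
  qed
qed simp

text \<open>This supplies the continuity at 0 of the autocorrelation in
  \<open>gauss_mollifier_limit\<close>. The limit step costs one approximation error for f and one
  for its translate, and the two are equal.\<close>

lemma L1_translate_continuous:
  fixes f :: "real \<Rightarrow> complex"
  assumes "integrable lborel f" "h \<longlonglongrightarrow> 0"
  shows "(\<lambda>n. \<integral>x. cmod (f (x - h n) - f x) \<partial>lborel) \<longlonglongrightarrow> 0"
  using assms(1)
proof (induction rule: integrable_induct)
  case (base A c)
  have "cmod (indicat_real A y *\<^sub>R c - indicat_real A x *\<^sub>R c) = cmod c * \<bar>indicat_real A y - indicat_real A x\<bar>" for x y
    by (auto simp: indicator_def)
  then have "(\<lambda>n. \<integral>x. cmod (indicat_real A (x - h n) *\<^sub>R c - indicat_real A x *\<^sub>R c) \<partial>lborel) =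
      (\<lambda>n. cmod c * (\<integral>x. \<bar>indicat_real A (x - h n) - indicat_real A x\<bar> \<partial>lborel))" by simp
  also have "\<dots> \<longlonglongrightarrow> cmod c * 0"
    using base assms(2) by (intro tendsto_intros indicator_translate_continuous) auto
  finally show ?case by simp
next
  case (add f g)
  note it = add.hyps[THEN integrable_translate]
  show ?case
  proof (rule tendsto_sandwich[OF _ _ tendsto_const])
    show "(\<lambda>n. (\<integral>x. cmod (f (x - h n) - f x) \<partial>lborel) + (\<integral>x. cmod (g (x - h n) - g x) \<partial>lborel)) \<longlonglongrightarrow> 0"
      using tendsto_add[OF add.IH] by simp
    show "\<forall>\<^sub>F n in sequentially. (\<integral>x. cmod (f (x - h n) + g (x - h n) - (f x + g x)) \<partial>lborel) \<le>
        (\<integral>x. cmod (f (x - h n) - f x) \<partial>lborel) + (\<integral>x. cmod (g (x - h n) - g x) \<partial>lborel)"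
    proof (intro always_eventually allI, subst Bochner_Integration.integral_add[symmetric])
      fix n
      show "(\<integral>x. cmod (f (x - h n) + g (x - h n) - (f x + g x)) \<partial>lborel) \<le>
        (\<integral>x. cmod (f (x - h n) - f x) + cmod (g (x - h n) - g x) \<partial>lborel)"
        by (intro integral_mono integrable_norm Bochner_Integration.integrable_diff Bochner_Integration.integrable_add it add.hyps)
          (metis add_diff_add norm_triangle_ineq)
    qed (intro integrable_norm Bochner_Integration.integrable_diff it add.hyps)+
  qed auto
next
  case (lim f s)
  note it = lim.hyps(1)[THEN integrable_translate] integrable_translate[OF \<open>integrable lborel f\<close>]
  have "(\<lambda>i. \<integral>x. cmod (s i x - f x) \<partial>lborel) \<longlonglongrightarrow> (\<integral>x. 0 \<partial>(lborel::real measure))"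
  \<comment> \<open>\<open>integrable_induct\<close> provides approximants with |s_i| <= 2 |f|,
    hence the majorant 3 |f|.\<close>
  proof (rule integral_dominated_convergence[where w = "\<lambda>x. 3 * cmod (f x)"])
    show "AE x in lborel. (\<lambda>i. cmod (s i x - f x)) \<longlonglongrightarrow> 0"
      using lim.hyps(2) by (auto intro!: AE_I2 tendsto_norm_zero LIM_zero)
    fix i show "AE x in lborel. norm (cmod (s i x - f x)) \<le> 3 * cmod (f x)"
    proof (intro AE_I2)
      fix x show "norm (cmod (s i x - f x)) \<le> 3 * cmod (f x)"
        using norm_triangle_ineq4[of "s i x" "f x"] lim.hyps(3)[of x i] by simp
    qed
  qed (use lim.hyps in \<open>auto intro!: borel_measurable_norm borel_measurable_diff\<close>)
  then have L: "(\<lambda>i. \<integral>x. cmod (s i x - f x) \<partial>lborel) \<longlonglongrightarrow> 0" by simp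
  show ?case
  proof (rule tendsto_zero_approx)
    fix e :: real assume "0 < e"
    obtain i where i: "(\<integral>x. cmod (s i x - f x) \<partial>lborel) < e/2"
      using LIMSEQ_D[OF L, of "e/2"] \<open>0 < e\<close> by auto
    show "\<exists>b. b \<longlonglongrightarrow> 0 \<and> (\<forall>n. (\<integral>x. cmod (f (x - h n) - f x) \<partial>lborel) \<le> b n + e)"
    proof (intro exI conjI allI)
      show "(\<lambda>n. \<integral>x. cmod (s i (x - h n) - s i x) \<partial>lborel) \<longlonglongrightarrow> 0" by (rule lim.IH)
      fix n
      have "(\<integral>x. cmod (f (x - h n) - f x) \<partial>lborel) \<le> (\<integral>x. cmod (s i (x - h n) - s i x) +
          (cmod (s i (x - h n) - f (x - h n)) + cmod (s i x - f x)) \<partial>lborel)"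
      proof (intro integral_mono integrable_norm Bochner_Integration.integrable_diff Bochner_Integration.integrable_add it lim.hyps)
        fix x
        have "f (x - h n) - f x = (s i (x - h n) - s i x) - (s i (x - h n) - f (x - h n)) + (s i x - f x)" by simp
        then show "cmod (f (x - h n) - f x) \<le> cmod (s i (x - h n) - s i x) +
          (cmod (s i (x - h n) - f (x - h n)) + cmod (s i x - f x))"
          by (smt (verit) norm_triangle_ineq norm_triangle_ineq4)
      qed
      also have "\<dots> = (\<integral>x. cmod (s i (x - h n) - s i x) \<partial>lborel) + ((\<integral>x. cmod (s i (x - h n) - f (x - h n)) \<partial>lborel) + (\<integral>x. cmod (s i x - f x) \<partial>lborel))"
        using it lim.hyps by simp
      also have "\<dots> \<le> (\<integral>x. cmod (s i (x - h n) - s i x) \<partial>lborel) + e"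
        using i integral_translate[of "\<lambda>x. cmod (s i x - f x)" "h n"] by simp
      finally show "(\<integral>x. cmod (f (x - h n) - f x) \<partial>lborel) \<le> (\<integral>x. cmod (s i (x - h n) - s i x) \<partial>lborel) + e" .
    qed
  qed simp
qed

section \<open>The Fourier transform of integrable functions\<close>

text \<open>Meaningful for integrable f; for a truncation to [-N, N] it is the inner integral in
  \<open>has_fourier\<close>.\<close>

definition ft :: "(real \<Rightarrow> complex) \<Rightarrow> real \<Rightarrow> complex" where
  "ft f \<xi> = (\<integral>x. cis (- (x * \<xi>)) * f x \<partial>lborel)"

lemma integrable_cis_mult:
  assumes "integrable lborel f"
  shows "integrable lborel (\<lambda>x. cis (a * x + b) * f x)"
  by (rule Bochner_Integration.integrable_bound[OF assms])
    (use assms in \<open>auto simp: norm_mult\<close>)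

lemma integrable_ft: "integrable lborel f \<Longrightarrow> integrable lborel (\<lambda>x. cis (- (x * \<xi>)) * f x)"
  using integrable_cis_mult[of f "-\<xi>" 0] by (simp add: mult.commute)

lemma borel_measurable_ft [measurable (raw)]:
  assumes [measurable]: "f \<in> borel_measurable borel"
  shows "ft f \<in> borel_measurable borel"
  unfolding ft_def[abs_def] by measurable

lemma norm_ft_le: "cmod (ft f \<xi>) \<le> (\<integral>x. cmod (f x) \<partial>lborel)"
  unfolding ft_def by (rule order_trans[OF integral_norm_bound]) (simp add: norm_mult)

lemma ft_diff:
  "integrable lborel f \<Longrightarrow> integrable lborel g \<Longrightarrow> ft (\<lambda>x. f x - g x) \<xi> = ft f \<xi> - ft g \<xi>"
  unfolding ft_def by (simp add: right_diff_distrib integrable_ft)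

lemma ft_add:
  "integrable lborel f \<Longrightarrow> integrable lborel g \<Longrightarrow> ft (\<lambda>x. f x + g x) \<xi> = ft f \<xi> + ft g \<xi>"
  unfolding ft_def by (simp add: distrib_left integrable_ft)

lemma ft_cmult: "ft (\<lambda>x. c * f x) \<xi> = c * ft f \<xi>"
proof -
  have "(\<lambda>x. cis (- (x * \<xi>)) * (c * f x)) = (\<lambda>x. c * (cis (- (x * \<xi>)) * f x))" by (simp add: ac_simps)
  then show ?thesis unfolding ft_def by simp
qed

lemma ft_cnj_reflect: "ft (\<lambda>x. cnj (f (- x))) \<xi> = cnj (ft f \<xi>)"
proof -
  have "cnj (ft f \<xi>) = (\<integral>x. cis (x * \<xi>) * cnj (f x) \<partial>lborel)"
    unfolding ft_def by (subst Bochner_Integration.integral_cnj[symmetric], rule Bochner_Integration.integral_cong) (auto simp: cis_cnj)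
  also have "\<dots> = (\<integral>x. cis (- (x * \<xi>)) * cnj (f (- x)) \<partial>lborel)"
    using lborel_integral_real_affine[of "-1" "\<lambda>x. cis (x * \<xi>) * cnj (f x)" 0] by simp
  finally show ?thesis by (simp add: ft_def)
qed

lemma ft_cnj: "ft (\<lambda>x. cnj (f x)) \<xi> = cnj (ft f (- \<xi>))"
  unfolding ft_def by (subst Bochner_Integration.integral_cnj[symmetric], rule Bochner_Integration.integral_cong) (auto simp: cis_cnj)

text \<open>Prepares two applications of Fubini: with kernel cis(-xy) and B = 1 in the
  multiplication formula, and with a translate of the conjugated function and B = M in the mollifier
  limit.\<close>

lemma integrable_lborel_pair_mult:
  fixes f g :: "real \<Rightarrow> complex"
  assumes f: "integrable lborel f" and g: "integrable lborel g"
    and c: "(\<lambda>(x,y). c x y) \<in> borel_measurable (lborel \<Otimes>\<^sub>M lborel)" "\<And>x y. cmod (c x y) \<le> B"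
  shows "integrable (lborel \<Otimes>\<^sub>M lborel) (\<lambda>(x,y). c x y * (f x * g y))"
proof -
  have [measurable]: "f \<in> borel_measurable borel" "g \<in> borel_measurable borel" using f g by auto
  have "integrable (lborel \<Otimes>\<^sub>M lborel) (\<lambda>p. f (fst p) * g (snd p))"
  proof (rule lborel_pair.Fubini_integrable)
    show "integrable lborel (\<lambda>x. \<integral>y. norm (f (fst (x, y)) * g (snd (x, y))) \<partial>lborel)"
      using f by (simp add: norm_mult)
    show "AE x in lborel. integrable lborel (\<lambda>y. f (fst (x, y)) * g (snd (x, y)))"
      using g by auto
  qed measurable
  then have "integrable (lborel \<Otimes>\<^sub>M lborel) (\<lambda>p. B *\<^sub>R (f (fst p) * g (snd p)))" by simp
  then show ?thesis
  proof (rule Bochner_Integration.integrable_bound)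
    show "(\<lambda>(x, y). c x y * (f x * g y)) \<in> borel_measurable (lborel \<Otimes>\<^sub>M lborel)"
      using c(1) by measurable
    show "AE p in lborel \<Otimes>\<^sub>M lborel. norm (case p of (x, y) \<Rightarrow> c x y * (f x * g y)) \<le> norm (B *\<^sub>R (f (fst p) * g (snd p)))"
    proof (intro AE_I2, unfold case_prod_beta norm_mult norm_scaleR)
      fix p :: "real \<times> real"
      show "cmod (c (fst p) (snd p)) * (cmod (f (fst p)) * cmod (g (snd p))) \<le> \<bar>B\<bar> * (cmod (f (fst p)) * cmod (g (snd p)))"
        using c(2)[of "fst p" "snd p"] by (intro mult_right_mono) auto
    qed
  qed
qed

text \<open>Fubini, because the kernel cis(-xy) is symmetric in x and y. Plancherel's identity and
  the adjoint of the transform are both derived from it.\<close>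

lemma ft_multiplication_formula:
  assumes f: "integrable lborel f" and g: "integrable lborel g"
  shows "(\<integral>\<xi>. ft f \<xi> * g \<xi> \<partial>lborel) = (\<integral>x. f x * ft g x \<partial>lborel)"
proof -
  have "(\<integral>y. (\<integral>x. cis (- (x * y)) * (f x * g y) \<partial>lborel) \<partial>lborel) = (\<integral>x. (\<integral>y. cis (- (x * y)) * (f x * g y) \<partial>lborel) \<partial>lborel)"
    by (rule lborel_pair.Fubini_integral, rule integrable_lborel_pair_mult[OF f g, where B = 1]) (simp_all add: case_prod_beta')
  moreover have "(\<lambda>x. cis (- (x * y)) * (f x * g y)) = (\<lambda>x. (cis (- (x * y)) * f x) * g y)" for y
    by (simp add: ac_simps)
  moreover have "(\<lambda>y. cis (- (x * y)) * (f x * g y)) = (\<lambda>y. f x * (cis (- (y * x)) * g y))" for x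
    by (simp add: ac_simps)
  ultimately show ?thesis unfolding ft_def by simp
qed

section \<open>Gaussians and their Fourier transforms\<close>

abbreviation (input) gaussian :: "real \<Rightarrow> complex" where
  "gaussian x \<equiv> complex_of_real (std_normal_density x)"

text \<open>The left side is the characteristic function of the standard normal law; sqrt (2 pi)
  undoes the normalisation of the density.\<close>

lemma integral_cis_gaussian:
  "(\<integral>x. cis (t * x) * gaussian x \<partial>lborel) = sqrt (2 * pi) * gaussian t"
proof -
  have "(\<integral>x. cis (t * x) * gaussian x \<partial>lborel) = char std_normal_distribution t"
    unfolding char_def by (subst integral_density) (auto simp: cis_conv_exp scaleR_conv_of_real ac_simps intro!: Bochner_Integration.integral_cong)
  also have "\<dots> = exp (- (t^2) / 2)" by (simp add: char_std_normal_distribution)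
  finally show ?thesis by (simp add: std_normal_density_def)
qed

text \<open>Scaling \<xi> by \<epsilon> reduces this to the previous identity at -(x +
  y)/\<epsilon>. As \<epsilon> decreases, the right side concentrates at y = -x and acts as an
  approximate identity there.\<close>

lemma ft_modulated_gaussian:
  assumes "\<epsilon> > 0"
  shows "ft (\<lambda>\<xi>. cis (- (x * \<xi>)) * gaussian (\<epsilon> * \<xi>)) y = (sqrt (2 * pi) / \<epsilon>) * gaussian ((x + y) / \<epsilon>)"
proof -
  have "(\<integral>\<xi>. cis (- ((x + y) / \<epsilon>) * \<xi>) * gaussian \<xi> \<partial>lborel) = sqrt (2 * pi) * gaussian ((x + y) / \<epsilon>)"
    unfolding integral_cis_gaussian by (simp add: std_normal_density_def)
  also have "(\<integral>\<xi>. cis (- ((x + y) / \<epsilon>) * \<xi>) * gaussian \<xi> \<partial>lborel) =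
      \<epsilon> * (\<integral>\<xi>. cis (- ((x + y) / \<epsilon>) * (\<epsilon> * \<xi>)) * gaussian (\<epsilon> * \<xi>) \<partial>lborel)"
    using assms by (subst lborel_integral_real_affine[of \<epsilon> _ 0]) (auto simp: scaleR_conv_of_real)
  also have "(\<lambda>\<xi>. cis (- ((x + y) / \<epsilon>) * (\<epsilon> * \<xi>)) * gaussian (\<epsilon> * \<xi>)) =
      (\<lambda>\<xi>. cis (- (\<xi> * y)) * (cis (- (x * \<xi>)) * gaussian (\<epsilon> * \<xi>)))"
  proof
    fix \<xi>
    have e: "- ((x + y) / \<epsilon>) * (\<epsilon> * \<xi>) = - (\<xi> * y) + - (x * \<xi>)"
      using assms by (simp add: field_simps)
    show "cis (- ((x + y) / \<epsilon>) * (\<epsilon> * \<xi>)) * gaussian (\<epsilon> * \<xi>) =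
      cis (- (\<xi> * y)) * (cis (- (x * \<xi>)) * gaussian (\<epsilon> * \<xi>))"
      unfolding e cis_mult[symmetric] by (simp only: mult.assoc)
  qed
  finally show ?thesis using assms unfolding ft_def by (simp add: field_simps)
qed

section \<open>Plancherel's identity\<close>

lemma gaussian_0: "std_normal_density 0 = 1 / sqrt (2 * pi)"
  by (simp add: std_normal_density_def)

lemma integral_gaussian: "(\<integral>x. gaussian x \<partial>lborel) = 1"
  using integral_cis_gaussian[of 0] by (simp add: gaussian_0 real_sqrt_mult)

lemma integrable_gaussian: "integrable lborel gaussian"
  by simp

lemma integrable_gaussian_dilate: "\<epsilon> > 0 \<Longrightarrow> integrable lborel (\<lambda>\<xi>. gaussian (\<epsilon> * \<xi>))"
  using lborel_integrable_real_affine[OF integrable_gaussian, of \<epsilon> 0] by simp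

text \<open>\<open>ft f\<close> is bounded but need not be integrable; the Gaussian factor repairs
  this. Since the conjugate of \<open>ft f\<close> is the transform of the reflected conjugate of f,
  the multiplication formula is applied twice: once to compute the transform of the weighted
  conjugate, once against f.\<close>

lemma gauss_weighted_parseval:
  assumes f: "integrable lborel f" and "\<epsilon> > 0"
  shows "integrable lborel (\<lambda>\<xi>. cnj (ft f \<xi>) * gaussian (\<epsilon> * \<xi>))"
    and "(\<integral>\<xi>. ft f \<xi> * (cnj (ft f \<xi>) * gaussian (\<epsilon> * \<xi>)) \<partial>lborel) =
      sqrt (2 * pi) * (\<integral>x. f x * (\<integral>z. gaussian z * cnj (f (x - \<epsilon> * z)) \<partial>lborel) \<partial>lborel)"
proof -
  have [measurable]: "f \<in> borel_measurable borel" using f by auto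
  let ?g = "\<lambda>\<xi>. cnj (ft f \<xi>) * gaussian (\<epsilon> * \<xi>)"
  have "integrable lborel (\<lambda>\<xi>. of_real (\<integral>x. cmod (f x) \<partial>lborel) * gaussian (\<epsilon> * \<xi>))"
    using integrable_gaussian_dilate[OF \<open>\<epsilon> > 0\<close>] by simp
  then show g: "integrable lborel ?g"
    by (rule Bochner_Integration.integrable_bound)
      (auto simp: norm_mult intro!: mult_right_mono norm_ft_le order_trans[OF norm_ft_le abs_ge_self])
  have f': "integrable lborel (\<lambda>y. cnj (f (- y)))"
    using lborel_integrable_real_affine[OF f, of "-1" 0] by simp
  have "ft ?g x = sqrt (2 * pi) * (\<integral>z. gaussian z * cnj (f (x - \<epsilon> * z)) \<partial>lborel)" for x
  proof -
    let ?h = "\<lambda>\<xi>. cis (- (x * \<xi>)) * gaussian (\<epsilon> * \<xi>)"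
    have h: "integrable lborel ?h"
      using integrable_cis_mult[OF integrable_gaussian_dilate[OF \<open>\<epsilon> > 0\<close>], of "-x" 0] by simp
    have "ft ?g x = (\<integral>\<xi>. ft (\<lambda>y. cnj (f (- y))) \<xi> * ?h \<xi> \<partial>lborel)"
      unfolding ft_def[of ?g] ft_cnj_reflect by (simp add: ac_simps)
    also have "\<dots> = (\<integral>y. cnj (f (- y)) * ft ?h y \<partial>lborel)"
      by (rule ft_multiplication_formula[OF f' h])
    also have "\<dots> = (\<integral>y. cnj (f (- y)) * (sqrt (2 * pi) / \<epsilon> * gaussian ((x + y) / \<epsilon>)) \<partial>lborel)"
      unfolding ft_modulated_gaussian[OF \<open>\<epsilon> > 0\<close>] by simp
    \<comment> \<open>Substitution y = -x + \<epsilon> z; the Jacobian \<epsilon> cancels the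
      1/\<epsilon> of the transformed Gaussian.\<close>
    also have "\<dots> = \<epsilon> * (\<integral>z. cnj (f (- (- x + \<epsilon> * z))) * (sqrt (2 * pi) / \<epsilon> * gaussian ((x + (- x + \<epsilon> * z)) / \<epsilon>)) \<partial>lborel)"
      using \<open>\<epsilon> > 0\<close> by (subst lborel_integral_real_affine[of \<epsilon> _ "- x"]) (auto simp: scaleR_conv_of_real)
    also have "\<dots> = \<epsilon> * (\<integral>z. (sqrt (2 * pi) / \<epsilon>) * (gaussian z * cnj (f (x - \<epsilon> * z))) \<partial>lborel)"
      using \<open>\<epsilon> > 0\<close> by (simp add: ac_simps)
    also have "\<dots> = sqrt (2 * pi) * (\<integral>z. gaussian z * cnj (f (x - \<epsilon> * z)) \<partial>lborel)"
      using \<open>\<epsilon> > 0\<close> by (subst integral_mult_right_zero) simp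
    finally show ?thesis .
  qed
  then have "(\<integral>x. f x * ft ?g x \<partial>lborel) = (\<integral>x. sqrt (2 * pi) * (f x * (\<integral>z. gaussian z * cnj (f (x - \<epsilon> * z)) \<partial>lborel)) \<partial>lborel)"
    by (simp add: ac_simps)
  then show "(\<integral>\<xi>. ft f \<xi> * ?g \<xi> \<partial>lborel) =
      sqrt (2 * pi) * (\<integral>x. f x * (\<integral>z. gaussian z * cnj (f (x - \<epsilon> * z)) \<partial>lborel) \<partial>lborel)"
    unfolding ft_multiplication_formula[OF f g] by simp
qed

text \<open>After exchanging the integrals, the expression is the Gaussian average of the
  autocorrelation \<open>A\<close> at scale \<epsilon>. Boundedness of f reduces continuity of
  \<open>A\<close> at 0 to translation continuity in L^1 and bounds \<open>A\<close> uniformly, so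
  dominated convergence applies.\<close>

lemma gauss_mollifier_limit:
  assumes f: "integrable lborel f" and M: "\<And>x. cmod (f x) \<le> M"
    and \<epsilon>: "\<epsilon> \<longlonglongrightarrow> 0"
  shows "(\<lambda>n. \<integral>x. f x * (\<integral>z. gaussian z * cnj (f (x - \<epsilon> n * z)) \<partial>lborel) \<partial>lborel)
    \<longlonglongrightarrow> (\<integral>x. f x * cnj (f x) \<partial>lborel)"
proof -
  have [measurable]: "f \<in> borel_measurable borel" using f by auto
  define A where "A t = (\<integral>x. f x * cnj (f (x - t)) \<partial>lborel)" for t
  have int: "integrable lborel (\<lambda>x. f x * cnj (f (x - t)))" for t
  proof -
    have "integrable lborel (\<lambda>x. of_real M * f x)" using f by simp
    then show ?thesis
    proof (rule Bochner_Integration.integrable_bound)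
      show "AE x in lborel. cmod (f x * cnj (f (x - t))) \<le> cmod (of_real M * f x)"
      proof (intro AE_I2)
        fix x show "cmod (f x * cnj (f (x - t))) \<le> cmod (of_real M * f x)"
          using mult_left_mono[OF M[of "x - t"] norm_ge_zero[of "f x"]] norm_ge_zero[of "f x"] M[of x]
          by (simp add: norm_mult abs_of_nonneg[of M] order_trans[OF norm_ge_zero M] ac_simps)
      qed
    qed measurable
  qed
  have Adiff: "cmod (A t - A 0) \<le> M * (\<integral>x. cmod (f (x - t) - f x) \<partial>lborel)" for t
  proof -
    have "A t - A 0 = (\<integral>x. f x * cnj (f (x - t)) - f x * cnj (f (x - 0)) \<partial>lborel)"
      unfolding A_def by (rule Bochner_Integration.integral_diff[symmetric, OF int int])
    also have "\<dots> = (\<integral>x. f x * cnj (f (x - t) - f x) \<partial>lborel)"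
      by (simp add: algebra_simps)
    finally have "cmod (A t - A 0) \<le> (\<integral>x. cmod (f x * cnj (f (x - t) - f x)) \<partial>lborel)"
      by (simp only: integral_norm_bound)
    also have "\<dots> \<le> (\<integral>x. M * cmod (f (x - t) - f x) \<partial>lborel)"
    proof (rule integral_mono')
      show "integrable lborel (\<lambda>x. M * cmod (f (x - t) - f x))"
        using f integrable_translate[OF f, of t] by simp
      show "cmod (f x * cnj (f (x - t) - f x)) \<le> M * cmod (f (x - t) - f x)" for x
        unfolding norm_mult complex_mod_cnj by (intro mult_right_mono M) simp
    qed (simp add: order_trans[OF norm_ge_zero M])
    finally show ?thesis by simp
  qed
  have A_lim: "(\<lambda>n. A (h n)) \<longlonglongrightarrow> A 0" if "h \<longlonglongrightarrow> 0" for h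
  proof (rule LIM_zero_cancel, rule Lim_null_comparison)
    show "\<forall>\<^sub>F n in sequentially. norm (A (h n) - A 0) \<le> M * (\<integral>x. cmod (f (x - h n) - f x) \<partial>lborel)"
      using Adiff by simp
    show "(\<lambda>n. M * (\<integral>x. cmod (f (x - h n) - f x) \<partial>lborel)) \<longlonglongrightarrow> 0"
      using tendsto_mult[OF tendsto_const[of M] L1_translate_continuous[OF f that]] by simp
  qed
  have A_bound: "cmod (A t) \<le> M * (\<integral>x. cmod (f x) \<partial>lborel)" for t
  proof -
    have "cmod (A t) \<le> (\<integral>x. cmod (f x * cnj (f (x - t))) \<partial>lborel)"
      unfolding A_def by (rule integral_norm_bound)
    also have "\<dots> \<le> (\<integral>x. M * cmod (f x) \<partial>lborel)"
      using f by (intro integral_mono') (auto simp: norm_mult mult.commute[of M] order_trans[OF norm_ge_zero M] intro!: mult_left_mono M)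
    finally show ?thesis by simp
  qed
  have [measurable]: "A \<in> borel_measurable borel"
    unfolding A_def[abs_def] by measurable
  have swap: "(\<integral>x. f x * (\<integral>z. gaussian z * cnj (f (x - e * z)) \<partial>lborel) \<partial>lborel) = (\<integral>z. gaussian z * A (e * z) \<partial>lborel)" for e
  proof -
    have "(\<integral>z. (\<integral>x. cnj (f (x - e * z)) * (f x * gaussian z) \<partial>lborel) \<partial>lborel) =
        (\<integral>x. (\<integral>z. cnj (f (x - e * z)) * (f x * gaussian z) \<partial>lborel) \<partial>lborel)"
      by (rule lborel_pair.Fubini_integral, rule integrable_lborel_pair_mult[OF f integrable_gaussian, where B = M])
        (simp_all add: case_prod_beta' M)
    moreover have "(\<lambda>x. cnj (f (x - e * z)) * (f x * gaussian z)) = (\<lambda>x. gaussian z * (f x * cnj (f (x - e * z))))" for z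
      by (simp add: ac_simps)
    moreover have "(\<lambda>z. cnj (f (x - e * z)) * (f x * gaussian z)) = (\<lambda>z. f x * (gaussian z * cnj (f (x - e * z))))" for x
      by (simp add: ac_simps)
    ultimately show ?thesis unfolding A_def by simp
  qed
  have "(\<lambda>n. \<integral>z. gaussian z * A (\<epsilon> n * z) \<partial>lborel) \<longlonglongrightarrow> (\<integral>z. gaussian z * A 0 \<partial>lborel)"
  proof (rule integral_dominated_convergence[where w = "\<lambda>z. std_normal_density z * (M * (\<integral>x. cmod (f x) \<partial>lborel))"])
    show "AE z in lborel. (\<lambda>n. gaussian z * A (\<epsilon> n * z)) \<longlonglongrightarrow> gaussian z * A 0"
      using \<epsilon> by (intro AE_I2 tendsto_mult tendsto_const A_lim tendsto_mult_left_zero)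
    show "AE z in lborel. norm (gaussian z * A (\<epsilon> n * z)) \<le> std_normal_density z * (M * (\<integral>x. cmod (f x) \<partial>lborel))" for n
      by (intro AE_I2) (simp add: norm_mult mult_left_mono A_bound)
  qed auto
  also have "(\<integral>z. gaussian z * A 0 \<partial>lborel) = A 0" using integral_gaussian by simp
  finally show ?thesis unfolding swap by (simp add: A_def)
qed

text \<open>The damped identity at \<epsilon> = 1/(n + 1) has limits on both sides: monotone
  convergence in frequency, where the Gaussian weight increases as \<epsilon> falls, and the
  mollifier limit in space. Equating them also shows that |ft f|^2 is integrable.\<close>

lemma plancherel_bounded:
  assumes f: "integrable lborel f" and M: "\<And>x. cmod (f x) \<le> M"
  shows "(\<integral>\<^sup>+\<xi>. ennreal ((cmod (ft f \<xi>))\<^sup>2) \<partial>lborel) = ennreal (2 * pi * (\<integral>x. (cmod (f x))\<^sup>2 \<partial>lborel))"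
proof -
  have [measurable]: "f \<in> borel_measurable borel" using f by auto
  define \<epsilon> :: "nat \<Rightarrow> real" where "\<epsilon> n = 1 / real (Suc n)" for n
  have \<epsilon>: "\<epsilon> \<longlonglongrightarrow> 0" unfolding \<epsilon>_def[abs_def] by (rule LIMSEQ_Suc[OF lim_1_over_n])
  have \<epsilon>_pos: "\<epsilon> n > 0" for n by (simp add: \<epsilon>_def)
  let ?q = "\<lambda>n \<xi>. (cmod (ft f \<xi>))\<^sup>2 * std_normal_density (\<epsilon> n * \<xi>)"
  have q_cplx: "complex_of_real (?q n \<xi>) = ft f \<xi> * (cnj (ft f \<xi>) * gaussian (\<epsilon> n * \<xi>))" for n \<xi>
    by (simp only: of_real_mult mult.assoc[symmetric] complex_norm_square)
  have q_int: "integrable lborel (?q n)" for n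
  proof -
    have "integrable lborel (\<lambda>\<xi>. of_real (\<integral>x. cmod (f x) \<partial>lborel) * (cnj (ft f \<xi>) * gaussian (\<epsilon> n * \<xi>)))"
      using gauss_weighted_parseval(1)[OF f \<epsilon>_pos[of n]] by simp
    then have "integrable lborel (\<lambda>\<xi>. ft f \<xi> * (cnj (ft f \<xi>) * gaussian (\<epsilon> n * \<xi>)))"
      by (rule Bochner_Integration.integrable_bound)
        (measurable, auto intro!: AE_I2 mult_right_mono norm_ft_le simp: norm_mult)
    then show ?thesis unfolding q_cplx[symmetric] by (simp only: complex_of_real_integrable_eq)
  qed
  have "complex_of_real (\<integral>\<xi>. ?q n \<xi> \<partial>lborel) =
      sqrt (2 * pi) * (\<integral>x. f x * (\<integral>z. gaussian z * cnj (f (x - \<epsilon> n * z)) \<partial>lborel) \<partial>lborel)" for n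
    unfolding gauss_weighted_parseval(2)[OF f \<epsilon>_pos[of n], symmetric] q_cplx[symmetric] by (rule integral_complex_of_real[symmetric])
  then have "(\<lambda>n. complex_of_real (\<integral>\<xi>. ?q n \<xi> \<partial>lborel)) \<longlonglongrightarrow> sqrt (2 * pi) * (\<integral>x. f x * cnj (f x) \<partial>lborel)"
    using tendsto_mult[OF tendsto_const gauss_mollifier_limit[OF f M \<epsilon>]] by simp
  also have "sqrt (2 * pi) * (\<integral>x. f x * cnj (f x) \<partial>lborel) = complex_of_real (sqrt (2 * pi) * (\<integral>x. (cmod (f x))\<^sup>2 \<partial>lborel))"
    by (simp only: complex_norm_square[symmetric] integral_complex_of_real of_real_mult)
  finally have lim1: "(\<lambda>n. \<integral>\<xi>. ?q n \<xi> \<partial>lborel) \<longlonglongrightarrow> sqrt (2 * pi) * (\<integral>x. (cmod (f x))\<^sup>2 \<partial>lborel)"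
    by (simp only: tendsto_of_real_iff)
  \<comment> \<open>With nonnegative integrals the limit can be taken before it is known to be
    finite; the weight tends to its value at 0.\<close>
  have lim2: "(\<lambda>n. \<integral>\<^sup>+\<xi>. ennreal (?q n \<xi>) \<partial>lborel) \<longlonglongrightarrow> (\<integral>\<^sup>+\<xi>. ennreal ((cmod (ft f \<xi>))\<^sup>2 * std_normal_density 0) \<partial>lborel)"
  proof (rule nn_integral_LIMSEQ)
    have "std_normal_density (\<epsilon> m * \<xi>) \<le> std_normal_density (\<epsilon> n * \<xi>)" if "m \<le> n" for m n \<xi>
    proof -
      have "\<epsilon> n \<le> \<epsilon> m" using that by (simp add: \<epsilon>_def field_simps)
      then have "(\<epsilon> n)\<^sup>2 * \<xi>\<^sup>2 \<le> (\<epsilon> m)\<^sup>2 * \<xi>\<^sup>2"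
        by (intro mult_right_mono power_mono) (auto simp: \<epsilon>_pos less_imp_le)
      then show ?thesis unfolding std_normal_density_def power_mult_distrib
        by (intro mult_left_mono) auto
    qed
    then show "incseq (\<lambda>n \<xi>. ennreal (?q n \<xi>))"
      by (auto simp: incseq_def le_fun_def intro!: ennreal_leI mult_left_mono)
    fix \<xi>
    have "(\<lambda>n. std_normal_density (\<epsilon> n * \<xi>)) \<longlonglongrightarrow> 1 / sqrt (2 * pi) * exp (- (0 * \<xi>)\<^sup>2 / 2)"
      unfolding std_normal_density_def by (intro tendsto_intros \<epsilon>) auto
    then have "(\<lambda>n. std_normal_density (\<epsilon> n * \<xi>)) \<longlonglongrightarrow> std_normal_density 0"
      unfolding std_normal_density_def by simp
    then show "(\<lambda>n. ennreal (?q n \<xi>)) \<longlonglongrightarrow> ennreal ((cmod (ft f \<xi>))\<^sup>2 * std_normal_density 0)"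
      by (intro tendsto_ennrealI tendsto_intros)
  qed measurable
  have nn_eq: "(\<lambda>n. \<integral>\<^sup>+\<xi>. ennreal (?q n \<xi>) \<partial>lborel) = (\<lambda>n. ennreal (\<integral>\<xi>. ?q n \<xi> \<partial>lborel))"
    by (intro ext nn_integral_eq_integral q_int) auto
  have "(\<integral>\<^sup>+\<xi>. ennreal ((cmod (ft f \<xi>))\<^sup>2 * std_normal_density 0) \<partial>lborel) =
      ennreal (sqrt (2 * pi) * (\<integral>x. (cmod (f x))\<^sup>2 \<partial>lborel))"
    by (rule LIMSEQ_unique[OF lim2[unfolded nn_eq] tendsto_ennrealI[OF lim1]])
  \<comment> \<open>The density at 0 is 1 / sqrt (2 pi); multiplying by sqrt (2 pi) removes it and
    produces the factor 2 pi.\<close>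
  then have "ennreal (sqrt (2 * pi)) * (\<integral>\<^sup>+\<xi>. ennreal ((cmod (ft f \<xi>))\<^sup>2 * std_normal_density 0) \<partial>lborel) =
      ennreal (2 * pi * (\<integral>x. (cmod (f x))\<^sup>2 \<partial>lborel))"
    by (simp add: ennreal_mult[symmetric] mult.assoc[symmetric])
  moreover have "ennreal (sqrt (2 * pi)) * (\<integral>\<^sup>+\<xi>. ennreal ((cmod (ft f \<xi>))\<^sup>2 * std_normal_density 0) \<partial>lborel)
      = (\<integral>\<^sup>+\<xi>. ennreal ((cmod (ft f \<xi>))\<^sup>2) \<partial>lborel)"
    by (subst nn_integral_cmult[symmetric], measurable) (simp add: ennreal_mult[symmetric] gaussian_0)
  ultimately show ?thesis by simp
qed

section \<open>Removing boundedness from Plancherel's identity\<close>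

lemma abs_l2_dominated_convergence:
  assumes f: "sq_int f" and s: "\<And>n. s n \<in> borel_measurable borel"
    and le: "\<And>n x. cmod (s n x) \<le> cmod (f x)" and lim: "\<And>x. (\<lambda>n. s n x) \<longlonglongrightarrow> f x"
  shows "\<And>n. sq_int (s n)" "(\<lambda>n. abs_l2 (s n)) \<longlonglongrightarrow> abs_l2 f"
proof -
  have [measurable]: "f \<in> borel_measurable borel" by (rule sq_int_measurable[OF f])
  note [measurable] = s
  show sq: "sq_int (s n)" for n
    using sq_int_bound(1)[OF f s] le by simp
  have "(\<lambda>n. \<integral>x. (cmod (s n x - f x))\<^sup>2 \<partial>lborel) \<longlonglongrightarrow> (\<integral>x. 0 \<partial>(lborel :: real measure))"
  \<comment> \<open>Domination by the limit itself gives |s_n - f| <= 2 |f|, hence 4 |f|^2.\<close>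
  proof (rule integral_dominated_convergence[where w = "\<lambda>x. 4 * (cmod (f x))\<^sup>2"])
    show "AE x in lborel. (\<lambda>n. (cmod (s n x - f x))\<^sup>2) \<longlonglongrightarrow> 0"
    proof (intro AE_I2)
      fix x
      have "(\<lambda>n. (cmod (s n x - f x))\<^sup>2) \<longlonglongrightarrow> (cmod (f x - f x))\<^sup>2"
        by (intro tendsto_intros lim)
      then show "(\<lambda>n. (cmod (s n x - f x))\<^sup>2) \<longlonglongrightarrow> 0" by simp
    qed
    show "AE x in lborel. norm ((cmod (s n x - f x))\<^sup>2) \<le> 4 * (cmod (f x))\<^sup>2" for n
    proof (intro AE_I2)
      fix x
      have "cmod (s n x - f x) \<le> 2 * cmod (f x)"
        using norm_triangle_ineq4[of "s n x" "f x"] le[of n x] by simp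
      then have "(cmod (s n x - f x))\<^sup>2 \<le> (2 * cmod (f x))\<^sup>2" by (intro power_mono) auto
      then show "norm ((cmod (s n x - f x))\<^sup>2) \<le> 4 * (cmod (f x))\<^sup>2" by (simp add: power_mult_distrib)
    qed
    show "integrable lborel (\<lambda>x. 4 * (cmod (f x))\<^sup>2)" using f by (simp add: sq_int_def)
  qed measurable
  then have "(\<lambda>n. (norm (abs_l2 (s n) - abs_l2 f))\<^sup>2) \<longlonglongrightarrow> 0"
    by (simp add: minus_abs_l2[OF sq f] norm_abs_l2_sq[OF sq_int_diff[OF sq f]])
  then have "(\<lambda>n. norm (abs_l2 (s n) - abs_l2 f)) \<longlonglongrightarrow> 0"
    using tendsto_real_sqrt by fastforce
  then show "(\<lambda>n. abs_l2 (s n)) \<longlonglongrightarrow> abs_l2 f"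
    by (simp add: LIM_zero_cancel tendsto_norm_zero_iff)
qed

lemma plancherel_bounded_l2:
  assumes f: "integrable lborel f" "sq_int f" and M: "\<And>x. cmod (f x) \<le> M"
  shows "sq_int (ft f)" "norm (abs_l2 (ft f)) = sqrt (2 * pi) * norm (abs_l2 f)"
proof -
  have [measurable]: "f \<in> borel_measurable borel" by (rule sq_int_measurable[OF f(2)])
  have eq: "(\<integral>\<^sup>+\<xi>. ennreal ((cmod (ft f \<xi>))\<^sup>2) \<partial>lborel) = ennreal ((sqrt (2 * pi) * norm (abs_l2 f))\<^sup>2)"
    using plancherel_bounded[OF f(1) M] by (simp add: power_mult_distrib norm_abs_l2_sq[OF f(2)])
  show sq: "sq_int (ft f)" by (rule sq_int_nnI[OF _ eq[THEN eq_refl]]) measurable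
  have "(norm (abs_l2 (ft f)))\<^sup>2 = (sqrt (2 * pi) * norm (abs_l2 f))\<^sup>2"
    using eq unfolding nn_norm_abs_l2[OF sq] by (subst (asm) ennreal_inj) auto
  then show "norm (abs_l2 (ft f)) = sqrt (2 * pi) * norm (abs_l2 f)"
    by (simp add: power2_eq_iff_nonneg)
qed

text \<open>Truncation in height makes f bounded while keeping |f| as a majorant, so a single
  sequence converges in L^2 and, by dominated convergence in L^1, has pointwise convergent
  transforms.\<close>

lemma plancherel_L1_approx:
  assumes f: "integrable lborel f" "sq_int f"
  defines "s \<equiv> \<lambda>k x. if cmod (f x) \<le> real k then f x else 0"
  shows "\<And>k. integrable lborel (s k)" "\<And>k. sq_int (s k)" "\<And>k x. cmod (s k x) \<le> real k"
    "(\<lambda>k. abs_l2 (s k)) \<longlonglongrightarrow> abs_l2 f" "\<And>\<xi>. (\<lambda>k. ft (s k) \<xi>) \<longlonglongrightarrow> ft f \<xi>"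
proof -
  have [measurable]: "f \<in> borel_measurable borel" by (rule sq_int_measurable[OF f(2)])
  have s_meas [measurable]: "s k \<in> borel_measurable borel" for k
    unfolding s_def by measurable
  have le: "cmod (s k x) \<le> cmod (f x)" for k x by (simp add: s_def)
  have lim: "(\<lambda>k. s k x) \<longlonglongrightarrow> f x" for x
  proof (rule tendsto_eventually, unfold eventually_sequentially)
    obtain K :: nat where "cmod (f x) \<le> real K" using real_arch_simple by blast
    then show "\<exists>N. \<forall>k\<ge>N. s k x = f x" by (intro exI[of _ K]) (auto simp: s_def)
  qed
  show int: "integrable lborel (s k)" for k
    by (rule Bochner_Integration.integrable_bound[OF f(1)]) (auto simp: le)
  show "cmod (s k x) \<le> real k" for k x by (simp add: s_def)
  show "sq_int (s k)" for k by (rule abs_l2_dominated_convergence(1)[OF f(2) s_meas le lim])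
  show "(\<lambda>k. abs_l2 (s k)) \<longlonglongrightarrow> abs_l2 f" by (rule abs_l2_dominated_convergence(2)[OF f(2) s_meas le lim])
  show "(\<lambda>k. ft (s k) \<xi>) \<longlonglongrightarrow> ft f \<xi>" for \<xi>
    unfolding ft_def
  proof (rule integral_dominated_convergence[where w = "\<lambda>x. cmod (f x)"])
    show "AE x in lborel. (\<lambda>k. cis (- (x * \<xi>)) * s k x) \<longlonglongrightarrow> cis (- (x * \<xi>)) * f x"
      by (intro AE_I2 tendsto_intros lim)
    show "AE x in lborel. norm (cis (- (x * \<xi>)) * s k x) \<le> cmod (f x)" for k
      by (simp add: norm_mult le)
  qed (use f in auto)
qed

text \<open>Fatou loses equality but places \<open>ft f\<close> in L^2. The inequality is then
  applied to the differences s_k - f in \<open>plancherel_L1\<close>, where it yields L^2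
  convergence of the transforms and thereby equality.\<close>

lemma plancherel_L1_le:
  assumes f: "integrable lborel f" "sq_int f"
  shows "sq_int (ft f)" "norm (abs_l2 (ft f)) \<le> sqrt (2 * pi) * norm (abs_l2 f)"
proof -
  have [measurable]: "f \<in> borel_measurable borel" by (rule sq_int_measurable[OF f(2)])
  define s where "s k x = (if cmod (f x) \<le> real k then f x else 0)" for k x
  note s = plancherel_L1_approx[OF f, folded s_def]
  note sb = plancherel_bounded_l2[OF s(1) s(2) s(3)]
  have [measurable]: "s k \<in> borel_measurable borel" for k using s(1)[of k] by auto
  have "cmod (s k x) \<le> cmod (f x)" for k x by (simp add: s_def)
  then have nle: "norm (abs_l2 (s k)) \<le> norm (abs_l2 f)" for k
    by (intro sq_int_bound(2)[OF f(2)]) auto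
  have "(\<integral>\<^sup>+\<xi>. ennreal ((cmod (ft f \<xi>))\<^sup>2) \<partial>lborel) = (\<integral>\<^sup>+\<xi>. liminf (\<lambda>k. ennreal ((cmod (ft (s k) \<xi>))\<^sup>2)) \<partial>lborel)"
    by (intro nn_integral_cong lim_imp_Liminf[symmetric] sequentially_bot tendsto_ennrealI tendsto_intros s(5))
  also have "\<dots> \<le> liminf (\<lambda>k. \<integral>\<^sup>+\<xi>. ennreal ((cmod (ft (s k) \<xi>))\<^sup>2) \<partial>lborel)"
    by (intro nn_integral_liminf) measurable
  also have "\<dots> \<le> liminf (\<lambda>k::nat. ennreal ((sqrt (2 * pi) * norm (abs_l2 f))\<^sup>2))"
    unfolding nn_norm_abs_l2[OF sb(1)] sb(2)
    by (intro Liminf_mono always_eventually allI ennreal_leI power_mono mult_left_mono nle) auto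
  also have "\<dots> = ennreal ((sqrt (2 * pi) * norm (abs_l2 f))\<^sup>2)"
    by (simp add: Liminf_const)
  finally have le: "(\<integral>\<^sup>+\<xi>. ennreal ((cmod (ft f \<xi>))\<^sup>2) \<partial>lborel) \<le> ennreal ((sqrt (2 * pi) * norm (abs_l2 f))\<^sup>2)" .
  show "sq_int (ft f)" by (rule sq_int_nnI[OF _ le]) measurable
  show "norm (abs_l2 (ft f)) \<le> sqrt (2 * pi) * norm (abs_l2 f)"
    by (rule norm_abs_l2_le_nn[OF _ le]) simp_all
qed

lemma plancherel_L1:
  assumes f: "integrable lborel f" "sq_int f"
  shows "norm (abs_l2 (ft f)) = sqrt (2 * pi) * norm (abs_l2 f)"
proof -
  define s where "s k x = (if cmod (f x) \<le> real k then f x else 0)" for k x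
  note s = plancherel_L1_approx[OF f, folded s_def]
  note sb = plancherel_bounded_l2[OF s(1) s(2) s(3)]
  have le: "norm (abs_l2 (ft (s k)) - abs_l2 (ft f)) \<le> sqrt (2 * pi) * norm (abs_l2 (s k) - abs_l2 f)" for k
    using plancherel_L1_le(2)[OF Bochner_Integration.integrable_diff[OF s(1)[of k] f(1)] sq_int_diff[OF s(2)[of k] f(2)]]
    by (simp add: minus_abs_l2 s(2) f(2) sb(1) plancherel_L1_le(1)[OF f] ft_diff[OF s(1) f(1), abs_def])
  have "(\<lambda>k. sqrt (2 * pi) * norm (abs_l2 (s k) - abs_l2 f)) \<longlonglongrightarrow> 0"
    by (intro tendsto_mult_right_zero tendsto_norm_zero LIM_zero s(4))
  then have "(\<lambda>k. abs_l2 (ft (s k)) - abs_l2 (ft f)) \<longlonglongrightarrow> 0"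
    by (rule Lim_null_comparison[OF always_eventually[OF allI[OF le]]])
  then have "(\<lambda>k. norm (abs_l2 (ft (s k)))) \<longlonglongrightarrow> norm (abs_l2 (ft f))"
    by (rule tendsto_norm[OF LIM_zero_cancel])
  moreover have "(\<lambda>k. norm (abs_l2 (ft (s k)))) \<longlonglongrightarrow> sqrt (2 * pi) * norm (abs_l2 f)"
    unfolding sb(2) by (intro tendsto_intros s(4))
  ultimately show ?thesis by (rule LIMSEQ_unique)
qed

lemma plancherel_L1_diff:
  assumes f: "integrable lborel f" "sq_int f" and g: "integrable lborel g" "sq_int g"
  shows "norm (abs_l2 (ft f) - abs_l2 (ft g)) = sqrt (2 * pi) * norm (abs_l2 f - abs_l2 g)"
  using plancherel_L1[OF Bochner_Integration.integrable_diff[OF f(1) g(1)] sq_int_diff[OF f(2) g(2)]]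
  by (simp add: minus_abs_l2 f g plancherel_L1_le(1) ft_diff[OF f(1) g(1), abs_def])

section \<open>The Fourier transform on \<open>L\<^sup>2\<close>\<close>

definition trunc :: "l2 \<Rightarrow> real \<Rightarrow> real \<Rightarrow> complex" where
  "trunc u N x = indicat_real {-N..N} x *\<^sub>R rep_l2 u x"

lemma borel_measurable_trunc [measurable]: "trunc u N \<in> borel_measurable borel"
  unfolding trunc_def[abs_def] by measurable

lemma sq_int_trunc: "sq_int (trunc u N)"
  by (rule sq_int_bound(1)[OF sq_int_rep_l2[of u]]) (auto simp: trunc_def indicator_def)

lemma integrable_trunc: "integrable lborel (trunc u N)"
proof -
  have "integrable lborel (\<lambda>x. indicat_real {-N..N} x + (cmod (rep_l2 u x))\<^sup>2)"
    by (intro Bochner_Integration.integrable_add integrable_sq_rep_l2) (simp add: integrable_indicator_iff emeasure_lborel_Icc_eq)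
  then show ?thesis
  proof (rule Bochner_Integration.integrable_bound)
    have "y \<le> 1 + y\<^sup>2" for y :: real
      using zero_le_power2[of "y - 1/2"] by (simp add: power2_eq_square algebra_simps)
    then show "AE x in lborel. norm (trunc u N x) \<le> norm (indicat_real {-N..N} x + (cmod (rep_l2 u x))\<^sup>2)"
      by (intro AE_I2) (simp add: trunc_def indicator_def)
  qed measurable
qed

lemma trunc_tendsto: "((\<lambda>N. abs_l2 (trunc u N)) \<longlongrightarrow> u) at_top"
proof (rule tendsto_at_topI_sequentially)
  fix X :: "nat \<Rightarrow> real" assume X: "filterlim X at_top sequentially"
  have "(\<lambda>n. abs_l2 (trunc u (X n))) \<longlonglongrightarrow> abs_l2 (rep_l2 u)"
  proof (rule abs_l2_dominated_convergence(2))
    show "cmod (trunc u (X n) x) \<le> cmod (rep_l2 u x)" for n x by (simp add: trunc_def indicator_def)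
    fix x
    have "\<forall>\<^sub>F n in sequentially. X n \<ge> \<bar>x\<bar>" using X by (simp add: filterlim_at_top)
    then have "\<forall>\<^sub>F n in sequentially. trunc u (X n) x = rep_l2 u x"
      by eventually_elim (auto simp: trunc_def indicator_def)
    then show "(\<lambda>n. trunc u (X n) x) \<longlonglongrightarrow> rep_l2 u x" by (rule tendsto_eventually)
  qed auto
  then show "(\<lambda>n. abs_l2 (trunc u (X n))) \<longlonglongrightarrow> u" by simp
qed

lemma tendsto_ennreal_sq_iff:
  assumes "\<And>x. 0 \<le> d x"
  shows "((\<lambda>x. ennreal ((d x)\<^sup>2)) \<longlongrightarrow> 0) F \<longleftrightarrow> (d \<longlongrightarrow> 0) F"
proof
  assume "((\<lambda>x. ennreal ((d x)\<^sup>2)) \<longlongrightarrow> 0) F"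
  then have "((\<lambda>x. ennreal ((d x)\<^sup>2)) \<longlongrightarrow> ennreal 0) F" by simp
  then have "((\<lambda>x. (d x)\<^sup>2) \<longlongrightarrow> 0) F" by (subst (asm) tendsto_ennreal_iff) auto
  then show "(d \<longlongrightarrow> 0) F" using tendsto_real_sqrt[of "\<lambda>x. (d x)\<^sup>2" 0 F] assms by simp
next
  assume "(d \<longlongrightarrow> 0) F"
  then have "((\<lambda>x. ennreal ((d x)\<^sup>2)) \<longlongrightarrow> ennreal (0\<^sup>2)) F" by (intro tendsto_ennrealI tendsto_intros)
  then show "((\<lambda>x. ennreal ((d x)\<^sup>2)) \<longlongrightarrow> 0) F" by simp
qed

text \<open>The nonnegative integral in \<open>has_fourier\<close> is a squared L^2 distance. As
  norm convergence, the notion inherits uniqueness of limits.\<close>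

lemma has_fourier_iff:
  "has_fourier u v \<longleftrightarrow> ((\<lambda>N. abs_l2 (ft (trunc u N))) \<longlongrightarrow> v) at_top"
proof -
  have sq: "sq_int (ft (trunc u N))" for N
    by (intro plancherel_L1_le(1) integrable_trunc sq_int_trunc)
  have "(LINT x:{-N..N}|lborel. cis (- (x * \<xi>)) * rep_l2 u x) = ft (trunc u N) \<xi>" for N \<xi>
    unfolding set_lebesgue_integral_def ft_def trunc_def by simp
  moreover have "(\<integral>\<^sup>+\<xi>. ennreal ((cmod (ft (trunc u N) \<xi> - rep_l2 v \<xi>))\<^sup>2) \<partial>lborel) =
      ennreal ((norm (abs_l2 (ft (trunc u N)) - v))\<^sup>2)" for N
    using nn_norm_abs_l2[OF sq_int_diff[OF sq sq_int_rep_l2[of v]], of N] minus_abs_l2[OF sq sq_int_rep_l2[of v], of N]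
    by simp
  moreover have "has_fourier u v \<longleftrightarrow> ((\<lambda>N. \<integral>\<^sup>+\<xi>. ennreal ((cmod ((LINT x:{-N..N}|lborel. cis (- (x * \<xi>)) * rep_l2 u x) - rep_l2 v \<xi>))\<^sup>2)
      \<partial>lborel) \<longlongrightarrow> 0) at_top"
    using has_fourier.abs_eq[of "rep_l2 u" "rep_l2 v"] by (simp add: l2_rel_def)
  ultimately have "has_fourier u v \<longleftrightarrow> ((\<lambda>N. norm (abs_l2 (ft (trunc u N)) - v)) \<longlongrightarrow> 0) at_top"
    by (simp add: tendsto_ennreal_sq_iff)
  then show ?thesis by (simp add: tendsto_norm_zero_iff Lim_null[symmetric])
qed

text \<open>Shows that the description defining \<open>fourier\<close> denotes. By Plancherel the
  transforms of the truncations at integer N form a Cauchy sequence; an exact formula for the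
  distance to its limit then extends the convergence to all real N.\<close>

lemma fourier_tendsto: "((\<lambda>N. abs_l2 (ft (trunc u N))) \<longlongrightarrow> fourier u) at_top"
proof -
  have iso: "norm (abs_l2 (ft (trunc u N)) - abs_l2 (ft (trunc u M))) =
      sqrt (2 * pi) * norm (abs_l2 (trunc u N) - abs_l2 (trunc u M))" for N M
    by (intro plancherel_L1_diff integrable_trunc sq_int_trunc)
  have tr: "(\<lambda>n. abs_l2 (trunc u (real n))) \<longlonglongrightarrow> u"
    using filterlim_compose[OF trunc_tendsto filterlim_real_sequentially] .
  have "Cauchy (\<lambda>n. abs_l2 (ft (trunc u (real n))))"
  proof (rule CauchyI)
    fix e :: real assume "0 < e"
    then have "0 < e / sqrt (2 * pi)" by simp
    from CauchyD[OF LIMSEQ_imp_Cauchy[OF tr] this]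
    show "\<exists>M. \<forall>m\<ge>M. \<forall>n\<ge>M. norm (abs_l2 (ft (trunc u (real m))) - abs_l2 (ft (trunc u (real n)))) < e"
      unfolding iso by (simp add: field_simps)
  qed
  then obtain v where v: "(\<lambda>n. abs_l2 (ft (trunc u (real n)))) \<longlonglongrightarrow> v"
    using Cauchy_convergent convergentD by blast
  have "norm (abs_l2 (ft (trunc u N)) - v) = sqrt (2 * pi) * norm (abs_l2 (trunc u N) - u)" for N
  proof (rule LIMSEQ_unique)
    show "(\<lambda>n. norm (abs_l2 (ft (trunc u N)) - abs_l2 (ft (trunc u (real n))))) \<longlonglongrightarrow> norm (abs_l2 (ft (trunc u N)) - v)"
      by (intro tendsto_intros v)
    show "(\<lambda>n. norm (abs_l2 (ft (trunc u N)) - abs_l2 (ft (trunc u (real n))))) \<longlonglongrightarrow> sqrt (2 * pi) * norm (abs_l2 (trunc u N) - u)"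
      unfolding iso by (intro tendsto_intros tr)
  qed
  moreover have "((\<lambda>N. sqrt (2 * pi) * norm (abs_l2 (trunc u N) - u)) \<longlongrightarrow> sqrt (2 * pi) * norm (u - u)) at_top"
    by (intro tendsto_intros trunc_tendsto)
  ultimately have "((\<lambda>N. norm (abs_l2 (ft (trunc u N)) - v)) \<longlongrightarrow> 0) at_top" by simp
  then have v: "((\<lambda>N. abs_l2 (ft (trunc u N))) \<longlongrightarrow> v) at_top"
    by (simp add: tendsto_norm_zero_iff Lim_null[symmetric])
  have "fourier u = v" unfolding fourier_def
  proof (rule the_equality)
    show "has_fourier u v" using v by (simp add: has_fourier_iff)
    show "w = v" if "has_fourier u w" for w
      using that v unfolding has_fourier_iff by (rule tendsto_unique[OF trivial_limit_at_top_linorder])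
  qed
  with v show ?thesis by simp
qed

lemma fourier_abs_l2:
  assumes f: "integrable lborel f" "sq_int f"
  shows "fourier (abs_l2 f) = abs_l2 (ft f)"
proof -
  let ?u = "abs_l2 f"
  have "norm (abs_l2 (ft (trunc ?u N)) - abs_l2 (ft f)) = sqrt (2 * pi) * norm (abs_l2 (trunc ?u N) - ?u)" for N
    by (intro plancherel_L1_diff integrable_trunc sq_int_trunc f)
  moreover have "((\<lambda>N. sqrt (2 * pi) * norm (abs_l2 (trunc ?u N) - ?u)) \<longlongrightarrow> sqrt (2 * pi) * norm (?u - ?u)) at_top"
    by (intro tendsto_intros trunc_tendsto)
  ultimately have "((\<lambda>N. norm (abs_l2 (ft (trunc ?u N)) - abs_l2 (ft f))) \<longlongrightarrow> 0) at_top" by simp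
  then have "((\<lambda>N. abs_l2 (ft (trunc ?u N))) \<longlongrightarrow> abs_l2 (ft f)) at_top"
    by (simp add: tendsto_norm_zero_iff Lim_null[symmetric])
  with fourier_tendsto show ?thesis by (rule tendsto_unique[OF trivial_limit_at_top_linorder])
qed

lemma norm_fourier_diff: "norm (fourier u - fourier v) = sqrt (2 * pi) * norm (u - v)"
proof (rule tendsto_unique[OF trivial_limit_at_top_linorder])
  show "((\<lambda>N. norm (abs_l2 (ft (trunc u N)) - abs_l2 (ft (trunc v N)))) \<longlongrightarrow> norm (fourier u - fourier v)) at_top"
    by (intro tendsto_intros fourier_tendsto)
  show "((\<lambda>N. norm (abs_l2 (ft (trunc u N)) - abs_l2 (ft (trunc v N)))) \<longlongrightarrow> sqrt (2 * pi) * norm (u - v)) at_top"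
    unfolding plancherel_L1_diff[OF integrable_trunc sq_int_trunc integrable_trunc sq_int_trunc]
    by (intro tendsto_intros trunc_tendsto)
qed

text \<open>Reduces an identity for \<open>fourier\<close> to the integral transform. Any
  approximating sequence of integrable functions may be used, since \<open>fourier\<close> is an
  isometry up to a factor.\<close>

lemma fourier_eqI:
  assumes "\<And>n. integrable lborel (f n)" "\<And>n. sq_int (f n)" "(\<lambda>n. abs_l2 (f n)) \<longlonglongrightarrow> u"
    and "(\<lambda>n. abs_l2 (ft (f n))) \<longlonglongrightarrow> v"
  shows "fourier u = v"
proof (rule LIMSEQ_unique)
  have "(\<lambda>n. norm (fourier (abs_l2 (f n)) - fourier u)) \<longlonglongrightarrow> sqrt (2 * pi) * norm (u - u)"
    unfolding norm_fourier_diff by (intro tendsto_intros assms)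
  then show "(\<lambda>n. abs_l2 (ft (f n))) \<longlonglongrightarrow> fourier u"
    by (simp add: fourier_abs_l2[OF assms(1,2)] tendsto_norm_zero_iff Lim_null[symmetric])
qed (rule assms)

lemma seq_trunc:
  "(\<lambda>n. abs_l2 (trunc u (real n))) \<longlonglongrightarrow> u" "(\<lambda>n. abs_l2 (ft (trunc u (real n)))) \<longlonglongrightarrow> fourier u"
  using filterlim_compose[OF trunc_tendsto filterlim_real_sequentially]
    filterlim_compose[OF fourier_tendsto filterlim_real_sequentially] by auto

lemma sq_int_ft_trunc: "sq_int (ft (trunc u N))"
  by (intro plancherel_L1_le(1) integrable_trunc sq_int_trunc)

lemma fourier_add: "fourier (u + v) = fourier u + fourier v"
proof (rule fourier_eqI)
  let ?f = "\<lambda>n x. trunc u (real n) x + trunc v (real n) x"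
  show "integrable lborel (?f n)" "sq_int (?f n)" for n
    by (intro Bochner_Integration.integrable_add sq_int_add integrable_trunc sq_int_trunc)+
  show "(\<lambda>n. abs_l2 (?f n)) \<longlonglongrightarrow> u + v"
    using tendsto_add[OF seq_trunc(1)[of u] seq_trunc(1)[of v]] by (simp add: plus_abs_l2 sq_int_trunc)
  show "(\<lambda>n. abs_l2 (ft (?f n))) \<longlonglongrightarrow> fourier u + fourier v"
    using tendsto_add[OF seq_trunc(2)[of u] seq_trunc(2)[of v]]
    by (simp add: plus_abs_l2 sq_int_ft_trunc ft_add[OF integrable_trunc integrable_trunc, abs_def])
qed

lemma norm_l2_cscale: "norm (l2_cscale c u) = cmod c * norm u"
proof -
  have "(norm (l2_cscale c u))\<^sup>2 = (cmod c * norm u)\<^sup>2"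
    using norm_abs_l2_sq[OF sq_int_cmult[OF sq_int_rep_l2[of u], of c]] cscale_abs_l2[of "rep_l2 u" c]
    by (simp add: norm_mult power_mult_distrib norm_l2_sq)
  then show ?thesis by (simp add: power2_eq_iff_nonneg)
qed

lemma bounded_linear_cscale: "bounded_linear (l2_cscale c)"
proof (rule bounded_linear_intro[where K = "cmod c"])
  show "l2_cscale c (u + v) = l2_cscale c u + l2_cscale c v" for u v
    by (rule l2_eqI, use rep_plus_l2[of u v] rep_cscale_l2[of c "u + v"] rep_cscale_l2[of c u] rep_cscale_l2[of c v]
      rep_plus_l2[of "l2_cscale c u" "l2_cscale c v"]
      in eventually_elim) (simp add: distrib_left)
  show "l2_cscale c (r *\<^sub>R u) = r *\<^sub>R l2_cscale c u" for r u
    by (rule l2_eqI, use rep_scaleR_l2[of r u] rep_cscale_l2[of c "r *\<^sub>R u"] rep_cscale_l2[of c u] rep_scaleR_l2[of r "l2_cscale c u"]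
      in eventually_elim) (simp)
qed (simp add: norm_l2_cscale mult.commute)

lemma l2_cscale_of_real: "l2_cscale (of_real r) u = r *\<^sub>R u"
  by (rule l2_eqI, use rep_scaleR_l2[of r u] rep_cscale_l2[of "of_real r" u] in eventually_elim) (simp add: scaleR_conv_of_real)

lemma cscale_cscale: "l2_cscale a (l2_cscale b u) = l2_cscale (a * b) u"
  by (rule l2_eqI, use rep_cscale_l2[of a "l2_cscale b u"] rep_cscale_l2[of b u] rep_cscale_l2[of "a * b" u] in eventually_elim) simp

lemma cscale_one: "l2_cscale 1 u = u"
  using l2_cscale_of_real[of 1 u] by simp

lemma l2_cscale_minus_one: "l2_cscale (-1) u = - u"
  using l2_cscale_of_real[of "-1" u] by simp

lemma fourier_cscale: "fourier (l2_cscale c u) = l2_cscale c (fourier u)"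
proof (rule fourier_eqI)
  let ?f = "\<lambda>n x. c * trunc u (real n) x"
  show "integrable lborel (?f n)" "sq_int (?f n)" for n
    by (intro integrable_mult_right sq_int_cmult integrable_trunc sq_int_trunc)+
  show "(\<lambda>n. abs_l2 (?f n)) \<longlonglongrightarrow> l2_cscale c u"
    using bounded_linear.tendsto[OF bounded_linear_cscale seq_trunc(1)[of u], of c]
    by (simp add: cscale_abs_l2 sq_int_trunc)
  show "(\<lambda>n. abs_l2 (ft (?f n))) \<longlonglongrightarrow> l2_cscale c (fourier u)"
    using bounded_linear.tendsto[OF bounded_linear_cscale seq_trunc(2)[of u], of c]
    by (simp add: cscale_abs_l2 sq_int_ft_trunc ft_cmult[abs_def])
qed

lemma fourier_zero: "fourier 0 = 0"
  using fourier_add[of 0 0] by simp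

lemma norm_fourier: "norm (fourier u) = sqrt (2 * pi) * norm u"
  using norm_fourier_diff[of u 0] by (simp add: fourier_zero)

lemma bounded_linear_fourier: "bounded_linear fourier"
  by (rule bounded_linear_intro[where K = "sqrt (2 * pi)"])
    (simp_all add: fourier_add norm_fourier fourier_cscale flip: l2_cscale_of_real)

text \<open>Polarisation of the norm identity, which for a real inner product needs sums
  only.\<close>

lemma fourier_inner: "fourier u \<bullet> fourier v = 2 * pi * (u \<bullet> v)"
  unfolding dot_norm fourier_add[symmetric] norm_fourier by (simp add: power_mult_distrib algebra_simps)

section \<open>Conjugation\<close>

lemma sq_int_cnj: "sq_int f \<Longrightarrow> sq_int (\<lambda>x. cnj (f x))"
  by (auto simp: sq_int_def)

lemma sq_int_uminus_arg: "sq_int f \<Longrightarrow> sq_int (\<lambda>x. f (- x))"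
  using lborel_integrable_real_affine[of "\<lambda>x. (cmod (f x))\<^sup>2" "-1" 0] by (auto simp: sq_int_def)

lemma AE_lborel_uminus:
  fixes f g :: "real \<Rightarrow> complex"
  assumes [measurable]: "f \<in> borel_measurable borel" "g \<in> borel_measurable borel"
    and "AE x in lborel. f x = g x"
  shows "AE x in lborel. f (- x) = g (- x)"
  using AE_borel_affine[of "-1" "\<lambda>x. f x = g x" 0] assms(3) by simp

lift_definition l2_cnj :: "l2 \<Rightarrow> l2" is "\<lambda>f x. cnj (f x)"
  by (auto simp: l2_rel_def intro: sq_int_cnj)

text \<open>The image of complex conjugation under the transform, see \<open>fourier_cnj\<close>. It
  respects classes because Lebesgue null sets are invariant under reflection.\<close>

lift_definition l2_star :: "l2 \<Rightarrow> l2" is "\<lambda>f x. cnj (f (- x))"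
proof -
  fix f g assume *: "l2_rel f g"
  then have "AE x in lborel. f (- x) = g (- x)"
    by (intro AE_lborel_uminus) (auto simp: l2_rel_def sq_int_def)
  then show "l2_rel (\<lambda>x. cnj (f (- x))) (\<lambda>x. cnj (g (- x)))"
    using * by (auto simp: l2_rel_def intro!: sq_int_cnj sq_int_uminus_arg elim!: eventually_mono)
qed

lemma cnj_abs_l2: "sq_int f \<Longrightarrow> l2_cnj (abs_l2 f) = abs_l2 (\<lambda>x. cnj (f x))"
  by (intro l2_cnj.abs_eq l2_rel_refl)

lemma star_abs_l2: "sq_int f \<Longrightarrow> l2_star (abs_l2 f) = abs_l2 (\<lambda>x. cnj (f (- x)))"
  by (intro l2_star.abs_eq l2_rel_refl)

lemma rep_cnj_l2: "AE x in lborel. rep_l2 (l2_cnj u) x = cnj (rep_l2 u x)"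
  using rep_abs_l2[OF sq_int_cnj[OF sq_int_rep_l2[of u]]] cnj_abs_l2[of "rep_l2 u"] by simp

lemma rep_star_l2: "AE x in lborel. rep_l2 (l2_star u) x = cnj (rep_l2 u (- x))"
  using rep_abs_l2[OF sq_int_cnj[OF sq_int_uminus_arg[OF sq_int_rep_l2[of u]]]] star_abs_l2[of "rep_l2 u"] by simp

lemma norm_l2_cnj: "norm (l2_cnj u) = norm u"
  using norm_abs_l2[OF sq_int_cnj[OF sq_int_rep_l2[of u]]] cnj_abs_l2[of "rep_l2 u"]
    norm_abs_l2[OF sq_int_rep_l2[of u]] by simp

lemma norm_l2_star: "norm (l2_star u) = norm u"
  using norm_abs_l2[OF sq_int_cnj[OF sq_int_uminus_arg[OF sq_int_rep_l2[of u]]]] star_abs_l2[of "rep_l2 u"]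
    norm_abs_l2[OF sq_int_rep_l2[of u]] lborel_integral_real_affine[of "-1" "\<lambda>x. (cmod (rep_l2 u x))\<^sup>2" 0]
  by simp

lemma bounded_linear_cnj_l2: "bounded_linear l2_cnj"
proof (rule bounded_linear_intro[where K = 1])
  show "l2_cnj (u + v) = l2_cnj u + l2_cnj v" for u v
    by (rule l2_eqI, use rep_plus_l2[of u v] rep_cnj_l2[of "u + v"] rep_cnj_l2[of u] rep_cnj_l2[of v]
      rep_plus_l2[of "l2_cnj u" "l2_cnj v"] in eventually_elim) simp
  show "l2_cnj (r *\<^sub>R u) = r *\<^sub>R l2_cnj u" for r u
    by (rule l2_eqI, use rep_scaleR_l2[of r u] rep_cnj_l2[of "r *\<^sub>R u"] rep_cnj_l2[of u]
      rep_scaleR_l2[of r "l2_cnj u"] in eventually_elim) (simp add: scaleR_conv_of_real)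
qed (simp add: norm_l2_cnj)

lemma bounded_linear_star_l2: "bounded_linear l2_star"
proof (rule bounded_linear_intro[where K = 1])
  show "l2_star (u + v) = l2_star u + l2_star v" for u v
  proof (rule l2_eqI)
    have "AE x in lborel. rep_l2 (u + v) (- x) = rep_l2 u (- x) + rep_l2 v (- x)"
      by (rule AE_lborel_uminus[OF _ _ rep_plus_l2]) measurable
    then show "AE x in lborel. rep_l2 (l2_star (u + v)) x = rep_l2 (l2_star u + l2_star v) x"
      using rep_star_l2[of "u + v"] rep_star_l2[of u] rep_star_l2[of v] rep_plus_l2[of "l2_star u" "l2_star v"]
      by eventually_elim simp
  qed
  show "l2_star (r *\<^sub>R u) = r *\<^sub>R l2_star u" for r u
  proof (rule l2_eqI)
    have "AE x in lborel. rep_l2 (r *\<^sub>R u) (- x) = r *\<^sub>R rep_l2 u (- x)"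
      by (rule AE_lborel_uminus[OF _ _ rep_scaleR_l2]) measurable
    then show "AE x in lborel. rep_l2 (l2_star (r *\<^sub>R u)) x = rep_l2 (r *\<^sub>R l2_star u) x"
      using rep_star_l2[of "r *\<^sub>R u"] rep_star_l2[of u] rep_scaleR_l2[of r "l2_star u"]
      by eventually_elim (simp add: scaleR_conv_of_real)
  qed
qed (simp add: norm_l2_star)

lemma l2_cnj_cnj [simp]: "l2_cnj (l2_cnj u) = u"
  by (rule l2_eqI, use rep_cnj_l2[of "l2_cnj u"] rep_cnj_l2[of u] in eventually_elim) simp

lemma inner_l2_cnj: "l2_cnj u \<bullet> l2_cnj v = u \<bullet> v"
  unfolding dot_norm bounded_linear.linear[OF bounded_linear_cnj_l2, THEN linear_add, symmetric] norm_l2_cnj ..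

lemma cnj_cscale: "l2_cnj (l2_cscale c u) = l2_cscale (cnj c) (l2_cnj u)"
  by (rule l2_eqI, use rep_cnj_l2[of "l2_cscale c u"] rep_cnj_l2[of u] rep_cscale_l2[of c u]
      rep_cscale_l2[of "cnj c" "l2_cnj u"] in eventually_elim) simp

text \<open>Reality becomes the fixed-point set of a bounded real-linear map, a form that
  \<open>solves_invariant\<close> can propagate in time.\<close>

lemma real_valued_iff: "real_valued u \<longleftrightarrow> l2_cnj u = u"
proof -
  have "real_valued u \<longleftrightarrow> (AE x in lborel. cnj (rep_l2 u x) = rep_l2 u x)"
    unfolding real_valued_def by (simp add: Reals_cnj_iff)
  also have "\<dots> \<longleftrightarrow> (AE x in lborel. rep_l2 (l2_cnj u) x = rep_l2 u x)"
    by (rule eventually_subst, use rep_cnj_l2[of u] in eventually_elim) simp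
  finally show ?thesis by (simp add: l2_eq_iff)
qed

lemma fourier_cnj: "fourier (l2_cnj u) = l2_star (fourier u)"
proof (rule fourier_eqI)
  let ?f = "\<lambda>n x. cnj (trunc u (real n) x)"
  show "integrable lborel (?f n)" "sq_int (?f n)" for n
    using integrable_trunc by (auto intro: sq_int_cnj sq_int_trunc)
  show "(\<lambda>n. abs_l2 (?f n)) \<longlonglongrightarrow> l2_cnj u"
    using bounded_linear.tendsto[OF bounded_linear_cnj_l2 seq_trunc(1)[of u]]
    by (simp add: cnj_abs_l2 sq_int_trunc)
  show "(\<lambda>n. abs_l2 (ft (?f n))) \<longlonglongrightarrow> l2_star (fourier u)"
    using bounded_linear.tendsto[OF bounded_linear_star_l2 seq_trunc(2)[of u]]
    by (simp add: star_abs_l2 sq_int_ft_trunc ft_cnj[abs_def])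
qed

section \<open>Fourier inversion\<close>

lemma integrable_mult_sq_int:
  assumes "sq_int f" "sq_int g"
  shows "integrable lborel (\<lambda>x. f x * g x)"
proof -
  have [measurable]: "f \<in> borel_measurable borel" "g \<in> borel_measurable borel"
    using assms by (auto simp: sq_int_def)
  have "integrable lborel (\<lambda>x. (cmod (f x))\<^sup>2 + (cmod (g x))\<^sup>2)"
    using assms by (auto simp: sq_int_def)
  then show ?thesis
  proof (rule Bochner_Integration.integrable_bound)
    have "a * b \<le> a\<^sup>2 + b\<^sup>2" if "0 \<le> a" "0 \<le> b" for a b :: real
      using sum_squares_bound[of a b] mult_nonneg_nonneg[OF that] by linarith
    then show "AE x in lborel. norm (f x * g x) \<le> norm ((cmod (f x))\<^sup>2 + (cmod (g x))\<^sup>2)"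
      by (intro AE_I2) (simp add: norm_mult)
  qed measurable
qed

lemma inner_complex_eq_Re: "z \<bullet> w = Re (z * cnj w)"
  by (simp add: inner_complex_def)

text \<open>For truncations this is the multiplication formula with the conjugate of v; continuity
  of both sides extends it to L^2.\<close>

lemma fourier_adjoint: "fourier u \<bullet> v = u \<bullet> l2_cnj (fourier (l2_cnj v))"
proof (rule LIMSEQ_unique)
  let ?u = "\<lambda>n. trunc u (real n)" and ?v = "\<lambda>n. trunc v (real n)"
  show "(\<lambda>n. abs_l2 (ft (?u n)) \<bullet> abs_l2 (?v n)) \<longlonglongrightarrow> fourier u \<bullet> v"
    by (intro tendsto_intros seq_trunc)
  have "abs_l2 (ft (?u n)) \<bullet> abs_l2 (?v n) = abs_l2 (?u n) \<bullet> l2_cnj (fourier (l2_cnj (abs_l2 (?v n))))" for n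
  proof -
    have cv: "integrable lborel (\<lambda>x. cnj (?v n x))" "sq_int (\<lambda>x. cnj (?v n x))"
      using integrable_trunc by (auto intro: sq_int_cnj sq_int_trunc)
    have sq: "sq_int (ft (\<lambda>x. cnj (?v n x)))" by (rule plancherel_L1_le(1)[OF cv])
    have "abs_l2 (ft (?u n)) \<bullet> abs_l2 (?v n) = (\<integral>x. Re (ft (?u n) x * cnj (?v n x)) \<partial>lborel)"
      by (simp add: inner_abs_l2 sq_int_ft_trunc sq_int_trunc inner_complex_eq_Re)
    also have "\<dots> = Re (\<integral>x. ft (?u n) x * cnj (?v n x) \<partial>lborel)"
      by (intro integral_Re integrable_mult_sq_int sq_int_ft_trunc cv)
    also have "\<dots> = Re (\<integral>x. ?u n x * ft (\<lambda>x. cnj (?v n x)) x \<partial>lborel)"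
      by (simp only: ft_multiplication_formula[OF integrable_trunc cv(1)])
    also have "\<dots> = (\<integral>x. Re (?u n x * ft (\<lambda>x. cnj (?v n x)) x) \<partial>lborel)"
      by (intro integral_Re[symmetric] integrable_mult_sq_int sq_int_trunc sq)
    also have "\<dots> = abs_l2 (?u n) \<bullet> abs_l2 (\<lambda>x. cnj (ft (\<lambda>x. cnj (?v n x)) x))"
      by (simp add: inner_abs_l2 sq_int_trunc sq_int_cnj sq inner_complex_eq_Re)
    finally show ?thesis
      by (simp add: cnj_abs_l2 sq_int_trunc fourier_abs_l2[OF cv] sq)
  qed
  then show "(\<lambda>n. abs_l2 (ft (?u n)) \<bullet> abs_l2 (?v n)) \<longlonglongrightarrow> u \<bullet> l2_cnj (fourier (l2_cnj v))"
    by (simp only:) (intro tendsto_intros seq_trunc bounded_linear.tendsto[OF bounded_linear_cnj_l2]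
      bounded_linear.tendsto[OF bounded_linear_fourier])
qed

text \<open>The adjoint divided by 2 pi; the two conjugations replace the kernel cis(-x\<xi>) by
  cis(x\<xi>).\<close>

definition ifourier :: "l2 \<Rightarrow> l2" where
  "ifourier v = (1 / (2 * pi)) *\<^sub>R l2_cnj (fourier (l2_cnj v))"

lemma ifourier_fourier [simp]: "ifourier (fourier u) = u"
proof -
  have "w \<bullet> l2_cnj (fourier (l2_cnj (fourier u))) = w \<bullet> ((2 * pi) *\<^sub>R u)" for w
    using fourier_adjoint[of w "fourier u"] fourier_inner[of w u] by simp
  then have "l2_cnj (fourier (l2_cnj (fourier u))) = (2 * pi) *\<^sub>R u"
    using vector_eq_ldot by blast
  then show ?thesis by (simp add: ifourier_def)
qed

lemma fourier_scaleR: "fourier (r *\<^sub>R u) = r *\<^sub>R fourier u"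
  by (simp add: bounded_linear.linear[OF bounded_linear_fourier, THEN linear_cmul])

lemma fourier_diff: "fourier (u - v) = fourier u - fourier v"
  by (simp add: bounded_linear.linear[OF bounded_linear_fourier, THEN linear_diff])

text \<open>The isometry alone gives only a left inverse. Here the adjoint is itself a transform
  between two conjugations, so \<open>fourier_inner\<close> applies to it as well and shows that the
  transform is onto.\<close>

lemma fourier_ifourier [simp]: "fourier (ifourier v) = v"
proof -
  let ?A = "\<lambda>v. l2_cnj (fourier (l2_cnj v))"
  have "fourier (?A v) \<bullet> w = ((2 * pi) *\<^sub>R v) \<bullet> w" for w
    using fourier_adjoint[of "?A v" w] fourier_inner[of "l2_cnj v" "l2_cnj w"] by (simp add: inner_l2_cnj)
  then have "fourier (?A v) = (2 * pi) *\<^sub>R v"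
    using vector_eq_rdot by blast
  then show ?thesis by (simp add: ifourier_def fourier_scaleR)
qed

lemma fourier_inject: "fourier u = fourier v \<longleftrightarrow> u = v"
  by (metis ifourier_fourier)

lemma norm_ifourier: "norm (ifourier v) = norm v / sqrt (2 * pi)"
  using norm_fourier[of "ifourier v"] by (simp add: field_simps)

text \<open>Gives a pointwise representative of the inverse transform, as required for the pointwise
  products in \<open>l2_mult_gevrey\<close>.\<close>

lemma ifourier_abs_l2:
  assumes "integrable lborel g" "sq_int g"
  shows "ifourier (abs_l2 g) = abs_l2 (\<lambda>x. ft g (- x) / (2 * pi))"
proof -
  have c: "integrable lborel (\<lambda>x. cnj (g x))" "sq_int (\<lambda>x. cnj (g x))"
    using assms by (auto intro: sq_int_cnj)
  have sq: "sq_int (\<lambda>x. ft g (- x))"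
    by (intro sq_int_uminus_arg plancherel_L1_le(1) assms)
  have "l2_cnj (fourier (l2_cnj (abs_l2 g))) = abs_l2 (\<lambda>x. ft g (- x))"
    using sq by (simp add: cnj_abs_l2 assms fourier_abs_l2 c ft_cnj[abs_def] sq_int_cnj)
  then show ?thesis
    by (simp add: ifourier_def scaleR_abs_l2 sq scaleR_conv_of_real)
qed

section \<open>Fourier multipliers\<close>

text \<open>Injectivity of the transform makes any function with the right transform the value of
  the description.\<close>

lemma fourier_multI:
  assumes "AE \<xi> in lborel. rep_l2 (fourier v) \<xi> = m \<xi> * rep_l2 (fourier u) \<xi>"
  shows "fourier_mult m u = v"
  unfolding fourier_mult_def
proof (rule the_equality)
  fix w assume "AE \<xi> in lborel. rep_l2 (fourier w) \<xi> = m \<xi> * rep_l2 (fourier u) \<xi>"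
  then have "AE \<xi> in lborel. rep_l2 (fourier w) \<xi> = rep_l2 (fourier v) \<xi>"
    using assms by eventually_elim simp
  then show "w = v" by (simp add: l2_eq_iff[symmetric] fourier_inject)
qed (rule assms)

text \<open>Surjectivity of the transform supplies the described function once the product is in
  L^2.\<close>

lemma rep_fourier_mult:
  assumes "sq_int (\<lambda>\<xi>. m \<xi> * rep_l2 (fourier u) \<xi>)"
  shows "AE \<xi> in lborel. rep_l2 (fourier (fourier_mult m u)) \<xi> = m \<xi> * rep_l2 (fourier u) \<xi>"
proof -
  let ?v = "ifourier (abs_l2 (\<lambda>\<xi>. m \<xi> * rep_l2 (fourier u) \<xi>))"
  have "AE \<xi> in lborel. rep_l2 (fourier ?v) \<xi> = m \<xi> * rep_l2 (fourier u) \<xi>"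
    using rep_abs_l2[OF assms] by simp
  with fourier_multI[OF this] show ?thesis by simp
qed

text \<open>The factor \<open>a\<close> records the symmetry of the symbol: a = 1 for i\<xi>, whose
  operator commutes with conjugation, and a = -1 for the real odd symbols \<tau> and \<psi>.\<close>

lemma fourier_mult_cnj:
  assumes sq: "sq_int (\<lambda>\<xi>. m \<xi> * rep_l2 (fourier u) \<xi>)" and m [measurable]: "m \<in> borel_measurable borel"
    and "a \<noteq> 0" and a: "\<And>\<xi>. a * m \<xi> = cnj (m (- \<xi>))"
  shows "l2_cscale a (fourier_mult m (l2_cnj u)) = l2_cnj (fourier_mult m u)"
proof -
  have "AE \<xi> in lborel. rep_l2 (fourier (fourier_mult m u)) (- \<xi>) = m (- \<xi>) * rep_l2 (fourier u) (- \<xi>)"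
    by (rule AE_lborel_uminus[OF _ _ rep_fourier_mult[OF sq]]) measurable
  then have ae: "AE \<xi> in lborel. rep_l2 (fourier (l2_cnj (fourier_mult m u))) \<xi> = a * (m \<xi> * rep_l2 (fourier (l2_cnj u)) \<xi>)"
    unfolding fourier_cnj using rep_star_l2[of "fourier (fourier_mult m u)"] rep_star_l2[of "fourier u"]
    by eventually_elim (simp add: a[symmetric] mult.assoc)
  have "fourier_mult m (l2_cnj u) = l2_cscale (inverse a) (l2_cnj (fourier_mult m u))"
    by (rule fourier_multI, unfold fourier_cscale,
      use ae rep_cscale_l2[of "inverse a" "fourier (l2_cnj (fourier_mult m u))"] in eventually_elim)
      (simp add: \<open>a \<noteq> 0\<close>)
  then show ?thesis using \<open>a \<noteq> 0\<close> by (simp add: cscale_cscale cscale_one)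
qed

section \<open>Gevrey spaces\<close>

definition gweight :: "real \<Rightarrow> real \<Rightarrow> real \<Rightarrow> real" where
  "gweight \<sigma> s \<xi> = cosh (\<sigma> * \<bar>\<xi>\<bar>) * jbracket \<xi> powr s"

lemma jbracket_ge_1: "1 \<le> jbracket \<xi>"
  by (simp add: jbracket_def)

lemma jbracket_pos: "0 < jbracket \<xi>"
  using jbracket_ge_1[of \<xi>] by linarith

lemma gweight_pos: "0 < gweight \<sigma> s \<xi>"
  using jbracket_pos[of \<xi>] by (simp add: gweight_def cosh_real_pos)

lemma gweight_ge_1: "0 \<le> s \<Longrightarrow> 1 \<le> gweight \<sigma> s \<xi>"
  unfolding gweight_def using cosh_real_ge_1[of "\<sigma> * \<bar>\<xi>\<bar>"] ge_one_powr_ge_zero[OF jbracket_ge_1[of \<xi>], of s]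
  by (metis mult_mono' mult_1 zero_le_one)

lemma borel_measurable_jbracket [measurable]: "jbracket \<in> borel_measurable borel"
  unfolding jbracket_def[abs_def] by measurable

lemma jbracket_powr: "jbracket \<xi> powr 2 = 1 + \<xi>\<^sup>2" "jbracket \<xi> powr 1 = jbracket \<xi>" "jbracket \<xi> powr 0 = 1"
  using jbracket_pos[of \<xi>] by (simp_all add: jbracket_def)

lemma abs_le_jbracket: "\<bar>\<xi>\<bar> \<le> jbracket \<xi>"
  unfolding jbracket_def by (rule real_le_rsqrt) simp

lemma jbracket_sq: "(jbracket \<xi>)\<^sup>2 = 1 + \<xi>\<^sup>2"
  by (simp add: jbracket_def)

lemma borel_measurable_gweight [measurable]: "gweight \<sigma> s \<in> borel_measurable borel"
  unfolding gweight_def[abs_def] cosh_def by measurable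

lemma gevrey_weighted_eq: "gevrey_weighted \<sigma> s u \<xi> = of_real (gweight \<sigma> s \<xi>) * rep_l2 (fourier u) \<xi>"
  by (simp add: gevrey_weighted_def gweight_def)

lemma borel_measurable_gevrey_weighted [measurable]: "gevrey_weighted \<sigma> s u \<in> borel_measurable borel"
  unfolding gevrey_weighted_eq[abs_def] by measurable

lemma gevrey_iff: "u \<in> gevrey \<sigma> s \<longleftrightarrow> sq_int (gevrey_weighted \<sigma> s u)"
  by (simp add: gevrey_def)

lemma gevrey_norm_eq: "u \<in> gevrey \<sigma> s \<Longrightarrow> gevrey_norm \<sigma> s u = norm (abs_l2 (gevrey_weighted \<sigma> s u))"
  unfolding gevrey_norm_def gevrey_iff by (simp add: norm_abs_l2)

lemma gevrey_norm_nonneg: "0 \<le> gevrey_norm \<sigma> s u"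
  by (simp add: gevrey_norm_def)

lemma sq_int_cong_AE:
  assumes "f \<in> borel_measurable borel" "sq_int g" "AE x in lborel. f x = g x"
  shows "sq_int f" "abs_l2 f = abs_l2 g"
proof -
  show "sq_int f" by (rule sq_int_bound(1)[OF assms(2,1)]) (use assms(3) in \<open>auto elim: eventually_mono\<close>)
  then show "abs_l2 f = abs_l2 g" using assms by (simp add: abs_l2_eq_iff)
qed

lemma gevrey_add:
  assumes "u \<in> gevrey \<sigma> s" "v \<in> gevrey \<sigma> s"
  shows "u + v \<in> gevrey \<sigma> s" "gevrey_norm \<sigma> s (u + v) \<le> gevrey_norm \<sigma> s u + gevrey_norm \<sigma> s v"
proof -
  have ae: "AE \<xi> in lborel. gevrey_weighted \<sigma> s (u + v) \<xi> = gevrey_weighted \<sigma> s u \<xi> + gevrey_weighted \<sigma> s v \<xi>"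
    using rep_plus_l2[of "fourier u" "fourier v"] unfolding fourier_add gevrey_weighted_eq
    by eventually_elim (simp add: distrib_left)
  note * = sq_int_cong_AE[OF borel_measurable_gevrey_weighted sq_int_add ae]
  show uv: "u + v \<in> gevrey \<sigma> s" using * assms by (simp add: gevrey_iff)
  show "gevrey_norm \<sigma> s (u + v) \<le> gevrey_norm \<sigma> s u + gevrey_norm \<sigma> s v"
    using assms * by (simp add: gevrey_norm_eq uv gevrey_iff plus_abs_l2[symmetric] norm_triangle_ineq)
qed

lemma gevrey_cscale:
  assumes "u \<in> gevrey \<sigma> s"
  shows "l2_cscale c u \<in> gevrey \<sigma> s" "gevrey_norm \<sigma> s (l2_cscale c u) = cmod c * gevrey_norm \<sigma> s u"
proof -
  have ae: "AE \<xi> in lborel. gevrey_weighted \<sigma> s (l2_cscale c u) \<xi> = c * gevrey_weighted \<sigma> s u \<xi>"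
    using rep_cscale_l2[of c "fourier u"] unfolding fourier_cscale gevrey_weighted_eq
    by eventually_elim simp
  note * = sq_int_cong_AE[OF borel_measurable_gevrey_weighted sq_int_cmult ae]
  show cu: "l2_cscale c u \<in> gevrey \<sigma> s" using * assms by (simp add: gevrey_iff)
  show "gevrey_norm \<sigma> s (l2_cscale c u) = cmod c * gevrey_norm \<sigma> s u"
    using assms * by (simp add: gevrey_norm_eq cu gevrey_iff cscale_abs_l2[symmetric] norm_l2_cscale)
qed

lemma gevrey_scaleR:
  assumes "u \<in> gevrey \<sigma> s"
  shows "r *\<^sub>R u \<in> gevrey \<sigma> s" "gevrey_norm \<sigma> s (r *\<^sub>R u) = \<bar>r\<bar> * gevrey_norm \<sigma> s u"
  using gevrey_cscale[OF assms, of "of_real r"] by (simp_all add: l2_cscale_of_real)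

lemma gevrey_diff:
  assumes "u \<in> gevrey \<sigma> s" "v \<in> gevrey \<sigma> s"
  shows "u - v \<in> gevrey \<sigma> s" "gevrey_norm \<sigma> s (u - v) \<le> gevrey_norm \<sigma> s u + gevrey_norm \<sigma> s v"
  using gevrey_add[OF assms(1) gevrey_scaleR(1)[OF assms(2), of "-1"]] gevrey_scaleR(2)[OF assms(2), of "-1"] by simp_all

lemma gevrey_boundI:
  assumes "u \<in> gevrey \<sigma> s" "0 \<le> C"
    and "AE \<xi> in lborel. cmod (gevrey_weighted \<sigma>' s' v \<xi>) \<le> C * cmod (gevrey_weighted \<sigma> s u \<xi>)"
  shows "v \<in> gevrey \<sigma>' s'" "gevrey_norm \<sigma>' s' v \<le> C * gevrey_norm \<sigma> s u"
proof -
  have sq: "sq_int (\<lambda>\<xi>. of_real C * gevrey_weighted \<sigma> s u \<xi>)"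
    using assms(1) by (intro sq_int_cmult) (simp add: gevrey_iff)
  have ae: "AE \<xi> in lborel. cmod (gevrey_weighted \<sigma>' s' v \<xi>) \<le> cmod (of_real C * gevrey_weighted \<sigma> s u \<xi>)"
    using assms(3,2) by (simp add: norm_mult)
  note * = sq_int_bound[OF sq borel_measurable_gevrey_weighted ae]
  show v: "v \<in> gevrey \<sigma>' s'" using *(1) by (simp add: gevrey_iff)
  have "abs_l2 (\<lambda>\<xi>. of_real C * gevrey_weighted \<sigma> s u \<xi>) = C *\<^sub>R abs_l2 (gevrey_weighted \<sigma> s u)"
    using assms(1) by (simp add: scaleR_abs_l2 gevrey_iff scaleR_conv_of_real)
  then show "gevrey_norm \<sigma>' s' v \<le> C * gevrey_norm \<sigma> s u"
    using *(2) assms(2) by (simp add: gevrey_norm_eq v assms(1))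
qed

lemma gweight_mono: "s \<le> s' \<Longrightarrow> gweight \<sigma> s \<xi> \<le> gweight \<sigma> s' \<xi>"
  unfolding gweight_def using jbracket_ge_1[of \<xi>] by (intro mult_left_mono powr_mono) auto

lemma gevrey_mono:
  assumes "u \<in> gevrey \<sigma> s" "s' \<le> s"
  shows "u \<in> gevrey \<sigma> s'" "gevrey_norm \<sigma> s' u \<le> gevrey_norm \<sigma> s u"
proof -
  have "AE \<xi> in lborel. cmod (gevrey_weighted \<sigma> s' u \<xi>) \<le> 1 * cmod (gevrey_weighted \<sigma> s u \<xi>)"
    unfolding gevrey_weighted_eq norm_mult norm_of_real
    using gweight_mono[OF assms(2)] gweight_pos[of \<sigma> s'] gweight_pos[of \<sigma> s]
    by (intro AE_I2) (auto intro!: mult_right_mono simp: less_imp_le)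
  from gevrey_boundI[OF assms(1) _ this] show "u \<in> gevrey \<sigma> s'" "gevrey_norm \<sigma> s' u \<le> gevrey_norm \<sigma> s u" by simp_all
qed

text \<open>The hyperbolic weight is common to both sides, so a symbol estimate in powers of
  \<open>jbracket\<close> suffices, uniformly in \<sigma>. With s >= 0 the weight is at least 1,
  which gives the unweighted square-integrability on which \<open>fourier_mult\<close>
  depends.\<close>

lemma sq_int_mult_gevrey:
  assumes u: "u \<in> gevrey \<sigma> s'" and m [measurable]: "m \<in> borel_measurable borel"
    and "0 \<le> s" and le: "\<And>\<xi>. cmod (m \<xi>) * jbracket \<xi> powr s \<le> C * jbracket \<xi> powr s'"
  shows "sq_int (\<lambda>\<xi>. m \<xi> * rep_l2 (fourier u) \<xi>)"
    and "cmod (of_real (gweight \<sigma> s \<xi>) * (m \<xi> * rep_l2 (fourier u) \<xi>)) \<le> C * cmod (gevrey_weighted \<sigma> s' u \<xi>)"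
proof -
  show *: "cmod (of_real (gweight \<sigma> s \<xi>) * (m \<xi> * rep_l2 (fourier u) \<xi>)) \<le> C * cmod (gevrey_weighted \<sigma> s' u \<xi>)" for \<xi>
  proof -
    have "cmod (of_real (gweight \<sigma> s \<xi>) * (m \<xi> * rep_l2 (fourier u) \<xi>)) =
        cosh (\<sigma> * \<bar>\<xi>\<bar>) * cmod (rep_l2 (fourier u) \<xi>) * (cmod (m \<xi>) * jbracket \<xi> powr s)"
      unfolding gweight_def by (simp add: norm_mult abs_mult)
    also have "\<dots> \<le> cosh (\<sigma> * \<bar>\<xi>\<bar>) * cmod (rep_l2 (fourier u) \<xi>) * (C * jbracket \<xi> powr s')"
      by (intro mult_left_mono le) (simp add: less_imp_le)
    also have "\<dots> = C * cmod (gevrey_weighted \<sigma> s' u \<xi>)"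
      unfolding gevrey_weighted_eq gweight_def by (simp add: norm_mult abs_mult)
    finally show ?thesis .
  qed
  have sq: "sq_int (\<lambda>\<xi>. of_real C * gevrey_weighted \<sigma> s' u \<xi>)"
    using u by (intro sq_int_cmult) (simp add: gevrey_iff)
  show "sq_int (\<lambda>\<xi>. m \<xi> * rep_l2 (fourier u) \<xi>)"
  proof (rule sq_int_bound(1)[OF sq], measurable, intro AE_I2)
    fix \<xi>
    have "1 * cmod (m \<xi> * rep_l2 (fourier u) \<xi>) \<le> gweight \<sigma> s \<xi> * cmod (m \<xi> * rep_l2 (fourier u) \<xi>)"
      by (intro mult_right_mono gweight_ge_1 \<open>0 \<le> s\<close>) simp
    also have "\<dots> \<le> C * cmod (gevrey_weighted \<sigma> s' u \<xi>)"
      using *[of \<xi>] gweight_pos[of \<sigma> s \<xi>] by (simp add: norm_mult)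
    also have "\<dots> \<le> cmod (of_real C * gevrey_weighted \<sigma> s' u \<xi>)"
      by (auto simp: norm_mult intro!: mult_right_mono)
    finally show "cmod (m \<xi> * rep_l2 (fourier u) \<xi>) \<le> cmod (of_real C * gevrey_weighted \<sigma> s' u \<xi>)" by simp
  qed
qed

lemma fourier_mult_gevrey:
  assumes u: "u \<in> gevrey \<sigma> s'" and m: "m \<in> borel_measurable borel"
    and "0 \<le> s" and le: "\<And>\<xi>. cmod (m \<xi>) * jbracket \<xi> powr s \<le> C * jbracket \<xi> powr s'"
  shows "fourier_mult m u \<in> gevrey \<sigma> s" "gevrey_norm \<sigma> s (fourier_mult m u) \<le> C * gevrey_norm \<sigma> s' u"
proof -
  note * = sq_int_mult_gevrey[OF u m \<open>0 \<le> s\<close> le]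
  \<comment> \<open>Nonnegativity of C is read off from the symbol estimate at \<xi> = 0, where
    \<open>jbracket\<close> is 1.\<close>
  have "0 < C * jbracket 0 powr s' \<or> C * jbracket 0 powr s' = 0"
    using le[of 0] by (smt (verit) norm_ge_zero powr_ge_zero mult_nonneg_nonneg)
  then have C: "0 \<le> C" by (auto simp: jbracket_def)
  have "AE \<xi> in lborel. cmod (gevrey_weighted \<sigma> s (fourier_mult m u) \<xi>) \<le> C * cmod (gevrey_weighted \<sigma> s' u \<xi>)"
    using rep_fourier_mult[OF *(1)] unfolding gevrey_weighted_eq[of \<sigma> s]
    by eventually_elim (use *(2) in simp)
  from gevrey_boundI[OF u C this] show "fourier_mult m u \<in> gevrey \<sigma> s"
    "gevrey_norm \<sigma> s (fourier_mult m u) \<le> C * gevrey_norm \<sigma> s' u" by auto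
qed

lemma fourier_mult_zero: "fourier_mult m 0 = 0"
  by (rule fourier_multI) (use rep_zero_l2 in \<open>auto simp: fourier_zero elim: eventually_mono\<close>)

lemma fourier_mult_diff:
  assumes "sq_int (\<lambda>\<xi>. m \<xi> * rep_l2 (fourier u) \<xi>)" "sq_int (\<lambda>\<xi>. m \<xi> * rep_l2 (fourier v) \<xi>)"
  shows "fourier_mult m (u - v) = fourier_mult m u - fourier_mult m v"
  by (rule fourier_multI, unfold fourier_diff,
      use rep_fourier_mult[OF assms(1)] rep_fourier_mult[OF assms(2)] rep_minus_l2[of "fourier u" "fourier v"]
        rep_minus_l2[of "fourier (fourier_mult m u)" "fourier (fourier_mult m v)"] in eventually_elim)
    (simp add: right_diff_distrib)

section \<open>Convolution and products\<close>

definition conv :: "(real \<Rightarrow> complex) \<Rightarrow> (real \<Rightarrow> complex) \<Rightarrow> real \<Rightarrow> complex" where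
  "conv f g \<xi> = (\<integral>y. f (\<xi> - y) * g y \<partial>lborel)"

lemma borel_measurable_conv [measurable (raw)]:
  assumes [measurable]: "f \<in> borel_measurable borel" "g \<in> borel_measurable borel"
  shows "conv f g \<in> borel_measurable borel"
  unfolding conv_def[abs_def] by measurable

text \<open>The oscillating factor lets one integrability statement serve twice: t = 0 for the
  convolution itself, general t for its transform.\<close>

lemma conv_kernel_integrable:
  assumes f: "integrable lborel f" and g: "integrable lborel g"
  shows "integrable (lborel \<Otimes>\<^sub>M lborel) (\<lambda>(y, \<xi>). cis (- (\<xi> * t)) * (f (\<xi> - y) * g y))"
proof (rule lborel_pair.Fubini_integrable)
  have [measurable]: "f \<in> borel_measurable borel" "g \<in> borel_measurable borel" using f g by auto
  show "(\<lambda>(y, \<xi>). cis (- (\<xi> * t)) * (f (\<xi> - y) * g y)) \<in> borel_measurable (lborel \<Otimes>\<^sub>M lborel)"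
    by measurable
  have "(\<lambda>y. \<integral>\<xi>. norm (case (y, \<xi>) of (y, \<xi>) \<Rightarrow> cis (- (\<xi> * t)) * (f (\<xi> - y) * g y)) \<partial>lborel) =
      (\<lambda>y. (\<integral>\<xi>. cmod (f \<xi>) \<partial>lborel) * cmod (g y))"
    using integral_translate[of "\<lambda>x. cmod (f x)"] by (simp add: norm_mult)
  then show "integrable lborel (\<lambda>y. \<integral>\<xi>. norm (case (y, \<xi>) of (y, \<xi>) \<Rightarrow> cis (- (\<xi> * t)) * (f (\<xi> - y) * g y)) \<partial>lborel)"
    using g by simp
  have "integrable lborel (\<lambda>\<xi>. cis (- (\<xi> * t)) * (f (\<xi> - y) * g y))" for y
    using integrable_ft[of "\<lambda>\<xi>. f (\<xi> - y) * g y" t] integrable_translate[OF f, of y] by simp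
  then show "AE y in lborel. integrable lborel (\<lambda>\<xi>. case (y, \<xi>) of (y, \<xi>) \<Rightarrow> cis (- (\<xi> * t)) * (f (\<xi> - y) * g y))"
    by simp
qed

lemma integrable_conv:
  assumes f: "integrable lborel f" and g: "integrable lborel g"
  shows "integrable lborel (conv f g)"
  using lborel_pair.integrable_snd[OF conv_kernel_integrable[OF f g, of 0]] by (simp add: conv_def[abs_def])

lemma ft_conv:
  assumes f: "integrable lborel f" and g: "integrable lborel g"
  shows "ft (conv f g) t = ft f t * ft g t"
proof -
  have "ft (conv f g) t = (\<integral>\<xi>. (\<integral>y. cis (- (\<xi> * t)) * (f (\<xi> - y) * g y) \<partial>lborel) \<partial>lborel)"
    unfolding ft_def conv_def by simp
  also have "\<dots> = (\<integral>y. (\<integral>\<xi>. cis (- (\<xi> * t)) * (f (\<xi> - y) * g y) \<partial>lborel) \<partial>lborel)"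
    by (rule lborel_pair.Fubini_integral[OF conv_kernel_integrable[OF f g]])
  also have "\<dots> = (\<integral>y. ft f t * (cis (- (y * t)) * g y) \<partial>lborel)"
  proof (rule Bochner_Integration.integral_cong[OF refl])
    fix y
    have "cis (- (\<xi> * t)) * (f (\<xi> - y) * g y) = (cis (- (y * t)) * g y) * (cis (- ((\<xi> - y) * t)) * f (\<xi> - y))" for \<xi>
    proof -
      have "cis (- (\<xi> * t)) = cis (- (y * t)) * cis (- ((\<xi> - y) * t))"
        by (simp add: cis_mult algebra_simps)
      then show ?thesis by (simp only: ac_simps)
    qed
    then have "(\<integral>\<xi>. cis (- (\<xi> * t)) * (f (\<xi> - y) * g y) \<partial>lborel) =
        (cis (- (y * t)) * g y) * (\<integral>\<xi>. cis (- ((\<xi> - y) * t)) * f (\<xi> - y) \<partial>lborel)"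
      by (simp only: integral_mult_right_zero)
    also have "\<dots> = ft f t * (cis (- (y * t)) * g y)"
      using integral_translate[of "\<lambda>\<xi>. cis (- (\<xi> * t)) * f \<xi>" y] by (simp add: ft_def)
    finally show "(\<integral>\<xi>. cis (- (\<xi> * t)) * (f (\<xi> - y) * g y) \<partial>lborel) = ft f t * (cis (- (y * t)) * g y)" .
  qed
  also have "\<dots> = ft f t * ft g t" unfolding ft_def[of g] by simp
  finally show ?thesis .
qed

lemma nn_integral_reflect_translate:
  fixes f :: "real \<Rightarrow> ennreal"
  assumes "f \<in> borel_measurable borel"
  shows "(\<integral>\<^sup>+y. f (\<xi> - y) \<partial>lborel) = (\<integral>\<^sup>+y. f y \<partial>lborel)" "(\<integral>\<^sup>+y. f (y - \<xi>) \<partial>lborel) = (\<integral>\<^sup>+y. f y \<partial>lborel)"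
  using nn_integral_real_affine[OF assms, of "-1" \<xi>] nn_integral_real_affine[OF assms, of 1 "- \<xi>"] by simp_all

text \<open>Cauchy-Schwarz for the measure F(\<xi> - y) dy, that is, for the product of sqrt F and
  sqrt F G, followed by Tonelli.\<close>

lemma young_L1_L2:
  fixes F G :: "real \<Rightarrow> real"
  assumes [measurable]: "F \<in> borel_measurable borel" "G \<in> borel_measurable borel"
    and F: "\<And>x. 0 \<le> F x" and G: "\<And>x. 0 \<le> G x"
  shows "(\<integral>\<^sup>+\<xi>. (\<integral>\<^sup>+y. ennreal (F (\<xi> - y)) * ennreal (G y) \<partial>lborel)\<^sup>2 \<partial>lborel) \<le>
    (\<integral>\<^sup>+x. ennreal (F x) \<partial>lborel)\<^sup>2 * (\<integral>\<^sup>+x. (ennreal (G x))\<^sup>2 \<partial>lborel)"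
proof -
  let ?I = "\<integral>\<^sup>+x. ennreal (F x) \<partial>lborel"
  have sq: "ennreal (sqrt (F x)) * ennreal (sqrt (F x)) = ennreal (F x)" for x
    using F[of x] by (simp add: ennreal_mult[symmetric])
  have "(\<integral>\<^sup>+y. ennreal (F (\<xi> - y)) * ennreal (G y) \<partial>lborel)\<^sup>2 \<le> ?I * (\<integral>\<^sup>+y. ennreal (F (\<xi> - y)) * (ennreal (G y))\<^sup>2 \<partial>lborel)" for \<xi>
  proof -
    have "(\<integral>\<^sup>+y. ennreal (sqrt (F (\<xi> - y))) * (ennreal (sqrt (F (\<xi> - y))) * ennreal (G y)) \<partial>lborel)\<^sup>2 \<le>
        (\<integral>\<^sup>+y. (ennreal (sqrt (F (\<xi> - y))))\<^sup>2 \<partial>lborel) * (\<integral>\<^sup>+y. (ennreal (sqrt (F (\<xi> - y))) * ennreal (G y))\<^sup>2 \<partial>lborel)"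
      by (rule Cauchy_Schwarz_nn_integral) measurable
    then show ?thesis
      unfolding power_mult_distrib mult.assoc[symmetric] sq power2_eq_square[of "ennreal (sqrt _)"]
      using nn_integral_reflect_translate(1)[of "\<lambda>x. ennreal (F x)" \<xi>] by simp
  qed
  then have "(\<integral>\<^sup>+\<xi>. (\<integral>\<^sup>+y. ennreal (F (\<xi> - y)) * ennreal (G y) \<partial>lborel)\<^sup>2 \<partial>lborel) \<le>
      (\<integral>\<^sup>+\<xi>. ?I * (\<integral>\<^sup>+y. ennreal (F (\<xi> - y)) * (ennreal (G y))\<^sup>2 \<partial>lborel) \<partial>lborel)"
    by (intro nn_integral_mono)
  also have "\<dots> = ?I * (\<integral>\<^sup>+\<xi>. (\<integral>\<^sup>+y. ennreal (F (\<xi> - y)) * (ennreal (G y))\<^sup>2 \<partial>lborel) \<partial>lborel)"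
    by (rule nn_integral_cmult) measurable
  also have "(\<integral>\<^sup>+\<xi>. (\<integral>\<^sup>+y. ennreal (F (\<xi> - y)) * (ennreal (G y))\<^sup>2 \<partial>lborel) \<partial>lborel) =
      (\<integral>\<^sup>+y. (\<integral>\<^sup>+\<xi>. ennreal (F (\<xi> - y)) * (ennreal (G y))\<^sup>2 \<partial>lborel) \<partial>lborel)"
    by (rule lborel_pair.Fubini') measurable
  also have "\<dots> = (\<integral>\<^sup>+y. ?I * (ennreal (G y))\<^sup>2 \<partial>lborel)"
    using nn_integral_reflect_translate(2)[of "\<lambda>x. ennreal (F x)"] by (simp add: nn_integral_multc)
  also have "\<dots> = ?I * (\<integral>\<^sup>+x. (ennreal (G x))\<^sup>2 \<partial>lborel)"
    by (rule nn_integral_cmult) measurable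
  finally show ?thesis by (simp add: power2_eq_square mult.assoc)
qed

definition inv_jbracket :: "real \<Rightarrow> complex" where
  "inv_jbracket x = of_real (1 / jbracket x)"

lemma sq_int_inv_jbracket: "sq_int inv_jbracket"
proof -
  have "(cmod (inv_jbracket x))\<^sup>2 = inverse (1 + x\<^sup>2)" for x
    using jbracket_pos[of x] by (simp add: inv_jbracket_def norm_divide power_divide jbracket_def divide_simps)
  moreover have "integrable lborel (\<lambda>x::real. inverse (1 + x\<^sup>2))"
    using integrable_inverse_1_plus_square by (simp add: set_integrable_def)
  ultimately show ?thesis unfolding sq_int_def inv_jbracket_def[abs_def] by simp
qed

text \<open>Equals sqrt pi. It is the constant in the Cauchy-Schwarz embedding of
  \<open>jbracket\<close>-weighted L^2 into L^1.\<close>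

definition inv_jbracket_norm :: real where
  "inv_jbracket_norm = norm (abs_l2 inv_jbracket)"

text \<open>For a non-integrable function the Bochner integral is 0 and the inequality is trivial;
  hence \<open>conv\<close> can be estimated before its integrand is known to be integrable.\<close>

lemma ennreal_norm_integral_le: "ennreal (norm (integral\<^sup>L M f)) \<le> (\<integral>\<^sup>+x. ennreal (norm (f x)) \<partial>M)"
  for f :: "_ \<Rightarrow> complex"
  using integral_norm_bound_ennreal[of M f] by (cases "integrable M f") (auto simp: not_integrable_integral_eq)

text \<open>Submultiplicativity moves p(\<xi>) onto p(\<xi> - y) p(y), after which Young's
  inequality applies to F = p |f| and G = p |g|. The first factor spends its \<open>jbracket\<close>
  on integrability; in the second it is discarded as being at least 1.\<close>

lemma conv_weighted:
  assumes [measurable]: "f \<in> borel_measurable borel" "g \<in> borel_measurable borel" "p \<in> borel_measurable borel"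
    and p: "\<And>x. 0 \<le> p x" and K: "0 \<le> K" "\<And>x y. p (x + y) \<le> K * (p x * p y)"
    and f: "sq_int (\<lambda>x. of_real (p x * jbracket x) * f x)" and g: "sq_int (\<lambda>x. of_real (p x * jbracket x) * g x)"
  shows "sq_int (\<lambda>\<xi>. of_real (p \<xi>) * conv f g \<xi>)"
    and "norm (abs_l2 (\<lambda>\<xi>. of_real (p \<xi>) * conv f g \<xi>)) \<le> K * inv_jbracket_norm *
      norm (abs_l2 (\<lambda>x. of_real (p x * jbracket x) * f x)) * norm (abs_l2 (\<lambda>x. of_real (p x * jbracket x) * g x))"
proof -
  note [measurable] = sq_int_measurable[OF sq_int_inv_jbracket]
  let ?a = "norm (abs_l2 (\<lambda>x. of_real (p x * jbracket x) * f x))"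
    and ?b = "norm (abs_l2 (\<lambda>x. of_real (p x * jbracket x) * g x))"
  define F where "F x = p x * cmod (f x)" for x
  define G where "G x = p x * cmod (g x)" for x
  have [measurable]: "F \<in> borel_measurable borel" "G \<in> borel_measurable borel"
    unfolding F_def[abs_def] G_def[abs_def] by measurable
  have FG: "0 \<le> F x" "0 \<le> G x" for x using p by (simp_all add: F_def G_def)
  have "(\<integral>\<^sup>+x. ennreal (F x) \<partial>lborel)\<^sup>2 =
      (\<integral>\<^sup>+x. ennreal (cmod (inv_jbracket x)) * ennreal (cmod (of_real (p x * jbracket x) * f x)) \<partial>lborel)\<^sup>2"
    using jbracket_pos p
    by (simp add: inv_jbracket_def F_def norm_mult norm_divide ennreal_mult[symmetric] less_imp_le less_imp_neq[symmetric])
  also have "\<dots> \<le> (\<integral>\<^sup>+x. (ennreal (cmod (inv_jbracket x)))\<^sup>2 \<partial>lborel) *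
      (\<integral>\<^sup>+x. (ennreal (cmod (of_real (p x * jbracket x) * f x)))\<^sup>2 \<partial>lborel)"
    by (rule Cauchy_Schwarz_nn_integral; measurable)
  also have "\<dots> = ennreal (inv_jbracket_norm\<^sup>2) * ennreal (?a\<^sup>2)"
    by (simp only: ennreal_power norm_ge_zero nn_norm_abs_l2[OF f] nn_norm_abs_l2[OF sq_int_inv_jbracket] inv_jbracket_norm_def)
  finally have A: "(\<integral>\<^sup>+x. ennreal (F x) \<partial>lborel)\<^sup>2 \<le> ennreal (inv_jbracket_norm\<^sup>2) * ennreal (?a\<^sup>2)" .
  have "(\<integral>\<^sup>+x. (ennreal (G x))\<^sup>2 \<partial>lborel) \<le> (\<integral>\<^sup>+x. ennreal ((cmod (of_real (p x * jbracket x) * g x))\<^sup>2) \<partial>lborel)"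
  proof (rule nn_integral_mono)
    fix x
    have "G x * 1 \<le> G x * jbracket x" by (intro mult_left_mono jbracket_ge_1 FG)
    also have "\<dots> = cmod (of_real (p x * jbracket x) * g x)"
      using p[of x] jbracket_pos[of x] by (simp add: G_def norm_mult)
    finally show "(ennreal (G x))\<^sup>2 \<le> ennreal ((cmod (of_real (p x * jbracket x) * g x))\<^sup>2)"
      by (simp add: ennreal_power FG ennreal_leI power_mono)
  qed
  then have B: "(\<integral>\<^sup>+x. (ennreal (G x))\<^sup>2 \<partial>lborel) \<le> ennreal (?b\<^sup>2)"
    unfolding nn_norm_abs_l2[OF g] .
  have "ennreal (cmod (of_real (p \<xi>) * conv f g \<xi>)) \<le> ennreal K * (\<integral>\<^sup>+y. ennreal (F (\<xi> - y)) * ennreal (G y) \<partial>lborel)" for \<xi>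
  proof -
    have "of_real (p \<xi>) * conv f g \<xi> = (\<integral>y. of_real (p \<xi>) * (f (\<xi> - y) * g y) \<partial>lborel)"
      unfolding conv_def by simp
    then have "ennreal (cmod (of_real (p \<xi>) * conv f g \<xi>)) \<le> (\<integral>\<^sup>+y. ennreal (cmod (of_real (p \<xi>) * (f (\<xi> - y) * g y))) \<partial>lborel)"
      by (simp only: ennreal_norm_integral_le)
    also have "\<dots> \<le> (\<integral>\<^sup>+y. ennreal K * (ennreal (F (\<xi> - y)) * ennreal (G y)) \<partial>lborel)"
    proof (rule nn_integral_mono)
      fix y
      have "cmod (of_real (p \<xi>) * (f (\<xi> - y) * g y)) = p ((\<xi> - y) + y) * (cmod (f (\<xi> - y)) * cmod (g y))"
        using p[of \<xi>] by (simp add: norm_mult)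
      also have "\<dots> \<le> K * (p (\<xi> - y) * p y) * (cmod (f (\<xi> - y)) * cmod (g y))"
        by (intro mult_right_mono K(2)) simp
      also have "\<dots> = K * (F (\<xi> - y) * G y)" by (simp add: F_def G_def)
      finally show "ennreal (cmod (of_real (p \<xi>) * (f (\<xi> - y) * g y))) \<le> ennreal K * (ennreal (F (\<xi> - y)) * ennreal (G y))"
        using K(1) FG by (simp add: ennreal_mult[symmetric] ennreal_leI)
    qed
    also have "\<dots> = ennreal K * (\<integral>\<^sup>+y. ennreal (F (\<xi> - y)) * ennreal (G y) \<partial>lborel)"
      by (rule nn_integral_cmult) measurable
    finally show ?thesis .
  qed
  then have "(ennreal (cmod (of_real (p \<xi>) * conv f g \<xi>)))\<^sup>2 \<le> (ennreal K * (\<integral>\<^sup>+y. ennreal (F (\<xi> - y)) * ennreal (G y) \<partial>lborel))\<^sup>2" for \<xi>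
    by (intro power_mono) auto
  then have "(\<integral>\<^sup>+\<xi>. ennreal ((cmod (of_real (p \<xi>) * conv f g \<xi>))\<^sup>2) \<partial>lborel) \<le>
      (\<integral>\<^sup>+\<xi>. (ennreal K)\<^sup>2 * (\<integral>\<^sup>+y. ennreal (F (\<xi> - y)) * ennreal (G y) \<partial>lborel)\<^sup>2 \<partial>lborel)"
    by (intro nn_integral_mono) (simp only: ennreal_power norm_ge_zero power_mult_distrib)
  also have "\<dots> = (ennreal K)\<^sup>2 * (\<integral>\<^sup>+\<xi>. (\<integral>\<^sup>+y. ennreal (F (\<xi> - y)) * ennreal (G y) \<partial>lborel)\<^sup>2 \<partial>lborel)"
    by (rule nn_integral_cmult) measurable
  also have "\<dots> \<le> (ennreal K)\<^sup>2 * ((\<integral>\<^sup>+x. ennreal (F x) \<partial>lborel)\<^sup>2 * (\<integral>\<^sup>+x. (ennreal (G x))\<^sup>2 \<partial>lborel))"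
    by (intro mult_left_mono young_L1_L2 FG) auto
  also have "\<dots> \<le> (ennreal K)\<^sup>2 * ((ennreal (inv_jbracket_norm\<^sup>2) * ennreal (?a\<^sup>2)) * ennreal (?b\<^sup>2))"
    by (intro mult_left_mono mult_mono A B) auto
  also have "\<dots> = ennreal ((K * inv_jbracket_norm * ?a * ?b)\<^sup>2)"
    using K(1) by (simp add: ennreal_power ennreal_mult[symmetric] power_mult_distrib mult.assoc)
  finally have le: "(\<integral>\<^sup>+\<xi>. ennreal ((cmod (of_real (p \<xi>) * conv f g \<xi>))\<^sup>2) \<partial>lborel) \<le> ennreal ((K * inv_jbracket_norm * ?a * ?b)\<^sup>2)" .
  show "sq_int (\<lambda>\<xi>. of_real (p \<xi>) * conv f g \<xi>)"
    by (rule sq_int_nnI[OF _ le]) measurable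
  show "norm (abs_l2 (\<lambda>\<xi>. of_real (p \<xi>) * conv f g \<xi>)) \<le> K * inv_jbracket_norm * ?a * ?b"
    by (rule norm_abs_l2_le_nn[OF _ le]) (use K(1) in \<open>simp_all add: inv_jbracket_norm_def\<close>)
qed

lemma gweight_submult:
  assumes "0 \<le> s"
  shows "gweight \<sigma> s (x + y) \<le> (2 * sqrt 2 powr s) * (gweight \<sigma> s x * gweight \<sigma> s y)"
proof -
  have abs_cosh: "cosh (\<sigma> * \<bar>z\<bar>) = cosh (\<sigma> * z)" for z :: real
    by (cases "0 \<le> z") (auto simp: cosh_minus)
  \<comment> \<open>In the addition formula cosh(a + b) = cosh a cosh b + sinh a sinh b the second
    term is at most the first, whence the factor 2.\<close>
  have sinh_le: "sinh (\<sigma> * x) * sinh (\<sigma> * y) \<le> cosh (\<sigma> * x) * cosh (\<sigma> * y)"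
  proof -
    have "\<bar>sinh z\<bar> \<le> cosh z" for z :: real
    proof -
      have "(sinh z)\<^sup>2 \<le> (cosh z)\<^sup>2" using cosh_square_eq[of z] by linarith
      then have "\<bar>sinh z\<bar> \<le> \<bar>cosh z\<bar>" by (simp only: abs_le_square_iff)
      then show ?thesis by (simp only: abs_of_nonneg[OF cosh_real_nonneg])
    qed
    from mult_mono[OF this[of "\<sigma> * x"] this[of "\<sigma> * y"]]
    have "\<bar>sinh (\<sigma> * x) * sinh (\<sigma> * y)\<bar> \<le> cosh (\<sigma> * x) * cosh (\<sigma> * y)"
      by (simp add: abs_mult cosh_real_nonneg)
    then show ?thesis by linarith
  qed
  have 1: "cosh (\<sigma> * (x + y)) \<le> 2 * (cosh (\<sigma> * x) * cosh (\<sigma> * y))"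
    using sinh_le by (simp add: distrib_left cosh_add)
  have 2: "jbracket (x + y) \<le> sqrt 2 * (jbracket x * jbracket y)"
  proof -
    \<comment> \<open>This is the difference of the two sides of the squared inequality.\<close>
    have "0 \<le> (x - y)\<^sup>2 + 1 + 2 * (x * y)\<^sup>2" by simp
    then have "1 + (x + y)\<^sup>2 \<le> 2 * ((1 + x\<^sup>2) * (1 + y\<^sup>2))"
      by (simp add: power2_eq_square algebra_simps)
    then show ?thesis unfolding jbracket_def real_sqrt_mult[symmetric] by simp
  qed
  have "jbracket (x + y) powr s \<le> (sqrt 2 * (jbracket x * jbracket y)) powr s"
    using 2 jbracket_pos[of "x + y"] assms by (intro powr_mono2) auto
  also have "\<dots> = sqrt 2 powr s * (jbracket x powr s * jbracket y powr s)"
    using jbracket_pos[of x] jbracket_pos[of y] by (simp add: powr_mult)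
  finally have "cosh (\<sigma> * (x + y)) * jbracket (x + y) powr s \<le>
      (2 * (cosh (\<sigma> * x) * cosh (\<sigma> * y))) * (sqrt 2 powr s * (jbracket x powr s * jbracket y powr s))"
    using 1 by (intro mult_mono) (auto simp: cosh_real_nonneg)
  then show ?thesis unfolding gweight_def abs_cosh by (simp add: ac_simps)
qed

lemma gweight_Suc: "gweight \<sigma> (s + 1) \<xi> = gweight \<sigma> s \<xi> * jbracket \<xi>"
  using jbracket_pos[of \<xi>] by (simp add: gweight_def powr_add)

section \<open>Pointwise products of Gevrey functions\<close>

lemma integrable_fourier_gevrey:
  assumes "u \<in> gevrey \<sigma> 1"
  shows "integrable lborel (rep_l2 (fourier u))"
proof -
  have "sq_int (\<lambda>\<xi>. of_real (jbracket \<xi>) * rep_l2 (fourier u) \<xi>)"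
    using assms jbracket_pos by (rule_tac sq_int_mult_gevrey(1)[where s' = 1 and s = 0 and C = 1])
      (auto simp: less_imp_le)
  from integrable_mult_sq_int[OF sq_int_inv_jbracket this] show ?thesis
    using jbracket_pos by (simp add: inv_jbracket_def less_imp_neq[symmetric])
qed

lemma conv_fourier_gevrey:
  assumes u: "u \<in> gevrey \<sigma> (s + 1)" and v: "v \<in> gevrey \<sigma> (s + 1)" and s: "0 \<le> s"
  shows "sq_int (\<lambda>\<xi>. of_real (gweight \<sigma> s \<xi>) * conv (rep_l2 (fourier u)) (rep_l2 (fourier v)) \<xi>)"
    and "norm (abs_l2 (\<lambda>\<xi>. of_real (gweight \<sigma> s \<xi>) * conv (rep_l2 (fourier u)) (rep_l2 (fourier v)) \<xi>)) \<le>
      (2 * sqrt 2 powr s) * inv_jbracket_norm * gevrey_norm \<sigma> (s + 1) u * gevrey_norm \<sigma> (s + 1) v"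
proof -
  have eq: "(\<lambda>\<xi>. of_real (gweight \<sigma> s \<xi> * jbracket \<xi>) * rep_l2 (fourier w) \<xi>) = gevrey_weighted \<sigma> (s + 1) w" for w
    by (simp add: gevrey_weighted_eq[abs_def] gweight_Suc)
  have sq: "sq_int (\<lambda>\<xi>. of_real (gweight \<sigma> s \<xi> * jbracket \<xi>) * rep_l2 (fourier w) \<xi>)" if "w \<in> gevrey \<sigma> (s + 1)" for w
    using that by (simp only: eq gevrey_iff)
  show "sq_int (\<lambda>\<xi>. of_real (gweight \<sigma> s \<xi>) * conv (rep_l2 (fourier u)) (rep_l2 (fourier v)) \<xi>)"
    by (rule conv_weighted(1)[OF _ _ _ _ _ gweight_submult[OF s] sq[OF u] sq[OF v]])
      (simp_all add: less_imp_le[OF gweight_pos])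
  have "norm (abs_l2 (\<lambda>\<xi>. of_real (gweight \<sigma> s \<xi>) * conv (rep_l2 (fourier u)) (rep_l2 (fourier v)) \<xi>)) \<le>
      (2 * sqrt 2 powr s) * inv_jbracket_norm * norm (abs_l2 (\<lambda>\<xi>. of_real (gweight \<sigma> s \<xi> * jbracket \<xi>) * rep_l2 (fourier u) \<xi>))
        * norm (abs_l2 (\<lambda>\<xi>. of_real (gweight \<sigma> s \<xi> * jbracket \<xi>) * rep_l2 (fourier v) \<xi>))"
    by (rule conv_weighted(2)[OF _ _ _ _ _ gweight_submult[OF s] sq[OF u] sq[OF v]])
      (simp_all add: less_imp_le[OF gweight_pos])
  then show "norm (abs_l2 (\<lambda>\<xi>. of_real (gweight \<sigma> s \<xi>) * conv (rep_l2 (fourier u)) (rep_l2 (fourier v)) \<xi>)) \<le>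
      (2 * sqrt 2 powr s) * inv_jbracket_norm * gevrey_norm \<sigma> (s + 1) u * gevrey_norm \<sigma> (s + 1) v"
    by (simp only: eq gevrey_norm_eq u v)
qed

text \<open>Both factors have integrable transforms, hence are given almost everywhere by the
  inversion integral; \<open>ft_conv\<close> turns their product into the inversion integral of the
  convolution, which lies in L^2. So \<open>l2_mult\<close> takes its genuine branch and not the
  default 0.\<close>

lemma l2_mult_gevrey:
  assumes u: "u \<in> gevrey \<sigma> 1" and v: "v \<in> gevrey \<sigma> 1"
  shows "sq_int (\<lambda>x. rep_l2 u x * rep_l2 v x)"
    and "AE x in lborel. rep_l2 (l2_mult u v) x = rep_l2 u x * rep_l2 v x"
    and "AE \<xi> in lborel. rep_l2 (fourier (l2_mult u v)) \<xi> =
      conv (rep_l2 (fourier u)) (rep_l2 (fourier v)) \<xi> / (2 * pi)"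
proof -
  let ?U = "rep_l2 (fourier u)" and ?V = "rep_l2 (fourier v)"
  let ?C = "conv ?U ?V"
  note Ui = integrable_fourier_gevrey[OF u] and Vi = integrable_fourier_gevrey[OF v]
  note Ci = integrable_conv[OF Ui Vi]
  have Cs: "sq_int ?C"
  proof (rule sq_int_bound(1))
    show "sq_int (\<lambda>\<xi>. of_real (gweight \<sigma> 0 \<xi>) * ?C \<xi>)"
      using conv_fourier_gevrey(1)[of u \<sigma> 0 v] u v by simp
    show "AE \<xi> in lborel. cmod (?C \<xi>) \<le> cmod (of_real (gweight \<sigma> 0 \<xi>) * ?C \<xi>)"
      using gweight_ge_1[of 0 \<sigma>] gweight_pos[of \<sigma> 0] by (intro AE_I2) (simp add: norm_mult mult_le_cancel_right1 less_imp_le)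
  qed measurable
  have repr: "AE x in lborel. rep_l2 w x = ft (rep_l2 (fourier w)) (- x) / (2 * pi)"
    if "integrable lborel (rep_l2 (fourier w))" for w
  proof -
    have "w = abs_l2 (\<lambda>x. ft (rep_l2 (fourier w)) (- x) / (2 * pi))"
      using ifourier_abs_l2[OF that sq_int_rep_l2] by simp
    moreover have "sq_int (\<lambda>x. ft (rep_l2 (fourier w)) (- x) / (2 * pi))"
      using sq_int_cmult[OF sq_int_uminus_arg[OF plancherel_L1_le(1)[OF that sq_int_rep_l2]], of "1 / (2 * pi)"] by simp
    ultimately show ?thesis using rep_abs_l2 by metis
  qed
  \<comment> \<open>Each of the two inversion formulas contributes 1/(2 pi). One is consumed in
    reading \<open>P\<close> as an inverse transform, the other remains in the conclusion.\<close>
  define P where "P x = ft ?C (- x) / (2 * pi) / (2 * pi)" for x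
  have Psq: "sq_int (\<lambda>x. ft ?C (- x) / (2 * pi))"
    using sq_int_cmult[OF sq_int_uminus_arg[OF plancherel_L1_le(1)[OF Ci Cs]], of "1 / (2 * pi)"] by simp
  then have P: "sq_int P" using sq_int_cmult[OF Psq, of "1 / (2 * pi)"] by (simp add: P_def[abs_def])
  have ae: "AE x in lborel. rep_l2 u x * rep_l2 v x = P x"
    using repr[OF Ui] repr[OF Vi] by eventually_elim (simp add: P_def ft_conv[OF Ui Vi])
  show sq: "sq_int (\<lambda>x. rep_l2 u x * rep_l2 v x)"
    by (rule sq_int_cong_AE(1)[OF _ P ae]) measurable
  have m: "l2_mult u v = abs_l2 (\<lambda>x. rep_l2 u x * rep_l2 v x)"
    using l2_mult.abs_eq[of "rep_l2 u" "rep_l2 v"] sq by (simp add: l2_rel_refl)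
  show "AE x in lborel. rep_l2 (l2_mult u v) x = rep_l2 u x * rep_l2 v x"
    unfolding m by (rule rep_abs_l2[OF sq])
  have "l2_mult u v = abs_l2 P"
    unfolding m by (rule sq_int_cong_AE(2)[OF _ P ae]) measurable
  also have "\<dots> = (1 / (2 * pi)) *\<^sub>R abs_l2 (\<lambda>x. ft ?C (- x) / (2 * pi))"
    by (subst scaleR_abs_l2[OF Psq]) (simp add: P_def[abs_def] scaleR_conv_of_real)
  also have "\<dots> = (1 / (2 * pi)) *\<^sub>R ifourier (abs_l2 ?C)"
    by (simp add: ifourier_abs_l2[OF Ci Cs])
  finally have "fourier (l2_mult u v) = abs_l2 (\<lambda>\<xi>. (1 / (2 * pi)) *\<^sub>R ?C \<xi>)"
    by (simp add: fourier_scaleR scaleR_abs_l2[OF Cs])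
  then show "AE \<xi> in lborel. rep_l2 (fourier (l2_mult u v)) \<xi> = ?C \<xi> / (2 * pi)"
    using rep_abs_l2[OF sq_int_scaleR[OF Cs, of "1 / (2 * pi)"]] by (simp add: scaleR_conv_of_real)
qed

lemma gevrey_l2_mult:
  assumes u: "u \<in> gevrey \<sigma> (s + 1)" and v: "v \<in> gevrey \<sigma> (s + 1)" and s: "0 \<le> s"
  shows "l2_mult u v \<in> gevrey \<sigma> s"
    and "gevrey_norm \<sigma> s (l2_mult u v) \<le> (2 * sqrt 2 powr s) * inv_jbracket_norm *
      gevrey_norm \<sigma> (s + 1) u * gevrey_norm \<sigma> (s + 1) v"
proof -
  let ?f = "\<lambda>\<xi>. of_real (gweight \<sigma> s \<xi>) * conv (rep_l2 (fourier u)) (rep_l2 (fourier v)) \<xi>"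
  have "u \<in> gevrey \<sigma> 1" "v \<in> gevrey \<sigma> 1" using gevrey_mono(1)[of _ \<sigma> "s + 1" 1] u v s by auto
  from l2_mult_gevrey(3)[OF this]
  have "AE \<xi> in lborel. cmod (gevrey_weighted \<sigma> s (l2_mult u v) \<xi>) \<le> cmod (?f \<xi>)"
  proof eventually_elim
    case (elim \<xi>)
    \<comment> \<open>The factor 1/(2 pi) of the product formula is at most 1 and is
      dropped.\<close>
    have "cmod (?f \<xi>) / (2 * pi) \<le> cmod (?f \<xi>) / 1" using pi_gt3 by (intro divide_left_mono) auto
    then show ?case unfolding gevrey_weighted_eq elim by (simp add: norm_mult norm_divide)
  qed
  note * = sq_int_bound[OF conv_fourier_gevrey(1)[OF u v s] _ this]
  show "l2_mult u v \<in> gevrey \<sigma> s" using *(1) by (simp add: gevrey_iff)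
  then show "gevrey_norm \<sigma> s (l2_mult u v) \<le> (2 * sqrt 2 powr s) * inv_jbracket_norm *
      gevrey_norm \<sigma> (s + 1) u * gevrey_norm \<sigma> (s + 1) v"
    using order_trans[OF *(2) conv_fourier_gevrey(2)[OF u v s]] by (simp add: gevrey_norm_eq)
qed

lemma l2_mult_commute: "l2_mult u v = l2_mult v u"
  by transfer (simp add: mult.commute l2_rel_def sq_int_zero)

lemma l2_mult_zero: "l2_mult 0 u = 0"
proof -
  have "AE x in lborel. rep_l2 0 x * rep_l2 u x = 0"
    using rep_zero_l2 by eventually_elim simp
  note * = sq_int_cong_AE[OF _ sq_int_zero this]
  have "sq_int (\<lambda>x. rep_l2 0 x * rep_l2 u x)" by (rule *(1)) measurable
  then have "l2_mult 0 u = abs_l2 (\<lambda>x. rep_l2 0 x * rep_l2 u x)"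
    using l2_mult.abs_eq[of "rep_l2 0" "rep_l2 u"] by (simp add: l2_rel_refl)
  also have "\<dots> = abs_l2 (\<lambda>_. 0)" by (rule *(2)) measurable
  finally show ?thesis by (simp add: zero_l2.abs_eq)
qed

text \<open>Distributivity can fail where \<open>l2_mult\<close> returns its default; in these
  spaces all products involved are genuine and the law holds pointwise.\<close>

lemma l2_mult_add_left:
  assumes "u \<in> gevrey \<sigma> 1" "v \<in> gevrey \<sigma> 1" "w \<in> gevrey \<sigma> 1"
  shows "l2_mult (u + v) w = l2_mult u w + l2_mult v w"
  by (rule l2_eqI, use l2_mult_gevrey(2)[OF gevrey_add(1)[OF assms(1,2)] assms(3)] l2_mult_gevrey(2)[OF assms(1,3)]
      l2_mult_gevrey(2)[OF assms(2,3)] rep_plus_l2[of u v] rep_plus_l2[of "l2_mult u w" "l2_mult v w"] in eventually_elim)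
    (simp add: distrib_right)

lemma l2_mult_diff_left:
  assumes "u \<in> gevrey \<sigma> 1" "v \<in> gevrey \<sigma> 1" "w \<in> gevrey \<sigma> 1"
  shows "l2_mult (u - v) w = l2_mult u w - l2_mult v w"
  by (rule l2_eqI, use l2_mult_gevrey(2)[OF gevrey_diff(1)[OF assms(1,2)] assms(3)] l2_mult_gevrey(2)[OF assms(1,3)]
      l2_mult_gevrey(2)[OF assms(2,3)] rep_minus_l2[of u v] rep_minus_l2[of "l2_mult u w" "l2_mult v w"] in eventually_elim)
    (simp add: left_diff_distrib)

lemma l2_mult_diff_right:
  assumes "w \<in> gevrey \<sigma> 1" "u \<in> gevrey \<sigma> 1" "v \<in> gevrey \<sigma> 1"
  shows "l2_mult w (u - v) = l2_mult w u - l2_mult w v"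
  unfolding l2_mult_commute[of w] by (rule l2_mult_diff_left[OF assms(2,3,1)])

lemma l2_mult_square_diff:
  assumes "u \<in> gevrey \<sigma> 1" "v \<in> gevrey \<sigma> 1"
  shows "l2_mult u u - l2_mult v v = l2_mult (u + v) (u - v)"
  using assms gevrey_diff(1)[OF assms]
  by (simp add: l2_mult_add_left l2_mult_commute[of u "u - v"] l2_mult_commute[of v "u - v"] l2_mult_diff_left
      l2_mult_commute[of v u])

lemma l2_cnj_mult:
  assumes "u \<in> gevrey \<sigma> 1" "v \<in> gevrey \<sigma> 1"
  shows "l2_cnj (l2_mult u v) = l2_mult (l2_cnj u) (l2_cnj v)"
proof -
  have ae: "AE x in lborel. rep_l2 (l2_cnj u) x * rep_l2 (l2_cnj v) x = cnj (rep_l2 u x * rep_l2 v x)"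
    using rep_cnj_l2[of u] rep_cnj_l2[of v] by eventually_elim simp
  note sq = sq_int_cnj[OF l2_mult_gevrey(1)[OF assms]]
  note * = sq_int_cong_AE[OF _ sq ae]
  have "l2_mult (l2_cnj u) (l2_cnj v) = abs_l2 (\<lambda>x. rep_l2 (l2_cnj u) x * rep_l2 (l2_cnj v) x)"
    using l2_mult.abs_eq[of "rep_l2 (l2_cnj u)" "rep_l2 (l2_cnj v)"] *(1) by (simp add: l2_rel_refl)
  also have "\<dots> = abs_l2 (\<lambda>x. cnj (rep_l2 u x * rep_l2 v x))" by (rule *(2)) measurable
  also have "\<dots> = l2_cnj (abs_l2 (\<lambda>x. rep_l2 u x * rep_l2 v x))"
    by (rule cnj_abs_l2[symmetric, OF l2_mult_gevrey(1)[OF assms]])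
  also have "abs_l2 (\<lambda>x. rep_l2 u x * rep_l2 v x) = l2_mult u v"
    using l2_mult.abs_eq[of "rep_l2 u" "rep_l2 v"] l2_mult_gevrey(1)[OF assms] by (simp add: l2_rel_refl)
  finally show ?thesis by simp
qed

section \<open>Gevrey spaces as copies of \<open>L\<^sup>2\<close>\<close>

definition gevrey_to_l2 :: "real \<Rightarrow> real \<Rightarrow> l2 \<Rightarrow> l2" where
  "gevrey_to_l2 \<sigma> s u = abs_l2 (gevrey_weighted \<sigma> s u)"

text \<open>For s >= 0 the weight is at least 1, so the quotient stays in L^2. The map is then a
  contraction into the ambient space and at the same time an isometry onto the Gevrey space with its
  own norm.\<close>

definition l2_to_gevrey :: "real \<Rightarrow> real \<Rightarrow> l2 \<Rightarrow> l2" where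
  "l2_to_gevrey \<sigma> s g = ifourier (abs_l2 (\<lambda>\<xi>. rep_l2 g \<xi> / of_real (gweight \<sigma> s \<xi>)))"

lemma sq_int_div_gweight:
  assumes "0 \<le> s"
  shows "sq_int (\<lambda>\<xi>. rep_l2 g \<xi> / of_real (gweight \<sigma> s \<xi>))"
    "norm (abs_l2 (\<lambda>\<xi>. rep_l2 g \<xi> / of_real (gweight \<sigma> s \<xi>))) \<le> norm g"
proof -
  have ae: "AE \<xi> in lborel. cmod (rep_l2 g \<xi> / of_real (gweight \<sigma> s \<xi>)) \<le> cmod (rep_l2 g \<xi>)"
  proof (intro AE_I2)
    fix \<xi>
    have "cmod (rep_l2 g \<xi>) / gweight \<sigma> s \<xi> \<le> cmod (rep_l2 g \<xi>) / 1"
      using gweight_ge_1[OF assms, of \<sigma> \<xi>] by (intro divide_left_mono) auto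
    then show "cmod (rep_l2 g \<xi> / of_real (gweight \<sigma> s \<xi>)) \<le> cmod (rep_l2 g \<xi>)"
      using gweight_pos[of \<sigma> s \<xi>] by (simp add: norm_divide)
  qed
  have "(\<lambda>\<xi>. rep_l2 g \<xi> / of_real (gweight \<sigma> s \<xi>)) \<in> borel_measurable borel" by measurable
  from sq_int_bound[OF sq_int_rep_l2 this ae]
  show "sq_int (\<lambda>\<xi>. rep_l2 g \<xi> / of_real (gweight \<sigma> s \<xi>))"
    "norm (abs_l2 (\<lambda>\<xi>. rep_l2 g \<xi> / of_real (gweight \<sigma> s \<xi>))) \<le> norm g" by simp_all
qed

lemma rep_fourier_l2_to_gevrey:
  assumes "0 \<le> s"
  shows "AE \<xi> in lborel. rep_l2 (fourier (l2_to_gevrey \<sigma> s g)) \<xi> = rep_l2 g \<xi> / of_real (gweight \<sigma> s \<xi>)"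
  unfolding l2_to_gevrey_def using rep_abs_l2[OF sq_int_div_gweight(1)[OF assms]] by simp

lemma gevrey_weighted_l2_to_gevrey:
  assumes "0 \<le> s"
  shows "AE \<xi> in lborel. gevrey_weighted \<sigma> s (l2_to_gevrey \<sigma> s g) \<xi> = rep_l2 g \<xi>"
  using rep_fourier_l2_to_gevrey[OF assms, of \<sigma> g] unfolding gevrey_weighted_eq
  by eventually_elim (use gweight_pos[of \<sigma> s] in \<open>simp add: less_imp_neq[symmetric]\<close>)

lemma l2_to_gevrey:
  assumes "0 \<le> s"
  shows "l2_to_gevrey \<sigma> s g \<in> gevrey \<sigma> s" "gevrey_to_l2 \<sigma> s (l2_to_gevrey \<sigma> s g) = g"
    "gevrey_norm \<sigma> s (l2_to_gevrey \<sigma> s g) = norm g"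
proof -
  note * = sq_int_cong_AE[OF borel_measurable_gevrey_weighted sq_int_rep_l2 gevrey_weighted_l2_to_gevrey[OF assms]]
  show 1: "l2_to_gevrey \<sigma> s g \<in> gevrey \<sigma> s" using *(1) by (simp add: gevrey_iff)
  show 2: "gevrey_to_l2 \<sigma> s (l2_to_gevrey \<sigma> s g) = g" using *(2) by (simp add: gevrey_to_l2_def)
  show "gevrey_norm \<sigma> s (l2_to_gevrey \<sigma> s g) = norm g"
    using 2 by (simp add: gevrey_norm_eq[OF 1] gevrey_to_l2_def)
qed

lemma l2_to_gevrey_eqI:
  assumes "0 \<le> s" "AE \<xi> in lborel. gevrey_weighted \<sigma> s u \<xi> = rep_l2 g \<xi>"
  shows "l2_to_gevrey \<sigma> s g = u"
proof -
  have "AE \<xi> in lborel. rep_l2 (fourier (l2_to_gevrey \<sigma> s g)) \<xi> = rep_l2 (fourier u) \<xi>"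
    using rep_fourier_l2_to_gevrey[OF assms(1), of \<sigma> g] assms(2) unfolding gevrey_weighted_eq
  proof eventually_elim
    case (elim \<xi>)
    show ?case unfolding elim(1) elim(2)[symmetric] using gweight_pos[of \<sigma> s \<xi>] by simp
  qed
  then show ?thesis by (simp add: l2_eq_iff[symmetric] fourier_inject)
qed

lemma rep_gevrey_to_l2:
  assumes "u \<in> gevrey \<sigma> s"
  shows "AE \<xi> in lborel. rep_l2 (gevrey_to_l2 \<sigma> s u) \<xi> = gevrey_weighted \<sigma> s u \<xi>"
  unfolding gevrey_to_l2_def using assms by (intro rep_abs_l2) (simp add: gevrey_iff)

lemma l2_to_gevrey_to_l2:
  assumes "0 \<le> s" "u \<in> gevrey \<sigma> s"
  shows "l2_to_gevrey \<sigma> s (gevrey_to_l2 \<sigma> s u) = u"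
  using rep_gevrey_to_l2[OF assms(2)] by (intro l2_to_gevrey_eqI[OF assms(1)]) (auto elim: eventually_mono)

lemma l2_to_gevrey_cscale:
  assumes "0 \<le> s"
  shows "l2_to_gevrey \<sigma> s (l2_cscale c g) = l2_cscale c (l2_to_gevrey \<sigma> s g)"
  by (rule l2_to_gevrey_eqI[OF assms], unfold gevrey_weighted_eq fourier_cscale,
      use gevrey_weighted_l2_to_gevrey[OF assms, of \<sigma> g, unfolded gevrey_weighted_eq] rep_cscale_l2[of c g]
        rep_cscale_l2[of c "fourier (l2_to_gevrey \<sigma> s g)"] in eventually_elim) simp

lemma bounded_linear_l2_to_gevrey:
  assumes "0 \<le> s"
  shows "bounded_linear (l2_to_gevrey \<sigma> s)"
proof (rule bounded_linear_intro[where K = 1])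
  show "l2_to_gevrey \<sigma> s (g + h) = l2_to_gevrey \<sigma> s g + l2_to_gevrey \<sigma> s h" for g h
    by (rule l2_to_gevrey_eqI[OF assms], unfold gevrey_weighted_eq fourier_add,
      use gevrey_weighted_l2_to_gevrey[OF assms, of \<sigma> g, unfolded gevrey_weighted_eq]
        gevrey_weighted_l2_to_gevrey[OF assms, of \<sigma> h, unfolded gevrey_weighted_eq] rep_plus_l2[of g h]
        rep_plus_l2[of "fourier (l2_to_gevrey \<sigma> s g)" "fourier (l2_to_gevrey \<sigma> s h)"] in eventually_elim)
      (simp add: distrib_left)
  show "l2_to_gevrey \<sigma> s (r *\<^sub>R g) = r *\<^sub>R l2_to_gevrey \<sigma> s g" for r g
    using l2_to_gevrey_cscale[OF assms, of \<sigma> "of_real r" g] by (simp add: l2_cscale_of_real)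
  show "norm (l2_to_gevrey \<sigma> s g) \<le> norm g * 1" for g
  proof -
    have "1 \<le> sqrt (2 * pi)" using pi_gt3 by simp
    then have "norm (l2_to_gevrey \<sigma> s g) \<le> norm (abs_l2 (\<lambda>\<xi>. rep_l2 g \<xi> / of_real (gweight \<sigma> s \<xi>))) / 1"
      unfolding l2_to_gevrey_def norm_ifourier by (intro divide_left_mono) auto
    then show ?thesis using sq_int_div_gweight(2)[OF assms, of g \<sigma>] by simp
  qed
qed

lemma l2_to_gevrey_inject:
  assumes "0 \<le> s"
  shows "l2_to_gevrey \<sigma> s g = l2_to_gevrey \<sigma> s h \<longleftrightarrow> g = h"
  by (metis l2_to_gevrey(2)[OF assms])

text \<open>The weight is even and real, so it commutes with the reflected conjugation that
  conjugation becomes on the Fourier side.\<close>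

lemma l2_cnj_l2_to_gevrey:
  assumes "0 \<le> s"
  shows "l2_cnj (l2_to_gevrey \<sigma> s g) = l2_to_gevrey \<sigma> s (l2_star g)"
proof (rule l2_to_gevrey_eqI[OF assms, symmetric])
  have even: "gweight \<sigma> s (- \<xi>) = gweight \<sigma> s \<xi>" for \<xi> by (simp add: gweight_def jbracket_def)
  have "AE \<xi> in lborel. gevrey_weighted \<sigma> s (l2_to_gevrey \<sigma> s g) (- \<xi>) = rep_l2 g (- \<xi>)"
    by (rule AE_lborel_uminus[OF _ _ gevrey_weighted_l2_to_gevrey[OF assms]]) measurable
  then show "AE \<xi> in lborel. gevrey_weighted \<sigma> s (l2_cnj (l2_to_gevrey \<sigma> s g)) \<xi> = rep_l2 (l2_star g) \<xi>"
    using rep_star_l2[of "fourier (l2_to_gevrey \<sigma> s g)"] rep_star_l2[of g] unfolding gevrey_weighted_eq fourier_cnj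
  proof eventually_elim
    case (elim \<xi>)
    show ?case unfolding elim(2) elim(3) elim(1)[symmetric] even by simp
  qed
qed

lemma gevrey_norm_l2_to_gevrey_diff:
  "gevrey_norm \<sigma> 2 (l2_to_gevrey \<sigma> 2 g - l2_to_gevrey \<sigma> 2 h) = norm (g - h)"
  using l2_to_gevrey(3)[of 2 \<sigma> "g - h"] linear_simps(2)[OF bounded_linear_l2_to_gevrey[of 2 \<sigma>], of g h] by simp

lemma norm_gevrey_to_l2: "u \<in> gevrey \<sigma> 2 \<Longrightarrow> norm (gevrey_to_l2 \<sigma> 2 u) = gevrey_norm \<sigma> 2 u"
  by (simp add: gevrey_to_l2_def gevrey_norm_eq)

section \<open>The free evolution on the weighted copy\<close>

definition phase :: "(real \<Rightarrow> real) \<Rightarrow> real \<Rightarrow> l2 \<Rightarrow> l2" where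
  "phase \<theta> t g = abs_l2 (\<lambda>\<xi>. cis (- (t * \<theta> \<xi>)) * rep_l2 g \<xi>)"

context
  fixes \<theta> :: "real \<Rightarrow> real"
  assumes \<theta> [measurable]: "\<theta> \<in> borel_measurable borel"
begin

lemma sq_int_phase: "sq_int (\<lambda>\<xi>. cis (- (t * \<theta> \<xi>)) * rep_l2 g \<xi>)"
  by (rule sq_int_bound(1)[OF sq_int_rep_l2[of g]]) (measurable, simp add: norm_mult)

lemma rep_phase: "AE \<xi> in lborel. rep_l2 (phase \<theta> t g) \<xi> = cis (- (t * \<theta> \<xi>)) * rep_l2 g \<xi>"
  unfolding phase_def by (rule rep_abs_l2[OF sq_int_phase])

lemma norm_phase: "norm (phase \<theta> t g) = norm g"
  using norm_abs_l2[OF sq_int_phase[of t g]] norm_abs_l2[OF sq_int_rep_l2[of g]]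
  by (simp add: phase_def norm_mult)

lemma phase_add: "phase \<theta> s (phase \<theta> t g) = phase \<theta> (s + t) g"
proof -
  have "cis (- (s * x)) * (cis (- (t * x)) * z) = cis (- ((s + t) * x)) * z" for x z
  proof -
    have "- ((s + t) * x) = - (s * x) + - (t * x)" by (simp add: algebra_simps)
    then show ?thesis by (simp only: cis_mult[symmetric] mult.assoc)
  qed
  then show ?thesis
    by (intro l2_eqI, use rep_phase[of s "phase \<theta> t g"] rep_phase[of t g] rep_phase[of "s + t" g] in eventually_elim)
      simp
qed

lemma phase_0: "phase \<theta> 0 g = g"
  by (rule l2_eqI, use rep_phase[of 0 g] in eventually_elim) simp

lemma phase_cscale: "phase \<theta> t (l2_cscale c g) = l2_cscale c (phase \<theta> t g)"
  by (rule l2_eqI, use rep_phase[of t "l2_cscale c g"] rep_phase[of t g] rep_cscale_l2[of c g]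
      rep_cscale_l2[of c "phase \<theta> t g"] in eventually_elim) simp

lemma bounded_linear_phase: "bounded_linear (phase \<theta> t)"
proof (rule bounded_linear_intro[where K = 1])
  show "phase \<theta> t (g + h) = phase \<theta> t g + phase \<theta> t h" for g h
    by (rule l2_eqI, use rep_phase[of t "g + h"] rep_phase[of t g] rep_phase[of t h] rep_plus_l2[of g h]
      rep_plus_l2[of "phase \<theta> t g" "phase \<theta> t h"] in eventually_elim) (simp add: distrib_left)
  show "phase \<theta> t (r *\<^sub>R g) = r *\<^sub>R phase \<theta> t g" for r g
    using phase_cscale[of t "of_real r" g] by (simp add: l2_cscale_of_real)
qed (simp add: norm_phase)

text \<open>All members of the orbit have the modulus of g, so domination is immediate. Continuity
  is for each fixed g, since the phase function may be unbounded.\<close>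

lemma continuous_on_phase: "continuous_on UNIV (\<lambda>t. phase \<theta> t g)"
  unfolding continuous_on_sequentially
proof (intro ballI allI impI, elim conjE)
  fix x :: "nat \<Rightarrow> real" and a assume x: "x \<longlonglongrightarrow> a"
  have "(\<lambda>n. abs_l2 (\<lambda>\<xi>. cis (- (x n * \<theta> \<xi>)) * rep_l2 g \<xi>)) \<longlonglongrightarrow> abs_l2 (\<lambda>\<xi>. cis (- (a * \<theta> \<xi>)) * rep_l2 g \<xi>)"
  proof (rule abs_l2_dominated_convergence(2)[OF sq_int_phase])
    show "(\<lambda>n. cis (- (x n * \<theta> \<xi>)) * rep_l2 g \<xi>) \<longlonglongrightarrow> cis (- (a * \<theta> \<xi>)) * rep_l2 g \<xi>" for \<xi>
      by (intro tendsto_intros x)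
  qed (measurable, simp add: norm_mult)
  then show "((\<lambda>t. phase \<theta> t g) \<circ> x) \<longlonglongrightarrow> phase \<theta> a g" by (simp add: phase_def o_def)
qed

text \<open>Reflection changes the sign of an odd phase and conjugation changes it back.\<close>

lemma star_phase:
  assumes "\<And>\<xi>. \<theta> (- \<xi>) = - \<theta> \<xi>"
  shows "l2_star (phase \<theta> t g) = phase \<theta> t (l2_star g)"
proof (rule l2_eqI)
  have "AE \<xi> in lborel. rep_l2 (phase \<theta> t g) (- \<xi>) = cis (- (t * \<theta> (- \<xi>))) * rep_l2 g (- \<xi>)"
    by (rule AE_lborel_uminus[OF _ _ rep_phase]) measurable
  then show "AE \<xi> in lborel. rep_l2 (l2_star (phase \<theta> t g)) \<xi> = rep_l2 (phase \<theta> t (l2_star g)) \<xi>"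
    using rep_star_l2[of "phase \<theta> t g"] rep_phase[of t "l2_star g"] rep_star_l2[of g]
    by eventually_elim (simp add: assms cis_cnj)
qed

lemma fourier_mult_l2_to_gevrey:
  assumes "0 \<le> s"
  shows "fourier_mult (\<lambda>\<xi>. cis (- (t * \<theta> \<xi>))) (l2_to_gevrey \<sigma> s g) = l2_to_gevrey \<sigma> s (phase \<theta> t g)"
  by (rule fourier_multI, use rep_fourier_l2_to_gevrey[OF assms, of \<sigma> g]
      rep_fourier_l2_to_gevrey[OF assms, of \<sigma> "phase \<theta> t g"] rep_phase[of t g] in eventually_elim) simp

end

section \<open>Duhamel's equation in a Banach space\<close>

text \<open>At a maximum point r of exp(-2 \<Lambda> t) d(t), with value m, the hypothesis bounds
  d(r) by \<Lambda> times the integral of m exp(2 \<Lambda> s) over [0, r], hence by half of d(r);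
  the 2 in the exponent produces the half. This forces m <= 0.\<close>

lemma gronwall_zero:
  fixes d :: "real \<Rightarrow> real"
  assumes cont: "continuous_on {0..T} d" and nonneg: "\<And>t. t \<in> {0..T} \<Longrightarrow> 0 \<le> d t" and "\<Lambda> > 0"
    and le: "\<And>t. t \<in> {0..T} \<Longrightarrow> d t \<le> \<Lambda> * integral {0..t} d"
    and "t \<in> {0..T}"
  shows "d t = 0"
proof -
  have "continuous_on {0..T} (\<lambda>t. exp (- 2 * \<Lambda> * t) * d t)"
    by (intro continuous_intros cont)
  then obtain r where r: "r \<in> {0..T}" "\<And>t. t \<in> {0..T} \<Longrightarrow> exp (- 2 * \<Lambda> * t) * d t \<le> exp (- 2 * \<Lambda> * r) * d r"
    using continuous_attains_sup[of "{0..T}" "\<lambda>t. exp (- 2 * \<Lambda> * t) * d t"] \<open>t \<in> {0..T}\<close> by auto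
  define m where "m = exp (- 2 * \<Lambda> * r) * d r"
  have dm: "d s \<le> m * exp (2 * \<Lambda> * s)" if "s \<in> {0..T}" for s
    using r(2)[OF that] unfolding m_def[symmetric] by (simp add: exp_minus field_simps)
  have dr: "d r = m * exp (2 * \<Lambda> * r)" by (simp add: m_def mult_exp_exp ac_simps flip: exp_add)
  have I: "((\<lambda>s. m * exp (2 * \<Lambda> * s)) has_integral (m * exp (2 * \<Lambda> * r) / (2 * \<Lambda>) - m * exp (2 * \<Lambda> * 0) / (2 * \<Lambda>))) {0..r}"
    using r(1) \<open>\<Lambda> > 0\<close>
    by (intro fundamental_theorem_of_calculus)
      (auto intro!: derivative_eq_intros simp flip: has_real_derivative_iff_has_vector_derivative)
  have "m \<ge> 0" using nonneg[OF r(1)] by (simp add: m_def)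
  have "d r \<le> \<Lambda> * integral {0..r} d" by (rule le[OF r(1)])
  also have "integral {0..r} d \<le> integral {0..r} (\<lambda>s. m * exp (2 * \<Lambda> * s))"
    using r(1) I by (intro integral_le dm integrable_continuous_real continuous_on_subset[OF cont]) (auto intro!: continuous_intros)
  then have "\<Lambda> * integral {0..r} d \<le> \<Lambda> * integral {0..r} (\<lambda>s. m * exp (2 * \<Lambda> * s))"
    using \<open>\<Lambda> > 0\<close> by simp
  also have "\<dots> = m * exp (2 * \<Lambda> * r) / 2 - m / 2"
    using \<open>\<Lambda> > 0\<close> integral_unique[OF I] by (simp add: field_simps)
  finally have "d r \<le> m * exp (2 * \<Lambda> * r) / 2" using \<open>m \<ge> 0\<close> by simp
  then have "m * exp (2 * \<Lambda> * r) \<le> 0" unfolding dr by simp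
  then have "m \<le> 0" by (simp add: mult_le_0_iff)
  then have "d t \<le> 0" using dm[OF \<open>t \<in> {0..T}\<close>] by (meson exp_ge_zero mult_nonpos_nonneg order_trans)
  then show ?thesis using nonneg[OF \<open>t \<in> {0..T}\<close>] by simp
qed

text \<open>The factor -i of the equation is absorbed in \<open>G\<close>, so the integral carries a
  plus sign. The quadratic growth of the Lipschitz constant in K leads to the power -2 in the
  existence time.\<close>

locale duhamel =
  fixes U :: "real \<Rightarrow> 'a :: banach \<Rightarrow> 'a" and G :: "'a \<Rightarrow> 'a" and L :: real
  assumes U_linear: "bounded_linear (U t)"
    and U_norm: "norm (U t x) = norm x"
    and U_add: "U s (U t x) = U (s + t) x"
    and U_0: "U 0 x = x"
    and U_cont: "continuous_on UNIV (\<lambda>t. U t x)"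
    and L_pos: "0 < L"
    and G_0: "G 0 = 0"
    and G_lip: "norm x \<le> K \<Longrightarrow> norm y \<le> K \<Longrightarrow> norm (G x - G y) \<le> L * (1 + K)\<^sup>2 * norm (x - y)"
begin

definition solves :: "real \<Rightarrow> 'a \<Rightarrow> (real \<Rightarrow> 'a) \<Rightarrow> bool" where
  "solves T g0 g \<longleftrightarrow> continuous_on {0..T} g \<and>
    (\<forall>t\<in>{0..T}. g t = U t g0 + integral {0..t} (\<lambda>s. U (t - s) (G (g s))))"

lemma U_diff: "U t (x - y) = U t x - U t y"
  by (rule linear_simps(2)[OF U_linear])

text \<open>Strong continuity and isometry together give joint continuity: the isometry controls the
  change in g, and the change in time is tested on the fixed vector g(t).\<close>

lemma continuous_on_U:
  assumes g: "continuous_on S g" and f: "continuous_on S f"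
  shows "continuous_on S (\<lambda>t. U (f t) (g t))"
  unfolding continuous_on_def
proof
  fix t assume t: "t \<in> S"
  have le: "norm (U (f r) (g r) - U (f t) (g t)) \<le> norm (g r - g t) + norm (U (f r) (g t) - U (f t) (g t))" for r
  proof -
    have "U (f r) (g r) - U (f t) (g t) = U (f r) (g r - g t) + (U (f r) (g t) - U (f t) (g t))"
      by (simp add: U_diff)
    then show ?thesis by (metis norm_triangle_ineq U_norm)
  qed
  have "continuous_on S (\<lambda>r. U (f r) (g t))"
    by (rule continuous_on_compose2[OF U_cont f]) auto
  then have "((\<lambda>r. norm (g r - g t) + norm (U (f r) (g t) - U (f t) (g t))) \<longlongrightarrow> norm (g t - g t) + norm (U (f t) (g t) - U (f t) (g t))) (at t within S)"
    using g t unfolding continuous_on_def by (intro tendsto_intros) auto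
  then have "((\<lambda>r. norm (g r - g t) + norm (U (f r) (g t) - U (f t) (g t))) \<longlongrightarrow> 0) (at t within S)" by simp
  then have "((\<lambda>r. U (f r) (g r) - U (f t) (g t)) \<longlongrightarrow> 0) (at t within S)"
    by (rule Lim_null_comparison[OF always_eventually[OF allI[OF le]]])
  then show "((\<lambda>r. U (f r) (g r)) \<longlongrightarrow> U (f t) (g t)) (at t within S)" by (rule LIM_zero_cancel)
qed

text \<open>The Lipschitz bound on the ball of radius \<open>norm x + 1\<close> covers all points
  within distance 1 of x.\<close>

lemma continuous_on_G: "continuous_on UNIV G"
  unfolding continuous_on_def
proof
  fix x :: 'a
  let ?K = "norm x + 1"
  have "((\<lambda>y. L * (1 + ?K)\<^sup>2 * norm (y - x)) \<longlongrightarrow> L * (1 + ?K)\<^sup>2 * norm (x - x)) (at x)"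
    by (intro tendsto_intros)
  then have lim: "((\<lambda>y. L * (1 + ?K)\<^sup>2 * norm (y - x)) \<longlongrightarrow> 0) (at x)" by simp
  have "\<forall>\<^sub>F y in at x. norm (G y - G x) \<le> L * (1 + ?K)\<^sup>2 * norm (y - x)"
    unfolding eventually_at
  proof (intro exI[of _ 1] conjI ballI impI)
    fix y assume "y \<noteq> x \<and> dist y x < 1"
    then have "norm y \<le> ?K" using norm_triangle_sub[of y x] by (simp add: dist_norm)
    then show "norm (G y - G x) \<le> L * (1 + ?K)\<^sup>2 * norm (y - x)" by (intro G_lip) auto
  qed simp
  then have "((\<lambda>y. G y - G x) \<longlongrightarrow> 0) (at x)" by (rule Lim_null_comparison[OF _ lim])
  then show "(G \<longlongrightarrow> G x) (at x within UNIV)" by (rule LIM_zero_cancel)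
qed

lemma continuous_on_G_comp: "continuous_on S g \<Longrightarrow> continuous_on S (\<lambda>s. G (g s))"
  by (rule continuous_on_compose2[OF continuous_on_G]) auto

text \<open>In the interaction picture \<open>h t = U (- t) (g t)\<close> the free evolution disappears and the
  integrand no longer depends on the upper limit.\<close>

definition ipic :: "real \<Rightarrow> 'a \<Rightarrow> 'a" where
  "ipic s h = U (- s) (G (U s h))"

definition ipic_solves :: "real \<Rightarrow> 'a \<Rightarrow> (real \<Rightarrow> 'a) \<Rightarrow> bool" where
  "ipic_solves T g0 h \<longleftrightarrow> continuous_on {0..T} h \<and>
    (\<forall>t\<in>{0..T}. h t = g0 + integral {0..t} (\<lambda>s. ipic s (h s)))"

lemma continuous_on_ipic: "continuous_on S h \<Longrightarrow> continuous_on S (\<lambda>s. ipic s (h s))"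
  unfolding ipic_def by (intro continuous_on_U continuous_on_G_comp continuous_intros)

lemma ipic_lip: "norm x \<le> K \<Longrightarrow> norm y \<le> K \<Longrightarrow> norm (ipic s x - ipic s y) \<le> L * (1 + K)\<^sup>2 * norm (x - y)"
  unfolding ipic_def U_diff[symmetric] U_norm using G_lip[of "U s x" K "U s y"] by (simp add: U_norm U_diff[symmetric])

lemma ipic_bound: "norm x \<le> K \<Longrightarrow> norm (ipic s x) \<le> L * (1 + K)\<^sup>2 * norm x"
proof -
  assume x: "norm x \<le> K"
  have "ipic s 0 = 0"
    using U_linear by (simp add: ipic_def G_0 linear_simps(3))
  moreover have "norm (0::'a) \<le> K" using order_trans[OF norm_ge_zero x] by simp
  ultimately show ?thesis using ipic_lip[OF x, of 0 s] by simp
qed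

lemma U_integral:
  fixes a b :: real
  assumes "continuous_on {a..b} f"
  shows "integral {a..b} (\<lambda>s. U t (f s)) = U t (integral {a..b} f)"
  using integral_linear[OF integrable_continuous_real[OF assms] U_linear[of t]] by (simp add: o_def)

lemma solves_imp_ipic:
  assumes "solves T g0 g"
  shows "ipic_solves T g0 (\<lambda>t. U (- t) (g t))"
  unfolding ipic_solves_def
proof (intro conjI ballI)
  have g: "continuous_on {0..T} g" using assms by (simp add: solves_def)
  then show "continuous_on {0..T} (\<lambda>t. U (- t) (g t))" by (intro continuous_on_U continuous_intros)
  fix t assume t: "t \<in> {0..T}"
  then have gt: "continuous_on {0..t} g" using continuous_on_subset[OF g] by auto
  have c: "continuous_on {0..t} (\<lambda>s. U (t - s) (G (g s)))"
    by (intro continuous_on_U continuous_on_G_comp continuous_intros gt)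
  have "U (- t) (g t) = U (- t) (U t g0 + integral {0..t} (\<lambda>s. U (t - s) (G (g s))))"
    using assms t unfolding solves_def by metis
  also have "\<dots> = U (- t) (U t g0) + U (- t) (integral {0..t} (\<lambda>s. U (t - s) (G (g s))))"
    using U_linear by (rule linear_simps)
  also have "\<dots> = g0 + integral {0..t} (\<lambda>s. U (- t) (U (t - s) (G (g s))))"
    by (simp add: U_integral[OF c, symmetric] U_add U_0)
  finally show "U (- t) (g t) = g0 + integral {0..t} (\<lambda>s. ipic s (U (- s) (g s)))"
    by (simp add: U_add U_0 ipic_def)
qed

lemma ipic_imp_solves:
  assumes "ipic_solves T g0 h"
  shows "solves T g0 (\<lambda>t. U t (h t))"
  unfolding solves_def
proof (intro conjI ballI)
  have h: "continuous_on {0..T} h" using assms by (simp add: ipic_solves_def)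
  then show "continuous_on {0..T} (\<lambda>t. U t (h t))" by (intro continuous_on_U continuous_intros)
  fix t assume t: "t \<in> {0..T}"
  then have ht: "continuous_on {0..t} h" using continuous_on_subset[OF h] by auto
  have "U t (h t) = U t (g0 + integral {0..t} (\<lambda>s. ipic s (h s)))"
    using assms t unfolding ipic_solves_def by metis
  also have "\<dots> = U t g0 + U t (integral {0..t} (\<lambda>s. ipic s (h s)))"
    using U_linear by (rule linear_simps)
  also have "\<dots> = U t g0 + integral {0..t} (\<lambda>s. U t (ipic s (h s)))"
    by (simp add: U_integral[OF continuous_on_ipic[OF ht]])
  finally show "U t (h t) = U t g0 + integral {0..t} (\<lambda>s. U (t - s) (G (U s (h s))))"
    by (simp add: ipic_def U_add)
qed

section \<open>Uniqueness, existence, stability and symmetry for Duhamel's equation\<close>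

lemma continuous_bounded:
  fixes T :: real
  assumes "continuous_on {0..T} h"
  obtains K where "0 \<le> K" "\<And>t. t \<in> {0..T} \<Longrightarrow> norm (h t) \<le> K"
proof -
  have "bounded (h ` {0..T})"
    using assms by (intro compact_imp_bounded compact_continuous_image) auto
  then obtain B where "\<forall>x\<in>h ` {0..T}. norm x \<le> B" unfolding bounded_iff by blast
  then show ?thesis by (intro that[of "max 0 B"]) (auto intro: max.coboundedI2)
qed

lemma ipic_unique:
  assumes h: "ipic_solves T g0 h" and k: "ipic_solves T g0 k" and t: "t \<in> {0..T}"
  shows "h t = k t"
proof -
  have ch: "continuous_on {0..T} h" and ck: "continuous_on {0..T} k"
    using h k by (auto simp: ipic_solves_def)
  obtain A where A: "0 \<le> A" "\<And>t. t \<in> {0..T} \<Longrightarrow> norm (h t) \<le> A" by (rule continuous_bounded[OF ch]) blast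
  obtain B where B: "0 \<le> B" "\<And>t. t \<in> {0..T} \<Longrightarrow> norm (k t) \<le> B" by (rule continuous_bounded[OF ck]) blast
  \<comment> \<open>\<open>K\<close> is taken from the two solutions themselves, which are bounded
    on the compact interval; hence uniqueness requires no relation between their size and T.\<close>
  define K where "K = max A B"
  have K: "norm (h t) \<le> K" "norm (k t) \<le> K" if "t \<in> {0..T}" for t
    using A(2)[OF that] B(2)[OF that] by (auto simp: K_def)
  define \<Lambda> where "\<Lambda> = L * (1 + K)\<^sup>2"
  have "0 < 1 + K" using A by (simp add: K_def)
  then have \<Lambda>: "\<Lambda> > 0" using L_pos by (simp add: \<Lambda>_def)
  have "norm (h t - k t) = 0"
  proof (rule gronwall_zero[OF _ _ \<Lambda> _ t])
    show cd: "continuous_on {0..T} (\<lambda>t. norm (h t - k t))" by (intro continuous_intros ch ck)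
    fix t assume t: "t \<in> {0..T}"
    then have sub: "{0..t} \<subseteq> {0..T}" by auto
    note ch' = continuous_on_subset[OF ch sub] and ck' = continuous_on_subset[OF ck sub]
    have "h t = g0 + integral {0..t} (\<lambda>s. ipic s (h s))" "k t = g0 + integral {0..t} (\<lambda>s. ipic s (k s))"
      using h k t unfolding ipic_solves_def by blast+
    then have "h t - k t = integral {0..t} (\<lambda>s. ipic s (h s)) - integral {0..t} (\<lambda>s. ipic s (k s))" by simp
    also have "\<dots> = integral {0..t} (\<lambda>s. ipic s (h s) - ipic s (k s))"
      by (intro Henstock_Kurzweil_Integration.integral_diff[symmetric] integrable_continuous_real continuous_on_ipic ch' ck')
    finally have "norm (h t - k t) = norm (integral {0..t} (\<lambda>s. ipic s (h s) - ipic s (k s)))" by simp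
    also have "\<dots> \<le> integral {0..t} (\<lambda>s. \<Lambda> * norm (h s - k s))"
    proof (rule integral_norm_bound_integral)
      show "(\<lambda>s. ipic s (h s) - ipic s (k s)) integrable_on {0..t}" "(\<lambda>s. \<Lambda> * norm (h s - k s)) integrable_on {0..t}"
        by (intro integrable_continuous_real continuous_intros continuous_on_ipic ch' ck')+
      show "norm (ipic s (h s) - ipic s (k s)) \<le> \<Lambda> * norm (h s - k s)" if "s \<in> {0..t}" for s
        unfolding \<Lambda>_def using that sub by (intro ipic_lip K) auto
    qed
    finally show "norm (h t - k t) \<le> \<Lambda> * integral {0..t} (\<lambda>s. norm (h s - k s))" by simp
  qed simp
  then show ?thesis by simp
qed

lemma solves_unique:
  assumes "solves T g0 g" "solves T g0 k" "t \<in> {0..T}"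
  shows "g t = k t"
proof -
  have "U (- t) (g t) = U (- t) (k t)"
    by (rule ipic_unique[OF assms(1,2)[THEN solves_imp_ipic] assms(3)])
  then have "U t (U (- t) (g t)) = U t (U (- t) (k t))" by simp
  then show ?thesis by (simp add: U_add U_0)
qed

text \<open>The fixed point is sought among the bounded continuous functions on the whole line,
  whose type is a complete metric space. \<open>clamp\<close> freezes time outside [0, T], so the
  map preserves continuity and boundedness while the integrals see only [0, T].\<close>

lemma ipic_exists:
  assumes T: "0 \<le> T" and small: "T * (L * (1 + K)\<^sup>2) \<le> 1 / 2" and g0: "2 * norm g0 \<le> K"
  shows "\<exists>h. ipic_solves T g0 h \<and> (\<forall>t\<in>{0..T}. norm (h t) \<le> K)"
proof -
  have K: "0 \<le> K" using g0 norm_ge_zero[of g0] by linarith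
  define clamp where "clamp t = max 0 (min T t)" for t
  have clamp: "clamp t \<in> {0..T}" for t using T by (auto simp: clamp_def)
  have clamp_id: "clamp t = t" if "t \<in> {0..T}" for t using that by (auto simp: clamp_def)
  have clamp_cont: "continuous_on UNIV clamp" unfolding clamp_def[abs_def] by (intro continuous_intros)
  define \<Lambda> where "\<Lambda> = L * (1 + K)\<^sup>2"
  have \<Lambda>: "0 \<le> \<Lambda>" using L_pos by (simp add: \<Lambda>_def)
  \<comment> \<open>Smallness of T serves two purposes. With b = K the integral stays below K/2,
    which together with norm g0 <= K/2 preserves the ball; with b = \<open>dist h k\<close> the map
    contracts by 1/2.\<close>
  have half: "B * clamp t \<le> b / 2" if "B = \<Lambda> * b" "0 \<le> b" for B b t
  proof -
    have "B * clamp t \<le> B * T" using clamp[of t] that \<Lambda> by (intro mult_left_mono) auto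
    also have "\<dots> = (T * \<Lambda>) * b" using that by simp
    also have "\<dots> \<le> (1 / 2) * b" using small that by (intro mult_right_mono) (auto simp: \<Lambda>_def)
    finally show ?thesis by simp
  qed
  define \<Phi> where "\<Phi> h t = g0 + integral {0..clamp t} (\<lambda>s. ipic s (apply_bcontfun h s))" for h t
  have hc: "continuous_on S (apply_bcontfun h)" for S and h :: "real \<Rightarrow>\<^sub>C 'a"
    by simp
  have int_bound: "norm (integral {0..clamp t} f) \<le> B * clamp t" if "continuous_on {0..T} f" "\<And>s. s \<in> {0..T} \<Longrightarrow> norm (f s) \<le> B"
    for f :: "real \<Rightarrow> 'a" and B t
    using integral_bound[of 0 "clamp t" f B] clamp[of t] that continuous_on_subset[OF that(1), of "{0..clamp t}"] by auto
  have ball: "norm (\<Phi> h t) \<le> K" if "h \<in> cball 0 K" for h :: "real \<Rightarrow>\<^sub>C 'a" and t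
  proof -
    have hK: "norm (apply_bcontfun h s) \<le> K" for s
      using that norm_bounded[of h s] by simp
    have "norm (integral {0..clamp t} (\<lambda>s. ipic s (apply_bcontfun h s))) \<le> (\<Lambda> * K) * clamp t"
    proof (rule int_bound[OF continuous_on_ipic[OF hc]])
      fix s show "norm (ipic s (apply_bcontfun h s)) \<le> \<Lambda> * K"
        using order_trans[OF ipic_bound[OF hK, of s s] mult_left_mono[OF hK[of s], of "L * (1 + K)\<^sup>2"]] \<Lambda> by (simp add: \<Lambda>_def)
    qed
    also have "\<dots> \<le> K / 2" by (rule half[OF refl K])
    finally show ?thesis
      unfolding \<Phi>_def using norm_triangle_ineq[of g0 "integral {0..clamp t} (\<lambda>s. ipic s (apply_bcontfun h s))"] g0 by linarith
  qed
  have bc: "\<Phi> h \<in> bcontfun" if "h \<in> cball 0 K" for h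
  proof (rule bcontfun_normI[of _ K])
    have "continuous_on {0..T} (\<lambda>t. integral {0..t} (\<lambda>s. ipic s (apply_bcontfun h s)))"
      by (intro indefinite_integral_continuous_1 integrable_continuous_real continuous_on_ipic hc)
    then have "continuous_on UNIV (\<lambda>t. integral {0..clamp t} (\<lambda>s. ipic s (apply_bcontfun h s)))"
      using clamp by (intro continuous_on_compose2[OF _ clamp_cont]) auto
    then show "continuous_on UNIV (\<Phi> h)" unfolding \<Phi>_def by (intro continuous_intros)
  qed (rule ball[OF that])
  \<comment> \<open>\<open>Bcontfun\<close> returns the given function only once it is known to be
    bounded and continuous, here for \<open>h\<close> in the ball.\<close>
  have app: "apply_bcontfun (Bcontfun (\<Phi> h)) = \<Phi> h" if "h \<in> cball 0 K" for h
    using Bcontfun_inverse[OF bc[OF that]] .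
  have "\<exists>!h. h \<in> cball 0 K \<and> Bcontfun (\<Phi> h) = h"
  proof (rule Banach_fix[where c = "1 / 2"])
    show "complete (cball (0 :: real \<Rightarrow>\<^sub>C 'a) K)" by (simp add: complete_eq_closed)
    show "cball (0 :: real \<Rightarrow>\<^sub>C 'a) K \<noteq> {}" using K by simp
    show "(\<lambda>h. Bcontfun (\<Phi> h)) ` cball 0 K \<subseteq> cball 0 K"
      using ball by (auto intro!: norm_bound simp: app)
    fix h k :: "real \<Rightarrow>\<^sub>C 'a" assume hk: "h \<in> cball 0 K" "k \<in> cball 0 K"
    have hK: "norm (apply_bcontfun h s) \<le> K" "norm (apply_bcontfun k s) \<le> K" for s
      using hk norm_bounded[of h s] norm_bounded[of k s] by auto
    show "dist (Bcontfun (\<Phi> h)) (Bcontfun (\<Phi> k)) \<le> 1 / 2 * dist h k"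
    proof (rule dist_bound)
      fix t
      have "\<Phi> h t - \<Phi> k t = integral {0..clamp t} (\<lambda>s. ipic s (apply_bcontfun h s)) - integral {0..clamp t} (\<lambda>s. ipic s (apply_bcontfun k s))"
        by (simp add: \<Phi>_def)
      also have "\<dots> = integral {0..clamp t} (\<lambda>s. ipic s (apply_bcontfun h s) - ipic s (apply_bcontfun k s))"
        by (intro Henstock_Kurzweil_Integration.integral_diff[symmetric] integrable_continuous_real continuous_on_ipic hc)
      finally have "norm (\<Phi> h t - \<Phi> k t) = norm \<dots>" by simp
      also have "\<dots> \<le> (\<Lambda> * dist h k) * clamp t"
      proof (rule int_bound)
        show "continuous_on {0..T} (\<lambda>s. ipic s (apply_bcontfun h s) - ipic s (apply_bcontfun k s))"
          by (intro continuous_intros continuous_on_ipic hc)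
        fix s
        have "norm (ipic s (apply_bcontfun h s) - ipic s (apply_bcontfun k s)) \<le> \<Lambda> * norm (apply_bcontfun h s - apply_bcontfun k s)"
          unfolding \<Lambda>_def by (rule ipic_lip[OF hK])
        also have "\<dots> \<le> \<Lambda> * dist h k"
          using dist_bounded[of h s k] \<Lambda> by (intro mult_left_mono) (simp_all add: dist_norm)
        finally show "norm (ipic s (apply_bcontfun h s) - ipic s (apply_bcontfun k s)) \<le> \<Lambda> * dist h k" .
      qed
      also have "\<dots> \<le> dist h k / 2" by (rule half[OF refl zero_le_dist])
      finally show "dist (apply_bcontfun (Bcontfun (\<Phi> h)) t) (apply_bcontfun (Bcontfun (\<Phi> k)) t) \<le> 1 / 2 * dist h k"
        by (simp add: app[OF hk(1)] app[OF hk(2)] dist_norm)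
    qed
  qed auto
  then obtain h where h: "h \<in> cball 0 K" "Bcontfun (\<Phi> h) = h" by blast
  have eq: "apply_bcontfun h = \<Phi> h" using app[OF h(1)] h(2) by simp
  show ?thesis
  proof (intro exI conjI ballI)
    show "ipic_solves T g0 (apply_bcontfun h)"
      unfolding ipic_solves_def
    proof (intro conjI ballI hc)
      fix t assume "t \<in> {0..T}"
      then show "apply_bcontfun h t = g0 + integral {0..t} (\<lambda>s. ipic s (apply_bcontfun h s))"
        using fun_cong[OF eq, of t] by (simp add: \<Phi>_def clamp_id)
    qed
    show "norm (apply_bcontfun h t) \<le> K" for t using ball[OF h(1), of t] by (simp add: eq)
  qed
qed

lemma solves_exists:
  assumes "0 \<le> T" "T * (L * (1 + K)\<^sup>2) \<le> 1 / 2" "2 * norm g0 \<le> K"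
  obtains g where "solves T g0 g" "\<And>t. t \<in> {0..T} \<Longrightarrow> norm (g t) \<le> K"
proof -
  obtain h where h: "ipic_solves T g0 h" "\<And>t. t \<in> {0..T} \<Longrightarrow> norm (h t) \<le> K"
    using ipic_exists[OF assms] by blast
  show ?thesis
    by (rule that[OF ipic_imp_solves[OF h(1)]]) (simp add: U_norm h(2))
qed

text \<open>At the time r of largest deviation, the difference of the two equations bounds this
  deviation by norm (g0 - k0) plus half of itself.\<close>

lemma solves_stable:
  assumes T: "0 \<le> T" and small: "T * (L * (1 + K)\<^sup>2) \<le> 1 / 2"
    and g0: "2 * norm g0 \<le> K" and k0: "2 * norm k0 \<le> K"
    and g: "solves T g0 g" and k: "solves T k0 k" and t: "t \<in> {0..T}"
  shows "norm (g t - k t) \<le> 2 * norm (g0 - k0)"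
proof -
  define h where "h t = U (- t) (g t)" for t
  define l where "l t = U (- t) (k t)" for t
  have hs: "ipic_solves T g0 h" unfolding h_def by (rule solves_imp_ipic[OF g])
  have ls: "ipic_solves T k0 l" unfolding l_def by (rule solves_imp_ipic[OF k])
  \<comment> \<open>An arbitrary solution carries no size bound; uniqueness identifies it with the
    constructed one, which stays in the ball of radius K.\<close>
  obtain h' where h': "ipic_solves T g0 h'" "\<And>t. t \<in> {0..T} \<Longrightarrow> norm (h' t) \<le> K"
    using ipic_exists[OF T small g0] by blast
  obtain l' where l': "ipic_solves T k0 l'" "\<And>t. t \<in> {0..T} \<Longrightarrow> norm (l' t) \<le> K"
    using ipic_exists[OF T small k0] by blast
  have hK: "norm (h t) \<le> K" and lK: "norm (l t) \<le> K" if "t \<in> {0..T}" for t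
    using ipic_unique[OF hs h'(1) that] ipic_unique[OF ls l'(1) that] h'(2)[OF that] l'(2)[OF that] by auto
  have ch: "continuous_on {0..T} h" and cl: "continuous_on {0..T} l"
    using hs ls by (auto simp: ipic_solves_def)
  have "continuous_on {0..T} (\<lambda>t. norm (h t - l t))" by (intro continuous_intros ch cl)
  then obtain r where r: "r \<in> {0..T}" "\<And>t. t \<in> {0..T} \<Longrightarrow> norm (h t - l t) \<le> norm (h r - l r)"
    using continuous_attains_sup[of "{0..T}" "\<lambda>t. norm (h t - l t)"] t by auto
  let ?m = "norm (h r - l r)" and ?\<Lambda> = "L * (1 + K)\<^sup>2"
  have \<Lambda>: "0 \<le> ?\<Lambda>" using L_pos by simp
  have sub: "{0..r} \<subseteq> {0..T}" using r(1) by auto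
  note ch' = continuous_on_subset[OF ch sub] and cl' = continuous_on_subset[OF cl sub]
  have "h r = g0 + integral {0..r} (\<lambda>s. ipic s (h s))" "l r = k0 + integral {0..r} (\<lambda>s. ipic s (l s))"
    using hs ls r(1) unfolding ipic_solves_def by blast+
  then have "h r - l r = (g0 - k0) + (integral {0..r} (\<lambda>s. ipic s (h s)) - integral {0..r} (\<lambda>s. ipic s (l s)))" by simp
  also have "integral {0..r} (\<lambda>s. ipic s (h s)) - integral {0..r} (\<lambda>s. ipic s (l s)) = integral {0..r} (\<lambda>s. ipic s (h s) - ipic s (l s))"
    by (intro Henstock_Kurzweil_Integration.integral_diff[symmetric] integrable_continuous_real continuous_on_ipic ch' cl')
  finally have "?m \<le> norm (g0 - k0) + norm (integral {0..r} (\<lambda>s. ipic s (h s) - ipic s (l s)))"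
    by (metis norm_triangle_ineq)
  also have "norm (integral {0..r} (\<lambda>s. ipic s (h s) - ipic s (l s))) \<le> (?\<Lambda> * ?m) * (r - 0)"
  proof (rule integral_bound)
    show "continuous_on {0..r} (\<lambda>s. ipic s (h s) - ipic s (l s))"
      by (intro continuous_intros continuous_on_ipic ch' cl')
    fix s assume "s \<in> {0..r}"
    then have s: "s \<in> {0..T}" using sub by auto
    show "norm (ipic s (h s) - ipic s (l s)) \<le> ?\<Lambda> * ?m"
      by (rule order_trans[OF ipic_lip[OF hK[OF s] lK[OF s]] mult_left_mono[OF r(2)[OF s] \<Lambda>]])
  qed (use r(1) in auto)
  also have "(?\<Lambda> * ?m) * (r - 0) \<le> (?\<Lambda> * ?m) * T"
    using r(1) mult_nonneg_nonneg[OF \<Lambda> norm_ge_zero[of "h r - l r"]] by (intro mult_left_mono) auto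
  also have "\<dots> = (T * ?\<Lambda>) * ?m" by simp
  also have "\<dots> \<le> (1 / 2) * ?m" by (intro mult_right_mono small) simp
  finally have "?m \<le> 2 * norm (g0 - k0)" by simp
  moreover have "norm (g t - k t) = norm (h t - l t)" by (simp add: h_def l_def U_diff[symmetric] U_norm)
  ultimately show ?thesis using r(2)[OF t] by linarith
qed

lemma solves_invariant:
  assumes R: "bounded_linear R" and RU: "\<And>t x. R (U t x) = U t (R x)" and RG: "\<And>x. R (G x) = G (R x)"
    and g: "solves T g0 g" and "R g0 = g0" and t: "t \<in> {0..T}"
  shows "R (g t) = g t"
proof -
  have cg: "continuous_on {0..T} g" using g by (simp add: solves_def)
  have "solves T g0 (\<lambda>t. R (g t))"
    unfolding solves_def
  proof (intro conjI ballI)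
    show "continuous_on {0..T} (\<lambda>t. R (g t))" by (rule bounded_linear.continuous_on[OF R cg])
    fix t assume t: "t \<in> {0..T}"
    then have cg': "continuous_on {0..t} g" using continuous_on_subset[OF cg] by auto
    have c: "continuous_on {0..t} (\<lambda>s. U (t - s) (G (g s)))"
      by (intro continuous_on_U continuous_on_G_comp continuous_intros cg')
    have "R (g t) = R (U t g0 + integral {0..t} (\<lambda>s. U (t - s) (G (g s))))"
      using g t unfolding solves_def by metis
    also have "\<dots> = R (U t g0) + R (integral {0..t} (\<lambda>s. U (t - s) (G (g s))))"
      using R by (rule linear_simps)
    also have "R (integral {0..t} (\<lambda>s. U (t - s) (G (g s)))) = integral {0..t} (\<lambda>s. R (U (t - s) (G (g s))))"
      using integral_linear[OF integrable_continuous_real[OF c] R] by (simp add: o_def)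
    finally show "R (g t) = U t g0 + integral {0..t} (\<lambda>s. U (t - s) (G (R (g s))))"
      by (simp add: RU RG \<open>R g0 = g0\<close>)
  qed
  from solves_unique[OF this g t] show ?thesis .
qed

end

section \<open>The nonlinearity\<close>

lemma l2_deriv_symbol_bound: "cmod (\<i> * of_real \<xi>) * jbracket \<xi> powr 1 \<le> 1 * jbracket \<xi> powr 2"
  unfolding jbracket_powr jbracket_sq[symmetric]
  using mult_right_mono[OF abs_le_jbracket[of \<xi>] less_imp_le[OF jbracket_pos[of \<xi>]]]
  by (simp add: norm_mult power2_eq_square)

lemma borel_measurable_deriv_symbol: "(\<lambda>\<xi>. \<i> * complex_of_real \<xi>) \<in> borel_measurable borel"
  by measurable

lemma l2_deriv_gevrey:
  assumes u: "u \<in> gevrey \<sigma> 2"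
  shows "l2_deriv u \<in> gevrey \<sigma> 1" "gevrey_norm \<sigma> 1 (l2_deriv u) \<le> gevrey_norm \<sigma> 2 u"
  using fourier_mult_gevrey[OF u borel_measurable_deriv_symbol _ l2_deriv_symbol_bound]
  unfolding l2_deriv_def by auto

lemma l2_deriv_sq_int: "u \<in> gevrey \<sigma> 2 \<Longrightarrow> sq_int (\<lambda>\<xi>. \<i> * of_real \<xi> * rep_l2 (fourier u) \<xi>)"
  by (rule sq_int_mult_gevrey(1)[OF _ borel_measurable_deriv_symbol _ l2_deriv_symbol_bound]) auto

lemma l2_deriv_diff: "u \<in> gevrey \<sigma> 2 \<Longrightarrow> v \<in> gevrey \<sigma> 2 \<Longrightarrow> l2_deriv (u - v) = l2_deriv u - l2_deriv v"
  unfolding l2_deriv_def by (intro fourier_mult_diff l2_deriv_sq_int)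

lemma l2_mult_gevrey_bound:
  assumes "u \<in> gevrey \<sigma> (s + 1)" "v \<in> gevrey \<sigma> (s + 1)" "s \<in> {0, 1}"
    and "gevrey_norm \<sigma> (s + 1) u \<le> a" "gevrey_norm \<sigma> (s + 1) v \<le> b"
  shows "gevrey_norm \<sigma> s (l2_mult u v) \<le> 4 * inv_jbracket_norm * a * b"
proof -
  \<comment> \<open>For the orders 0 and 1 the constant 2 sqrt(2)^s is at most 4, so one constant
    serves all products.\<close>
  have "sqrt 2 powr s \<le> 2"
    using assms(3) real_sqrt_le_mono[of 2 4] by auto
  moreover have "0 \<le> inv_jbracket_norm" by (simp add: inv_jbracket_norm_def)
  moreover have "0 \<le> a" "0 \<le> b"
    using assms(4,5) gevrey_norm_nonneg order_trans by blast+
  ultimately have "(2 * sqrt 2 powr s) * inv_jbracket_norm * gevrey_norm \<sigma> (s + 1) u * gevrey_norm \<sigma> (s + 1) v \<le>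
      (2 * 2) * inv_jbracket_norm * a * b"
    using assms(4,5) by (intro mult_mono mult_nonneg_nonneg gevrey_norm_nonneg) auto
  moreover have "0 \<le> s" using assms(3) by auto
  ultimately show ?thesis using order_trans[OF gevrey_l2_mult(2)[OF assms(1,2)]] by simp
qed

text \<open>The orders match the operators applied next: \<tau>(D) takes order 1 to order 2,
  \<psi>(D) takes order 0 to order 2. A product of two factors of order s + 1 has order s; the cubic
  term reaches order 0 because u and its square both have order 1.\<close>

lemma nonlin_terms_gevrey:
  assumes u: "u \<in> gevrey \<sigma> 2"
  shows "l2_mult u u \<in> gevrey \<sigma> 1" "l2_mult (l2_deriv u) (l2_deriv u) \<in> gevrey \<sigma> 0"
    "l2_mult u (l2_mult u u) \<in> gevrey \<sigma> 0"
proof -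
  show uu: "l2_mult u u \<in> gevrey \<sigma> 1" using gevrey_l2_mult(1)[of u \<sigma> 1 u] u by simp
  show "l2_mult (l2_deriv u) (l2_deriv u) \<in> gevrey \<sigma> 0"
    using gevrey_l2_mult(1)[of _ \<sigma> 0] l2_deriv_gevrey(1)[OF u] by simp
  show "l2_mult u (l2_mult u u) \<in> gevrey \<sigma> 0"
    using gevrey_l2_mult(1)[of u \<sigma> 0] gevrey_mono(1)[OF u, of 1] uu by simp
qed

section \<open>Symbol estimates and the Lipschitz bound for the nonlinearity\<close>

locale equation =
  fixes \<gamma>\<^sub>1 \<delta>\<^sub>1 \<gamma> \<gamma>\<^sub>2 \<delta>\<^sub>2 :: real
  assumes \<gamma>\<^sub>1: "\<gamma>\<^sub>1 > 0" and \<delta>\<^sub>1: "\<delta>\<^sub>1 > 0"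
begin

abbreviation "\<rho> \<equiv> varphi_sym \<gamma>\<^sub>1 \<delta>\<^sub>1"
abbreviation "\<tau> \<equiv> tau_sym \<gamma>\<^sub>1 \<delta>\<^sub>1 \<gamma>"
abbreviation "\<psi> \<equiv> psi_sym \<gamma>\<^sub>1 \<delta>\<^sub>1"
abbreviation "\<phi> \<equiv> phi_sym \<gamma>\<^sub>1 \<delta>\<^sub>1 \<gamma>\<^sub>2 \<delta>\<^sub>2"
abbreviation "\<tau>D \<equiv> fourier_mult (\<lambda>\<xi>. of_real (\<tau> \<xi>))"
abbreviation "\<psi>D \<equiv> fourier_mult (\<lambda>\<xi>. of_real (\<psi> \<xi>))"
abbreviation "F \<equiv> nonlin \<gamma>\<^sub>1 \<delta>\<^sub>1 \<gamma>"

lemma borel_measurable_symbols [measurable]: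
  "\<tau> \<in> borel_measurable borel" "\<psi> \<in> borel_measurable borel"
  "\<phi> \<in> borel_measurable borel"
  unfolding tau_sym_def[abs_def] psi_sym_def[abs_def] phi_sym_def[abs_def] varphi_sym_def by measurable

lemma varphi_sym_lower_bound:
  obtains m where "m > 0" "\<And>\<xi>. m * (jbracket \<xi>)^4 \<le> \<rho> \<xi>"
proof
  \<comment> \<open>The half compensates (1 + \<xi>^2)^2 <= 2 (1 + \<xi>^4); the minimum fits both
    the constant and the quartic coefficient of \<open>\<rho>\<close>.\<close>
  let ?m = "min 1 \<delta>\<^sub>1 / 2"
  show "?m > 0" using \<delta>\<^sub>1 by simp
  fix \<xi> :: real
  have "(jbracket \<xi>)^4 = (1 + \<xi>\<^sup>2)\<^sup>2"
    unfolding jbracket_sq[symmetric] by simp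
  also have "\<dots> \<le> 2 * (1 + \<xi>^4)"
    using zero_le_power2[of "1 - \<xi>\<^sup>2"] by (simp add: power2_eq_square power4_eq_xxxx algebra_simps)
  finally have "?m * (jbracket \<xi>)^4 \<le> ?m * (2 * (1 + \<xi>^4))"
    using \<open>?m > 0\<close> by (intro mult_left_mono) auto
  also have "\<dots> = min 1 \<delta>\<^sub>1 + min 1 \<delta>\<^sub>1 * \<xi>^4" by (simp add: algebra_simps)
  also have "\<dots> \<le> 1 + \<delta>\<^sub>1 * \<xi>^4" by (intro add_mono mult_right_mono) auto
  also have "\<dots> \<le> \<rho> \<xi>" using \<gamma>\<^sub>1 by (simp add: varphi_sym_def)
  finally show "?m * (jbracket \<xi>)^4 \<le> \<rho> \<xi>" .
qed

lemma symbol_bounds: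
  obtains C where "C > 0"
    "\<And>\<xi>. \<bar>\<tau> \<xi>\<bar> * jbracket \<xi> powr 2 \<le> C * jbracket \<xi> powr 1"
    "\<And>\<xi>. \<bar>\<psi> \<xi>\<bar> * jbracket \<xi> powr 2 \<le> C * jbracket \<xi> powr 0"
proof -
  obtain m where m: "m > 0" "\<And>\<xi>. m * (jbracket \<xi>)^4 \<le> \<rho> \<xi>"
    using varphi_sym_lower_bound by blast
  \<comment> \<open>One constant for both symbols: 3 + 4 |\<gamma>| times the square of
    \<open>jbracket\<close> bounds |3 - 4 \<gamma> \<xi>^2|, and 3 + 4 |\<gamma>| exceeds the
    numerator 1 that \<psi> requires.\<close>
  let ?C = "(3 + 4 * \<bar>\<gamma>\<bar>) / m"
  have jp: "0 < m * (jbracket \<xi>)^4" for \<xi>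
    by (intro mult_pos_pos zero_less_power m jbracket_pos)
  have psi: "\<bar>\<psi> \<xi>\<bar> \<le> jbracket \<xi> / (m * (jbracket \<xi>)^4)" for \<xi>
  proof -
    have "\<bar>\<psi> \<xi>\<bar> = \<bar>\<xi>\<bar> / \<rho> \<xi>"
      using m(2)[of \<xi>] jp[of \<xi>] by (simp add: psi_sym_def)
    also have "\<dots> \<le> jbracket \<xi> / (m * (jbracket \<xi>)^4)"
      by (intro frac_le abs_le_jbracket jp m(2)) (simp add: less_imp_le[OF jbracket_pos])
    finally show ?thesis .
  qed
  show ?thesis
  proof
    show "?C > 0" using m by (intro divide_pos_pos) auto
    fix \<xi>
    have "\<bar>\<psi> \<xi>\<bar> * (jbracket \<xi>)\<^sup>2 \<le> jbracket \<xi> / (m * (jbracket \<xi>)^4) * (jbracket \<xi>)\<^sup>2"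
      by (intro mult_right_mono psi) simp
    also have "\<dots> = 1 / (m * jbracket \<xi>)"
      using jbracket_pos[of \<xi>] m(1) by (simp add: field_simps eval_nat_numeral)
    also have "\<dots> \<le> (3 + 4 * \<bar>\<gamma>\<bar>) / m"
      using m(1) jbracket_ge_1[of \<xi>] by (intro frac_le) auto
    finally show "\<bar>\<psi> \<xi>\<bar> * jbracket \<xi> powr 2 \<le> ?C * jbracket \<xi> powr 0"
      by (simp only: jbracket_powr jbracket_sq)
    have "\<bar>3 - 4 * \<gamma> * \<xi>\<^sup>2\<bar> \<le> 3 + 4 * \<bar>\<gamma>\<bar> * \<xi>\<^sup>2"
      by (rule order_trans[OF abs_triangle_ineq4]) (simp add: abs_mult)
    also have "\<dots> \<le> (3 + 4 * \<bar>\<gamma>\<bar>) * (jbracket \<xi>)\<^sup>2"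
      unfolding jbracket_sq by (simp add: algebra_simps)
    finally have n: "\<bar>3 - 4 * \<gamma> * \<xi>\<^sup>2\<bar> \<le> (3 + 4 * \<bar>\<gamma>\<bar>) * (jbracket \<xi>)\<^sup>2" .
    have tau: "\<bar>\<tau> \<xi>\<bar> = \<bar>\<psi> \<xi>\<bar> * \<bar>3 - 4 * \<gamma> * \<xi>\<^sup>2\<bar> / 4"
      by (simp add: tau_sym_def psi_sym_def abs_mult)
    have "\<bar>\<tau> \<xi>\<bar> \<le> \<bar>\<psi> \<xi>\<bar> * \<bar>3 - 4 * \<gamma> * \<xi>\<^sup>2\<bar>"
      unfolding tau using mult_nonneg_nonneg[OF abs_ge_zero[of "\<psi> \<xi>"] abs_ge_zero[of "3 - 4 * \<gamma> * \<xi>\<^sup>2"]] by linarith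
    then have "\<bar>\<tau> \<xi>\<bar> * (jbracket \<xi>)\<^sup>2 \<le>
        \<bar>\<psi> \<xi>\<bar> * \<bar>3 - 4 * \<gamma> * \<xi>\<^sup>2\<bar> * (jbracket \<xi>)\<^sup>2"
      by (rule mult_right_mono) simp
    also have "\<dots> \<le> (jbracket \<xi> / (m * (jbracket \<xi>)^4)) * ((3 + 4 * \<bar>\<gamma>\<bar>) * (jbracket \<xi>)\<^sup>2) * (jbracket \<xi>)\<^sup>2"
      by (intro mult_right_mono mult_mono psi n) (auto simp: less_imp_le[OF jp] less_imp_le[OF jbracket_pos])
    also have "\<dots> = ?C * jbracket \<xi>"
      using jbracket_pos[of \<xi>] m(1) by (simp add: field_simps eval_nat_numeral)
    finally show "\<bar>\<tau> \<xi>\<bar> * jbracket \<xi> powr 2 \<le> ?C * jbracket \<xi> powr 1"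
      by (simp only: jbracket_powr jbracket_sq)
  qed
qed

lemma multiplier_bounds:
  obtains C where "C > 0"
    "\<And>\<sigma> w. w \<in> gevrey \<sigma> 1 \<Longrightarrow> \<tau>D w \<in> gevrey \<sigma> 2"
    "\<And>\<sigma> w. w \<in> gevrey \<sigma> 1 \<Longrightarrow> gevrey_norm \<sigma> 2 (\<tau>D w) \<le> C * gevrey_norm \<sigma> 1 w"
    "\<And>\<sigma> w. w \<in> gevrey \<sigma> 1 \<Longrightarrow> sq_int (\<lambda>\<xi>. of_real (\<tau> \<xi>) * rep_l2 (fourier w) \<xi>)"
    "\<And>\<sigma> w. w \<in> gevrey \<sigma> 0 \<Longrightarrow> \<psi>D w \<in> gevrey \<sigma> 2"
    "\<And>\<sigma> w. w \<in> gevrey \<sigma> 0 \<Longrightarrow> gevrey_norm \<sigma> 2 (\<psi>D w) \<le> C * gevrey_norm \<sigma> 0 w"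
    "\<And>\<sigma> w. w \<in> gevrey \<sigma> 0 \<Longrightarrow> sq_int (\<lambda>\<xi>. of_real (\<psi> \<xi>) * rep_l2 (fourier w) \<xi>)"
proof -
  obtain C where C: "C > 0"
    "\<And>\<xi>. \<bar>\<tau> \<xi>\<bar> * jbracket \<xi> powr 2 \<le> C * jbracket \<xi> powr 1"
    "\<And>\<xi>. \<bar>\<psi> \<xi>\<bar> * jbracket \<xi> powr 2 \<le> C * jbracket \<xi> powr 0"
    using symbol_bounds by metis
  have m: "(\<lambda>\<xi>. complex_of_real (\<tau> \<xi>)) \<in> borel_measurable borel"
    "(\<lambda>\<xi>. complex_of_real (\<psi> \<xi>)) \<in> borel_measurable borel" by measurable
  have Cc: "cmod (of_real (\<tau> \<xi>)) * jbracket \<xi> powr 2 \<le> C * jbracket \<xi> powr 1"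
    "cmod (of_real (\<psi> \<xi>)) * jbracket \<xi> powr 2 \<le> C * jbracket \<xi> powr 0" for \<xi>
    using C(2,3) by (simp_all only: norm_of_real)
  show ?thesis
    by (rule that[OF C(1)]; (rule fourier_mult_gevrey[OF _ m(1) _ Cc(1)] sq_int_mult_gevrey(1)[OF _ m(1) _ Cc(1)]
        fourier_mult_gevrey[OF _ m(2) _ Cc(2)] sq_int_mult_gevrey(1)[OF _ m(2) _ Cc(2)])?; simp?)
qed

lemma nonlin_gevrey: "u \<in> gevrey \<sigma> 2 \<Longrightarrow> F u \<in> gevrey \<sigma> 2"
  by (rule multiplier_bounds) (simp add: nonlin_def gevrey_diff(1) gevrey_scaleR(1) nonlin_terms_gevrey)

text \<open>Squares, of u and of its derivative, are compared through (u + v)(u - v). The quadratic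
  terms give a factor K and the cubic term K^2; (1 + K)^2 dominates both. \<sigma> is quantified
  after \<open>L\<close>.\<close>

lemma nonlin_lipschitz:
  obtains L where "L > 0"
    "\<And>\<sigma> u v K. u \<in> gevrey \<sigma> 2 \<Longrightarrow> v \<in> gevrey \<sigma> 2 \<Longrightarrow> gevrey_norm \<sigma> 2 u \<le> K \<Longrightarrow> gevrey_norm \<sigma> 2 v \<le> K \<Longrightarrow>
      gevrey_norm \<sigma> 2 (F u - F v) \<le> L * (1 + K)\<^sup>2 * gevrey_norm \<sigma> 2 (u - v)"
proof -
  obtain C where C: "C > 0" and T: "\<And>\<sigma> w. w \<in> gevrey \<sigma> 1 \<Longrightarrow> \<tau>D w \<in> gevrey \<sigma> 2"
    "\<And>\<sigma> w. w \<in> gevrey \<sigma> 1 \<Longrightarrow> gevrey_norm \<sigma> 2 (\<tau>D w) \<le> C * gevrey_norm \<sigma> 1 w"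
    "\<And>\<sigma> w. w \<in> gevrey \<sigma> 1 \<Longrightarrow> sq_int (\<lambda>\<xi>. of_real (\<tau> \<xi>) * rep_l2 (fourier w) \<xi>)"
    and P: "\<And>\<sigma> w. w \<in> gevrey \<sigma> 0 \<Longrightarrow> \<psi>D w \<in> gevrey \<sigma> 2"
    "\<And>\<sigma> w. w \<in> gevrey \<sigma> 0 \<Longrightarrow> gevrey_norm \<sigma> 2 (\<psi>D w) \<le> C * gevrey_norm \<sigma> 0 w"
    "\<And>\<sigma> w. w \<in> gevrey \<sigma> 0 \<Longrightarrow> sq_int (\<lambda>\<xi>. of_real (\<psi> \<xi>) * rep_l2 (fourier w) \<xi>)"
    by (rule multiplier_bounds) blast
  define B where "B = 4 * inv_jbracket_norm"
  have B: "0 \<le> B" by (simp add: B_def inv_jbracket_norm_def)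
  show ?thesis
  proof
    \<comment> \<open>The two quadratic terms contribute 2 B K each and the cubic one 3 B^2 K^2, all
      times C from the multipliers; the added 1 guarantees positivity.\<close>
    show "C * (4 * B + 3 * B\<^sup>2) + 1 > 0"
      using C B by (intro add_nonneg_pos mult_nonneg_nonneg add_nonneg_nonneg) auto
    fix \<sigma> u v K
    assume u: "u \<in> gevrey \<sigma> 2" and v: "v \<in> gevrey \<sigma> 2" and Ku: "gevrey_norm \<sigma> 2 u \<le> K" and Kv: "gevrey_norm \<sigma> 2 v \<le> K"
    let ?D = "gevrey_norm \<sigma> 2 (u - v)"
    have K: "0 \<le> K" using Ku gevrey_norm_nonneg order_trans by blast
    have D: "0 \<le> ?D" by (rule gevrey_norm_nonneg)
    note u1 = gevrey_mono[OF u, of 1, simplified] and v1 = gevrey_mono[OF v, of 1, simplified]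
    note d = gevrey_diff(1)[OF u v]
    note d1 = gevrey_mono[OF d, of 1, simplified]
    note ux = l2_deriv_gevrey[OF u] and vx = l2_deriv_gevrey[OF v]
    note tu = nonlin_terms_gevrey[OF u] and tv = nonlin_terms_gevrey[OF v]
    have s: "gevrey_norm \<sigma> 2 (u + v) \<le> 2 * K" "gevrey_norm \<sigma> 1 (l2_deriv u + l2_deriv v) \<le> 2 * K"
      using gevrey_add(2)[OF u v] gevrey_add(2)[OF ux(1) vx(1)] ux(2) vx(2) Ku Kv by linarith+
    have dx: "gevrey_norm \<sigma> 1 (l2_deriv u - l2_deriv v) \<le> ?D"
      using l2_deriv_gevrey(2)[OF d] by (simp add: l2_deriv_diff[OF u v])
    have sqd: "gevrey_norm \<sigma> 1 (l2_mult u u - l2_mult v v) \<le> B * (2 * K) * ?D"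
      using l2_mult_gevrey_bound[of "u + v" \<sigma> 1 "u - v" "2 * K" ?D] gevrey_add(1)[OF u v] d s(1)
      by (simp add: l2_mult_square_diff[OF u1(1) v1(1)] B_def)
    have sqx: "gevrey_norm \<sigma> 0 (l2_mult (l2_deriv u) (l2_deriv u) - l2_mult (l2_deriv v) (l2_deriv v)) \<le> B * (2 * K) * ?D"
      using l2_mult_gevrey_bound[of "l2_deriv u + l2_deriv v" \<sigma> 0 "l2_deriv u - l2_deriv v" "2 * K" ?D]
        gevrey_add(1)[OF ux(1) vx(1)] gevrey_diff(1)[OF ux(1) vx(1)] s(2) dx
      by (simp add: l2_mult_square_diff[OF ux(1) vx(1)] B_def)
    have cub: "gevrey_norm \<sigma> 0 (l2_mult u (l2_mult u u) - l2_mult v (l2_mult v v)) \<le> 3 * B\<^sup>2 * K\<^sup>2 * ?D"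
    proof -
      have uv1: "l2_mult u u - l2_mult v v \<in> gevrey \<sigma> 1" by (rule gevrey_diff(1)[OF tu(1) tv(1)])
      have "l2_mult (u - v) (l2_mult u u) = l2_mult u (l2_mult u u) - l2_mult v (l2_mult u u)"
        by (rule l2_mult_diff_left[OF u1(1) v1(1) tu(1)])
      moreover have "l2_mult v (l2_mult u u - l2_mult v v) = l2_mult v (l2_mult u u) - l2_mult v (l2_mult v v)"
        by (rule l2_mult_diff_right[OF v1(1) tu(1) tv(1)])
      \<comment> \<open>Telescoping: one factor u is replaced first, then the square. The two parts
        give one and two copies of B^2 K^2, hence the factor 3.\<close>
      ultimately have eq: "l2_mult u (l2_mult u u) - l2_mult v (l2_mult v v) =
          l2_mult (u - v) (l2_mult u u) + l2_mult v (l2_mult u u - l2_mult v v)" by simp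
      have uu: "gevrey_norm \<sigma> 1 (l2_mult u u) \<le> B * K * K"
        using l2_mult_gevrey_bound[of u \<sigma> 1 u K K] u Ku by (simp add: B_def)
      have "gevrey_norm \<sigma> 0 (l2_mult (u - v) (l2_mult u u)) \<le> B * ?D * (B * K * K)"
        using l2_mult_gevrey_bound[of "u - v" \<sigma> 0 "l2_mult u u" ?D "B * K * K"] d1 tu(1) uu by (simp add: B_def)
      moreover have "gevrey_norm \<sigma> 0 (l2_mult v (l2_mult u u - l2_mult v v)) \<le> B * K * (B * (2 * K) * ?D)"
        using l2_mult_gevrey_bound[of v \<sigma> 0 "l2_mult u u - l2_mult v v" K "B * (2 * K) * ?D"] v1 uv1 Kv sqd by (simp add: B_def)
      moreover have "l2_mult (u - v) (l2_mult u u) \<in> gevrey \<sigma> 0" "l2_mult v (l2_mult u u - l2_mult v v) \<in> gevrey \<sigma> 0"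
        using gevrey_l2_mult(1)[of "u - v" \<sigma> 0] gevrey_l2_mult(1)[of v \<sigma> 0] d1(1) tu(1) v1(1) uv1 by auto
      note gevrey_add(2)[OF this]
      ultimately have "gevrey_norm \<sigma> 0 (l2_mult u (l2_mult u u) - l2_mult v (l2_mult v v)) \<le>
          B * ?D * (B * K * K) + B * K * (B * (2 * K) * ?D)"
        unfolding eq by linarith
      then show ?thesis by (simp add: power2_eq_square algebra_simps)
    qed
    let ?a = "\<tau>D (l2_mult u u) - \<tau>D (l2_mult v v)"
    let ?b = "\<psi>D (l2_mult (l2_deriv u) (l2_deriv u)) - \<psi>D (l2_mult (l2_deriv v) (l2_deriv v))"
    let ?c = "\<psi>D (l2_mult u (l2_mult u u)) - \<psi>D (l2_mult v (l2_mult v v))"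
    have a: "?a \<in> gevrey \<sigma> 2" "gevrey_norm \<sigma> 2 ?a \<le> C * (B * (2 * K) * ?D)"
    proof -
      have eq: "?a = \<tau>D (l2_mult u u - l2_mult v v)"
        by (rule fourier_mult_diff[symmetric, OF T(3)[OF tu(1)] T(3)[OF tv(1)]])
      note w = gevrey_diff(1)[OF tu(1) tv(1)]
      show "?a \<in> gevrey \<sigma> 2" unfolding eq by (rule T(1)[OF w])
      show "gevrey_norm \<sigma> 2 ?a \<le> C * (B * (2 * K) * ?D)"
        unfolding eq by (rule order_trans[OF T(2)[OF w] mult_left_mono[OF sqd less_imp_le[OF C]]])
    qed
    have b: "?b \<in> gevrey \<sigma> 2" "gevrey_norm \<sigma> 2 ?b \<le> C * (B * (2 * K) * ?D)"
    proof -
      have eq: "?b = \<psi>D (l2_mult (l2_deriv u) (l2_deriv u) - l2_mult (l2_deriv v) (l2_deriv v))"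
        by (rule fourier_mult_diff[symmetric, OF P(3)[OF tu(2)] P(3)[OF tv(2)]])
      note w = gevrey_diff(1)[OF tu(2) tv(2)]
      show "?b \<in> gevrey \<sigma> 2" unfolding eq by (rule P(1)[OF w])
      show "gevrey_norm \<sigma> 2 ?b \<le> C * (B * (2 * K) * ?D)"
        unfolding eq by (rule order_trans[OF P(2)[OF w] mult_left_mono[OF sqx less_imp_le[OF C]]])
    qed
    have c: "?c \<in> gevrey \<sigma> 2" "gevrey_norm \<sigma> 2 ?c \<le> C * (3 * B\<^sup>2 * K\<^sup>2 * ?D)"
    proof -
      have eq: "?c = \<psi>D (l2_mult u (l2_mult u u) - l2_mult v (l2_mult v v))"
        by (rule fourier_mult_diff[symmetric, OF P(3)[OF tu(3)] P(3)[OF tv(3)]])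
      note w = gevrey_diff(1)[OF tu(3) tv(3)]
      show "?c \<in> gevrey \<sigma> 2" unfolding eq by (rule P(1)[OF w])
      show "gevrey_norm \<sigma> 2 ?c \<le> C * (3 * B\<^sup>2 * K\<^sup>2 * ?D)"
        unfolding eq by (rule order_trans[OF P(2)[OF w] mult_left_mono[OF cub less_imp_le[OF C]]])
    qed
    have "F u - F v = ?a - (7/48) *\<^sub>R ?b - (1/8) *\<^sub>R ?c"
      unfolding nonlin_def by (simp add: scaleR_diff_right)
    then have "gevrey_norm \<sigma> 2 (F u - F v) \<le>
        gevrey_norm \<sigma> 2 ?a + (7/48) * gevrey_norm \<sigma> 2 ?b + (1/8) * gevrey_norm \<sigma> 2 ?c"
      using gevrey_diff(2)[OF gevrey_diff(1)[OF a(1) gevrey_scaleR(1)[OF b(1), of "7/48"]] gevrey_scaleR(1)[OF c(1), of "1/8"]]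
        gevrey_diff(2)[OF a(1) gevrey_scaleR(1)[OF b(1), of "7/48"]]
        gevrey_scaleR(2)[OF b(1), of "7/48"] gevrey_scaleR(2)[OF c(1), of "1/8"]
      by simp
    \<comment> \<open>The coefficients 7/48 and 1/8 are replaced by 1.\<close>
    also have "\<dots> \<le> C * (B * (2 * K) * ?D) + C * (B * (2 * K) * ?D) + C * (3 * B\<^sup>2 * K\<^sup>2 * ?D)"
      using a(2) b(2) c(2) gevrey_norm_nonneg[of \<sigma> 2 ?b] gevrey_norm_nonneg[of \<sigma> 2 ?c] by linarith
    also have "\<dots> = (C * (4 * B) * K + C * (3 * B\<^sup>2) * K\<^sup>2) * ?D"
      by (simp add: algebra_simps)
    also have "\<dots> \<le> (C * (4 * B) * (1 + K)\<^sup>2 + C * (3 * B\<^sup>2) * (1 + K)\<^sup>2) * ?D"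
    proof -
      have "K \<le> (1 + K)\<^sup>2" "K\<^sup>2 \<le> (1 + K)\<^sup>2"
        using K by (simp_all add: power2_eq_square algebra_simps)
      then show ?thesis using C B D by (intro mult_right_mono add_mono mult_left_mono) auto
    qed
    also have "\<dots> \<le> (C * (4 * B + 3 * B\<^sup>2) + 1) * (1 + K)\<^sup>2 * ?D"
      using D by (intro mult_right_mono) (simp_all add: algebra_simps)
    finally show "gevrey_norm \<sigma> 2 (F u - F v) \<le>
        (C * (4 * B + 3 * B\<^sup>2) + 1) * (1 + K)\<^sup>2 * ?D" .
  qed
qed

text \<open>\<tau> and \<psi> are real and odd, so their operators anticommute with conjugation,
  while the derivative commutes with it. The sign is compensated by the factor -i in the
  equation.\<close>

lemma nonlin_cnj:
  assumes u: "u \<in> gevrey \<sigma> 2"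
  shows "F (l2_cnj u) = - l2_cnj (F u)"
proof -
  have m: "(\<lambda>\<xi>. complex_of_real (\<tau> \<xi>)) \<in> borel_measurable borel"
    "(\<lambda>\<xi>. complex_of_real (\<psi> \<xi>)) \<in> borel_measurable borel" by measurable
  have sq: "w \<in> gevrey \<sigma> 1 \<Longrightarrow> sq_int (\<lambda>\<xi>. of_real (\<tau> \<xi>) * rep_l2 (fourier w) \<xi>)"
    "w \<in> gevrey \<sigma> 0 \<Longrightarrow> sq_int (\<lambda>\<xi>. of_real (\<psi> \<xi>) * rep_l2 (fourier w) \<xi>)" for w
    by (rule multiplier_bounds, blast)+
  have odd: "\<tau> (- \<xi>) = - \<tau> \<xi>" "\<psi> (- \<xi>) = - \<psi> \<xi>" for \<xi>
    by (simp_all add: tau_sym_def psi_sym_def varphi_sym_def)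
  have T: "\<tau>D (l2_cnj w) = - l2_cnj (\<tau>D w)" if "w \<in> gevrey \<sigma> 1" for w
    using fourier_mult_cnj[OF sq(1)[OF that] m(1), of "-1"]
    by (simp add: odd l2_cscale_minus_one minus_equation_iff[of _ "l2_cnj _"])
  have P: "\<psi>D (l2_cnj w) = - l2_cnj (\<psi>D w)" if "w \<in> gevrey \<sigma> 0" for w
    using fourier_mult_cnj[OF sq(2)[OF that] m(2), of "-1"]
    by (simp add: odd l2_cscale_minus_one minus_equation_iff[of _ "l2_cnj _"])
  have X: "l2_deriv (l2_cnj u) = l2_cnj (l2_deriv u)"
    using fourier_mult_cnj[OF l2_deriv_sq_int[OF u] borel_measurable_deriv_symbol, of 1] l2_cscale_of_real[of 1]
    by (simp add: l2_deriv_def)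
  note u1 = gevrey_mono(1)[OF u, of 1, simplified] and ux = l2_deriv_gevrey(1)[OF u]
  note tu = nonlin_terms_gevrey[OF u]
  interpret c: bounded_linear l2_cnj by (rule bounded_linear_cnj_l2)
  show ?thesis
    unfolding nonlin_def X l2_cnj_mult[OF u1 u1, symmetric] l2_cnj_mult[OF ux ux, symmetric]
      l2_cnj_mult[OF u1 tu(1), symmetric] T[OF tu(1)] P[OF tu(2)] P[OF tu(3)]
    by (simp add: c.diff c.scaleR)
qed

lemma nonlin_zero: "F 0 = 0"
  by (simp add: nonlin_def l2_mult_zero l2_deriv_def fourier_mult_zero)

lemma phi_sym_odd: "\<phi> (- \<xi>) = - \<phi> \<xi>"
  by (simp add: phi_sym_def varphi_sym_def)

end

section \<open>The Cauchy problem in Gevrey spaces\<close>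

text \<open>The Lipschitz bound is assumed with \<open>L\<close> as a parameter instead of being
  obtained inside, which allows one \<open>L\<close> to be shared by all \<sigma>.\<close>

locale gevrey_problem = equation +
  fixes L \<sigma> :: real
  assumes L: "L > 0"
    and nonlin_lip: "\<And>u v K. u \<in> gevrey \<sigma> 2 \<Longrightarrow> v \<in> gevrey \<sigma> 2 \<Longrightarrow> gevrey_norm \<sigma> 2 u \<le> K \<Longrightarrow>
      gevrey_norm \<sigma> 2 v \<le> K \<Longrightarrow>
      gevrey_norm \<sigma> 2 (F u - F v) \<le> L * (1 + K)\<^sup>2 * gevrey_norm \<sigma> 2 (u - v)"
begin

abbreviation "S \<equiv> lin_group \<gamma>\<^sub>1 \<delta>\<^sub>1 \<gamma>\<^sub>2 \<delta>\<^sub>2"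
abbreviation "U \<equiv> phase \<phi>"
abbreviation "E \<equiv> l2_to_gevrey \<sigma> 2"
abbreviation "W \<equiv> gevrey_to_l2 \<sigma> 2"
abbreviation "gnorm \<equiv> gevrey_norm \<sigma> 2"
abbreviation "is_sol \<equiv> is_solution \<gamma>\<^sub>1 \<delta>\<^sub>1 \<gamma> \<gamma>\<^sub>2 \<delta>\<^sub>2 \<sigma>"
abbreviation "sol \<equiv> solution_map \<gamma>\<^sub>1 \<delta>\<^sub>1 \<gamma> \<gamma>\<^sub>2 \<delta>\<^sub>2 \<sigma>"

definition G :: "l2 \<Rightarrow> l2" where
  "G g = l2_cscale (- \<i>) (W (F (E g)))"

lemma lin_group_l2_to_gevrey:
  "S t (E g) = E (U t g)"
  unfolding lin_group_def by (intro fourier_mult_l2_to_gevrey borel_measurable_symbols) simp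

lemma l2_to_gevrey_G:
  "E (G g) = l2_cscale (- \<i>) (F (E g))"
  unfolding G_def
  by (simp add: l2_to_gevrey_cscale l2_to_gevrey_to_l2 nonlin_gevrey l2_to_gevrey(1))

text \<open>\<open>E\<close> carries the L^2 norm to the Gevrey norm and -i has modulus 1, so the
  Lipschitz bound for \<open>F\<close> passes to \<open>G\<close> with the same constant.\<close>

sublocale duhamel U G L
proof (rule duhamel.intro)
  fix s t :: real and x y :: l2 and K :: real
  show "bounded_linear (U t)" by (intro bounded_linear_phase borel_measurable_symbols)
  show "norm (U t x) = norm x" by (intro norm_phase borel_measurable_symbols)
  show "U s (U t x) = U (s + t) x" by (intro phase_add borel_measurable_symbols)
  show "U 0 x = x" by (intro phase_0 borel_measurable_symbols)
  show "continuous_on UNIV (\<lambda>t. U t x)" by (intro continuous_on_phase borel_measurable_symbols)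
  show "0 < L" by (rule L)
  have E0: "E 0 = 0" by (rule linear_simps(3)[OF bounded_linear_l2_to_gevrey]) simp
  have "E (G 0) = E 0"
    unfolding l2_to_gevrey_G E0 nonlin_zero by (rule linear_simps(3)[OF bounded_linear_cscale])
  then show "G 0 = 0" by (simp add: l2_to_gevrey_inject)
  assume K: "norm x \<le> K" "norm y \<le> K"
  have "norm (G x - G y) = gnorm (E (G x) - E (G y))"
    by (simp add: gevrey_norm_l2_to_gevrey_diff)
  also have "\<dots> = gnorm (l2_cscale (- \<i>) (F (E x) - F (E y)))"
    unfolding l2_to_gevrey_G by (simp add: linear_simps(2)[OF bounded_linear_cscale])
  also have "\<dots> = gnorm (F (E x) - F (E y))"
    by (subst gevrey_cscale(2)) (simp_all add: gevrey_diff(1) nonlin_gevrey l2_to_gevrey(1))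
  also have "\<dots> \<le> L * (1 + K)\<^sup>2 * gnorm (E x - E y)"
    using K by (intro nonlin_lip) (simp_all add: l2_to_gevrey)
  finally show "norm (G x - G y) \<le> L * (1 + K)\<^sup>2 * norm (x - y)"
    by (simp add: gevrey_norm_l2_to_gevrey_diff)
qed

text \<open>Two signs cancel: conjugation turns -i into i, and by \<open>nonlin_cnj\<close> it
  anticommutes with \<open>F\<close>.\<close>

lemma star_G: "l2_star (G g) = G (l2_star g)"
proof -
  have "E (l2_star (G g)) = l2_cnj (l2_cscale (- \<i>) (F (E g)))"
    by (simp add: l2_cnj_l2_to_gevrey[symmetric] l2_to_gevrey_G)
  also have "\<dots> = l2_cscale \<i> (l2_cscale (-1) (F (l2_cnj (E g))))"
    by (simp add: cnj_cscale nonlin_cnj[OF l2_to_gevrey(1)] l2_cscale_minus_one)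
  also have "\<dots> = E (G (l2_star g))"
    by (simp add: cscale_cscale l2_to_gevrey_G l2_cnj_l2_to_gevrey)
  finally show ?thesis by (simp add: l2_to_gevrey_inject)
qed

text \<open>The integral on the left is formed in the ambient L^2, the one on the right in the
  weighted copy; \<open>E\<close> is bounded and linear and therefore passes through the
  integral.\<close>

lemma duhamel_integral:
  assumes g: "continuous_on {0..T} g" and \<eta>: "\<And>s. s \<in> {0..T} \<Longrightarrow> \<eta> s = E (g s)"
    and \<eta>0: "\<eta>0 \<in> gevrey \<sigma> 2" and t: "t \<in> {0..T}"
  shows "(\<lambda>s. S (t - s) (F (\<eta> s))) integrable_on {0..t}"
    and "S t \<eta>0 - l2_cscale \<i> (integral {0..t}
        (\<lambda>s. S (t - s) (F (\<eta> s)))) =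
      E (U t (W \<eta>0) + integral {0..t} (\<lambda>s. U (t - s) (G (g s))))"
proof -
  let ?f = "\<lambda>s. U (t - s) (G (g s))"
  \<comment> \<open>\<open>F\<close> after \<open>E\<close> equals \<open>?A\<close> after
    \<open>G\<close>. The outer factor i combines with this one to -1, which turns the minus sign of
    the equation into plus.\<close>
  let ?A = "\<lambda>h. l2_cscale \<i> (E h)"
  have lin: "bounded_linear ?A"
    by (intro bounded_linear_compose[OF bounded_linear_cscale] bounded_linear_l2_to_gevrey) simp
  have "continuous_on {0..t} g" using t by (intro continuous_on_subset[OF g]) auto
  then have "continuous_on {0..t} ?f"
    by (intro continuous_on_U continuous_on_G_comp continuous_intros)
  then have f: "?f integrable_on {0..t}" by (rule integrable_continuous_real)
  have nl: "F (E x) = ?A (G x)" for x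
    by (simp add: l2_to_gevrey_G cscale_cscale cscale_one)
  have eq: "S (t - s) (F (\<eta> s)) = ?A (?f s)" if "s \<in> {0..t}" for s
  proof -
  have "s \<in> {0..T}" using that t by auto
    then have "S (t - s) (F (\<eta> s)) =
        S (t - s) (E (l2_cscale \<i> (G (g s))))"
      by (simp add: \<eta> nl l2_to_gevrey_cscale)
    also have "\<dots> = ?A (?f s)"
      unfolding lin_group_l2_to_gevrey phase_cscale[OF borel_measurable_symbols(3)]
      by (rule l2_to_gevrey_cscale) simp
    finally show ?thesis .
  qed
  have "(\<lambda>s. ?A (?f s)) integrable_on {0..t}"
    using integrable_linear[OF f lin] by (simp add: o_def)
  then show "(\<lambda>s. S (t - s) (F (\<eta> s))) integrable_on {0..t}"
    using integrable_cong[of "{0..t}", OF eq] by simp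
  have "integral {0..t} (\<lambda>s. S (t - s) (F (\<eta> s))) = integral {0..t} (\<lambda>s. ?A (?f s))"
    by (rule Henstock_Kurzweil_Integration.integral_cong) (rule eq)
  also have "\<dots> = ?A (integral {0..t} ?f)"
    using integral_linear[OF f lin] by (simp add: o_def)
  finally have I: "integral {0..t} (\<lambda>s. S (t - s) (F (\<eta> s))) = ?A (integral {0..t} ?f)" .
  have "S t \<eta>0 = E (U t (W \<eta>0))"
    using lin_group_l2_to_gevrey[of t "W \<eta>0"] by (simp add: l2_to_gevrey_to_l2 \<eta>0)
  then show "S t \<eta>0 - l2_cscale \<i> (integral {0..t}
        (\<lambda>s. S (t - s) (F (\<eta> s)))) =
      E (U t (W \<eta>0) + integral {0..t} ?f)"
    unfolding I by (simp add: cscale_cscale l2_cscale_minus_one linear_simps(1)[OF bounded_linear_l2_to_gevrey[of 2 \<sigma>]])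
qed

lemma continuous_iff_gevrey:
  assumes \<eta>: "\<And>s. s \<in> {0..T} \<Longrightarrow> \<eta> s = E (g s)"
  shows "(\<forall>t\<in>{0..T}. ((\<lambda>r. gnorm (\<eta> r - \<eta> t)) \<longlongrightarrow> 0) (at t within {0..T})) \<longleftrightarrow> continuous_on {0..T} g"
proof -
  have "((\<lambda>r. gnorm (\<eta> r - \<eta> t)) \<longlongrightarrow> 0) (at t within {0..T}) \<longleftrightarrow> (g \<longlongrightarrow> g t) (at t within {0..T})"
    if t: "t \<in> {0..T}" for t
  proof -
  have "\<forall>\<^sub>F r in at t within {0..T}. r \<in> {0..T}" by (simp add: eventually_at_filter)
    then have "\<forall>\<^sub>F r in at t within {0..T}. gnorm (\<eta> r - \<eta> t) = norm (g r - g t)"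
      by eventually_elim (simp only: \<eta> t gevrey_norm_l2_to_gevrey_diff)
    then have "((\<lambda>r. gnorm (\<eta> r - \<eta> t)) \<longlongrightarrow> 0) (at t within {0..T}) \<longleftrightarrow>
        ((\<lambda>r. norm (g r - g t)) \<longlongrightarrow> 0) (at t within {0..T})"
      by (rule tendsto_cong)
    also have "\<dots> \<longleftrightarrow> (g \<longlongrightarrow> g t) (at t within {0..T})"
      by (simp only: tendsto_norm_zero_iff Lim_null[symmetric])
    finally show ?thesis .
  qed
  then show ?thesis by (simp add: continuous_on_def)
qed

lemma is_solution_imp_solves:
  assumes \<eta>0: "\<eta>0 \<in> gevrey \<sigma> 2" and sol: "is_sol T \<eta>0 \<eta>"
  shows "solves T (W \<eta>0) (\<lambda>t. W (\<eta> t))"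
    and "\<And>t. t \<in> {0..T} \<Longrightarrow> \<eta> t = E (W (\<eta> t))"
proof -
  let ?g = "\<lambda>t. W (\<eta> t)"
  show \<eta>: "\<eta> t = E (?g t)" if "t \<in> {0..T}" for t
    using sol that by (intro l2_to_gevrey_to_l2[symmetric]) (auto simp: is_solution_def C_gevrey_def)
  have c: "continuous_on {0..T} ?g"
    using sol by (subst continuous_iff_gevrey[OF \<eta>, symmetric]) (auto simp: is_solution_def C_gevrey_def)
  show "solves T (W \<eta>0) ?g"
    unfolding solves_def
  proof (intro conjI ballI c)
    fix t assume t: "t \<in> {0..T}"
    have "E (?g t) = \<eta> t" by (rule \<eta>[OF t, symmetric])
    also have "\<eta> t = S t \<eta>0 - l2_cscale \<i> (integral {0..t}
        (\<lambda>s. S (t - s) (F (\<eta> s))))"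
      using sol t unfolding is_solution_def by blast
    also have "\<dots> = E (U t (W \<eta>0) + integral {0..t} (\<lambda>s. U (t - s) (G (?g s))))"
      by (rule duhamel_integral(2)[OF c \<eta> \<eta>0 t])
    finally have "E (?g t) = E (U t (W \<eta>0) + integral {0..t} (\<lambda>s. U (t - s) (G (?g s))))" .
    then show "?g t = U t (W \<eta>0) + integral {0..t} (\<lambda>s. U (t - s) (G (?g s)))"
      by (simp add: l2_to_gevrey_inject)
  qed
qed

text \<open>Reality must be proved for the constructed solution: real data are fixed by
  \<open>l2_star\<close> in the weighted copy, and \<open>solves_invariant\<close> carries this to
  all times. Restriction to [0, T] meets the extensionality in \<open>C_gevrey\<close>, on which
  uniqueness as a function of time rests.\<close>

lemma solves_imp_is_solution:
  assumes \<eta>0: "\<eta>0 \<in> gevrey \<sigma> 2" "real_valued \<eta>0"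
    and sol: "solves T (W \<eta>0) g"
  shows "is_sol T \<eta>0 (restrict (\<lambda>t. E (g t)) {0..T})"
proof -
  let ?\<eta> = "restrict (\<lambda>t. E (g t)) {0..T}"
  have \<eta>: "?\<eta> t = E (g t)" if "t \<in> {0..T}" for t using that by simp
  have c: "continuous_on {0..T} g" using sol by (simp add: solves_def)
  have "E (l2_star (W \<eta>0)) = E (W \<eta>0)"
    using \<eta>0 by (simp add: l2_cnj_l2_to_gevrey[symmetric] l2_to_gevrey_to_l2 real_valued_iff)
  then have star0: "l2_star (W \<eta>0) = W \<eta>0" by (simp add: l2_to_gevrey_inject)
  have star_U: "l2_star (U t x) = U t (l2_star x)" for t x
    by (rule star_phase[OF borel_measurable_symbols(3) phi_sym_odd])
  have star: "l2_star (g t) = g t" if "t \<in> {0..T}" for t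
    by (rule solves_invariant[OF bounded_linear_star_l2 star_U star_G sol star0 that])
  show ?thesis
    unfolding is_solution_def
  proof (intro conjI ballI)
    show "?\<eta> \<in> C_gevrey T \<sigma> 2"
      unfolding C_gevrey_def using continuous_iff_gevrey[of T ?\<eta> g, OF \<eta>] c by (auto simp: l2_to_gevrey(1))
    fix t assume t: "t \<in> {0..T}"
    show "real_valued (?\<eta> t)"
      unfolding real_valued_iff \<eta>[OF t] by (simp add: l2_cnj_l2_to_gevrey star[OF t])
    show "(\<lambda>s. S (t - s) (F (?\<eta> s))) integrable_on {0..t}"
      by (rule duhamel_integral(1)[OF c \<eta> \<eta>0(1) t])
    have "g t = U t (W \<eta>0) + integral {0..t} (\<lambda>s. U (t - s) (G (g s)))"
      using sol t unfolding solves_def by blast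
    then have "?\<eta> t = E (U t (W \<eta>0) + integral {0..t} (\<lambda>s. U (t - s) (G (g s))))"
      unfolding \<eta>[OF t] by (rule arg_cong)
    also have "\<dots> = S t \<eta>0 - l2_cscale \<i> (integral {0..t}
        (\<lambda>s. S (t - s) (F (?\<eta> s))))"
      by (rule duhamel_integral(2)[OF c \<eta> \<eta>0(1) t, symmetric])
    finally show "?\<eta> t = S t \<eta>0 - l2_cscale \<i> (integral {0..t}
        (\<lambda>s. S (t - s) (F (?\<eta> s))))" .
  qed
qed

text \<open>Verifies the smallness condition of \<open>ipic_exists\<close> for the radius K = 2 (1 +
  R), a radius admissible for all data of norm at most R.\<close>

lemma existence_time:
  assumes "0 \<le> R"
  shows "1 / (18 * L) / (1 + R)\<^sup>2 * (L * (1 + 2 * (1 + R))\<^sup>2) \<le> 1 / 2"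
proof -
  have "(1 + 2 * (1 + R))\<^sup>2 \<le> (3 * (1 + R))\<^sup>2" using assms by (intro power_mono) auto
  also have "\<dots> = 9 * (1 + R)\<^sup>2" by (simp only: power_mult_distrib) simp
  finally show ?thesis using L assms by (simp add: field_simps)
qed

text \<open>\<open>T\<close> depends on the data through the bound \<open>R\<close> only. The norm
  of the data as \<open>R\<close> gives the individual existence time; a fixed \<open>R\<close>
  gives a common time on a ball.\<close>

lemma well_posed:
  assumes R: "0 \<le> R" and \<eta>0: "\<eta>0 \<in> data_ball \<sigma> R"
  defines "T \<equiv> 1 / (18 * L) / (1 + R)\<^sup>2"
  shows "\<exists>!\<eta>. is_sol T \<eta>0 \<eta>"
proof -
  have g0: "\<eta>0 \<in> gevrey \<sigma> 2" "real_valued \<eta>0" "2 * norm (W \<eta>0) \<le> 2 * (1 + R)"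
    using \<eta>0 norm_gevrey_to_l2[of \<eta>0 \<sigma>] by (auto simp: data_ball_def)
  have "0 \<le> T" using L by (simp add: T_def)
  obtain g where g: "solves T (W \<eta>0) g"
    using solves_exists[OF \<open>0 \<le> T\<close> existence_time[OF R, folded T_def] g0(3)] by blast
  show ?thesis
  proof (rule ex1I)
    show "is_sol T \<eta>0 (restrict (\<lambda>t. E (g t)) {0..T})"
      by (rule solves_imp_is_solution[OF g0(1,2) g])
    fix \<eta> assume sol: "is_sol T \<eta>0 \<eta>"
    have "\<eta> t = E (g t)" if "t \<in> {0..T}" for t
      using is_solution_imp_solves(2)[OF g0(1) sol that] solves_unique[OF is_solution_imp_solves(1)[OF g0(1) sol] g that]
      by simp
    moreover have "\<eta> \<in> extensional {0..T}" using sol by (simp add: is_solution_def C_gevrey_def)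
    ultimately show "\<eta> = restrict (\<lambda>t. E (g t)) {0..T}"
      by (intro extensionalityI[of _ "{0..T}"]) auto
  qed
qed

text \<open>On the common time interval \<open>solution_map\<close> denotes the unique solution for
  all data in the ball, so the abstract stability estimate applies at each t and passes to the
  supremum.\<close>

lemma solution_map_lipschitz:
  assumes R: "0 \<le> R" and \<eta>0: "\<eta>0 \<in> data_ball \<sigma> R" and \<zeta>0: "\<zeta>0 \<in> data_ball \<sigma> R"
  defines "T \<equiv> 1 / (18 * L) / (1 + R)\<^sup>2"
  shows "C_gevrey_dist T \<sigma> 2 (sol T \<zeta>0) (sol T \<eta>0) \<le>
    2 * gnorm (\<zeta>0 - \<eta>0)"
proof -
  have sol: "is_sol T \<theta>0 (sol T \<theta>0)" if "\<theta>0 \<in> data_ball \<sigma> R" for \<theta>0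
    unfolding solution_map_def T_def by (rule theI'[OF well_posed[OF R that]])
  have data: "\<theta>0 \<in> gevrey \<sigma> 2" "2 * norm (W \<theta>0) \<le> 2 * (1 + R)" if "\<theta>0 \<in> data_ball \<sigma> R" for \<theta>0
    using that norm_gevrey_to_l2[of \<theta>0 \<sigma>] by (auto simp: data_ball_def)
  note s\<eta> = is_solution_imp_solves[OF data(1)[OF \<eta>0] sol[OF \<eta>0]]
  note s\<zeta> = is_solution_imp_solves[OF data(1)[OF \<zeta>0] sol[OF \<zeta>0]]
  have T: "0 \<le> T" using L by (simp add: T_def)
  show ?thesis
    unfolding C_gevrey_dist_def
  proof (rule cSUP_least)
    show "{0..T} \<noteq> {}" using T by simp
    fix t assume t: "t \<in> {0..T}"
    have "gnorm (sol T \<zeta>0 t - sol T \<eta>0 t) =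
        norm (W (sol T \<zeta>0 t) - W (sol T \<eta>0 t))"
      by (subst s\<zeta>(2)[OF t], subst s\<eta>(2)[OF t]) (rule gevrey_norm_l2_to_gevrey_diff)
    also have "\<dots> \<le> 2 * norm (W \<zeta>0 - W \<eta>0)"
      by (rule solves_stable[OF T existence_time[OF R, folded T_def] data(2)[OF \<zeta>0] data(2)[OF \<eta>0] s\<zeta>(1) s\<eta>(1) t])
    also have "norm (W \<zeta>0 - W \<eta>0) = gnorm (\<zeta>0 - \<eta>0)"
      using gevrey_norm_l2_to_gevrey_diff[of \<sigma> "W \<zeta>0" "W \<eta>0"]
      by (simp add: l2_to_gevrey_to_l2 data(1)[OF \<eta>0] data(1)[OF \<zeta>0])
    finally show "gnorm (sol T \<zeta>0 t - sol T \<eta>0 t) \<le>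
      2 * gnorm (\<zeta>0 - \<eta>0)" .
  qed
qed

end

theorem theorem2:
  fixes \<gamma>\<^sub>1 \<delta>\<^sub>1 \<gamma> \<gamma>\<^sub>2 \<delta>\<^sub>2 :: real
  assumes "\<gamma>\<^sub>1 > 0" and "\<delta>\<^sub>1 > 0"
  shows "\<exists>c>0. \<forall>\<sigma>\<^sub>0>0.
    (\<forall>\<eta>\<^sub>0 \<in> gevrey \<sigma>\<^sub>0 2. real_valued \<eta>\<^sub>0 \<longrightarrow>
      (\<exists>!\<eta>. is_solution \<gamma>\<^sub>1 \<delta>\<^sub>1 \<gamma> \<gamma>\<^sub>2 \<delta>\<^sub>2 \<sigma>\<^sub>0 (c / (1 + gevrey_norm \<sigma>\<^sub>0 2 \<eta>\<^sub>0)\<^sup>2) \<eta>\<^sub>0 \<eta>)) \<and>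
    (\<forall>R>0. let T = c / (1 + R)\<^sup>2 in
      \<forall>\<eta>\<^sub>0 \<in> data_ball \<sigma>\<^sub>0 R.
        (\<exists>!\<eta>. is_solution \<gamma>\<^sub>1 \<delta>\<^sub>1 \<gamma> \<gamma>\<^sub>2 \<delta>\<^sub>2 \<sigma>\<^sub>0 T \<eta>\<^sub>0 \<eta>) \<and>
        (\<forall>\<epsilon>>0. \<exists>d>0. \<forall>\<zeta>\<^sub>0 \<in> data_ball \<sigma>\<^sub>0 R. gevrey_norm \<sigma>\<^sub>0 2 (\<zeta>\<^sub>0 - \<eta>\<^sub>0) < d \<longrightarrow>
          C_gevrey_dist T \<sigma>\<^sub>0 2
            (solution_map \<gamma>\<^sub>1 \<delta>\<^sub>1 \<gamma> \<gamma>\<^sub>2 \<delta>\<^sub>2 \<sigma>\<^sub>0 T \<zeta>\<^sub>0)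
            (solution_map \<gamma>\<^sub>1 \<delta>\<^sub>1 \<gamma> \<gamma>\<^sub>2 \<delta>\<^sub>2 \<sigma>\<^sub>0 T \<eta>\<^sub>0) < \<epsilon>))"
proof -
  interpret equation \<gamma>\<^sub>1 \<delta>\<^sub>1 \<gamma> \<gamma>\<^sub>2 \<delta>\<^sub>2
    by unfold_locales (use assms in auto)
  obtain L where L: "L > 0"
    "\<And>\<sigma> u v K. u \<in> gevrey \<sigma> 2 \<Longrightarrow> v \<in> gevrey \<sigma> 2 \<Longrightarrow> gevrey_norm \<sigma> 2 u \<le> K \<Longrightarrow> gevrey_norm \<sigma> 2 v \<le> K \<Longrightarrow>
      gevrey_norm \<sigma> 2 (F u - F v) \<le> L * (1 + K)\<^sup>2 * gevrey_norm \<sigma> 2 (u - v)"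
    using nonlin_lipschitz by metis
  show ?thesis
  proof (rule exI[of _ "1 / (18 * L)"], intro conjI[of "0 < _"] allI impI)
    show "1 / (18 * L) > 0" using L(1) by simp
    fix \<sigma> :: real
    interpret gevrey_problem \<gamma>\<^sub>1 \<delta>\<^sub>1 \<gamma> \<gamma>\<^sub>2 \<delta>\<^sub>2 L \<sigma>
      by unfold_locales (use L in auto)
    have "\<exists>!\<eta>. is_sol (1 / (18 * L) / (1 + gnorm \<eta>0)\<^sup>2) \<eta>0 \<eta>" if "\<eta>0 \<in> gevrey \<sigma> 2" "real_valued \<eta>0" for \<eta>0
      using that by (intro well_posed gevrey_norm_nonneg) (simp add: data_ball_def)
    moreover have "let T = 1 / (18 * L) / (1 + R)\<^sup>2 in \<forall>\<eta>0 \<in> data_ball \<sigma> R. (\<exists>!\<eta>. is_sol T \<eta>0 \<eta>) \<and>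
        (\<forall>\<epsilon>>0. \<exists>d>0. \<forall>\<zeta>0 \<in> data_ball \<sigma> R. gnorm (\<zeta>0 - \<eta>0) < d \<longrightarrow> C_gevrey_dist T \<sigma> 2 (sol T \<zeta>0) (sol T \<eta>0) < \<epsilon>)"
      if "R > 0" for R
      unfolding Let_def
    proof (intro ballI conjI allI impI)
      have R: "0 \<le> R" using that by simp
      fix \<eta>0 assume \<eta>0: "\<eta>0 \<in> data_ball \<sigma> R"
      show "\<exists>!\<eta>. is_sol (1 / (18 * L) / (1 + R)\<^sup>2) \<eta>0 \<eta>" by (rule well_posed[OF R \<eta>0])
      fix \<epsilon> :: real assume "\<epsilon> > 0"
      \<comment> \<open>The Lipschitz constant 2 explains the choice d = \<epsilon>/2.\<close>
      then show "\<exists>d>0. \<forall>\<zeta>0 \<in> data_ball \<sigma> R. gnorm (\<zeta>0 - \<eta>0) < d \<longrightarrow>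
          C_gevrey_dist (1 / (18 * L) / (1 + R)\<^sup>2) \<sigma> 2 (sol (1 / (18 * L) / (1 + R)\<^sup>2) \<zeta>0) (sol (1 / (18 * L) / (1 + R)\<^sup>2) \<eta>0) < \<epsilon>"
        using solution_map_lipschitz[OF R \<eta>0] by (intro exI[of _ "\<epsilon> / 2"]) fastforce
    qed
    ultimately show "(\<forall>\<eta>0 \<in> gevrey \<sigma> 2. real_valued \<eta>0 \<longrightarrow> (\<exists>!\<eta>. is_sol (1 / (18 * L) / (1 + gnorm \<eta>0)\<^sup>2) \<eta>0 \<eta>)) \<and>
      (\<forall>R>0. let T = 1 / (18 * L) / (1 + R)\<^sup>2 in \<forall>\<eta>0 \<in> data_ball \<sigma> R. (\<exists>!\<eta>. is_sol T \<eta>0 \<eta>) \<and>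
        (\<forall>\<epsilon>>0. \<exists>d>0. \<forall>\<zeta>0 \<in> data_ball \<sigma> R. gnorm (\<zeta>0 - \<eta>0) < d \<longrightarrow> C_gevrey_dist T \<sigma> 2 (sol T \<zeta>0) (sol T \<eta>0) < \<epsilon>))"
      by blast
  qed
qed

end
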